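(* Let $B,C$ be small categories and let $F:C\rightarrow B$ be a functor. Assume that $C$ has finite limits and that $F$ preserves finite limits. Then (assuming the axiom of choice) the following are equivalent. (1) $F$ is an equivalence of categories. (2) $F$ is a universal equivalence; that is, the Quillen adjunction $F_{*}:\mathrm{U}(C)\rightleftarrows\mathrm{U}(B):F^{*}$ is a Quillen equivalence.
   Context: For a small category $A$, $\mathrm{sPSh}(A)=\mathrm{sSet}^{A^{\mathrm{op}}}$ is the category of simplicial presheaves on $A$, and $\mathrm{U}(A)$ is $\mathrm{sPSh}(A)$ with the Bousfield-Kan (projective) model structure, in which weak equivalences and fibrations are the objectwise ones. A functor $F:C\to B$ between small categories induces a Quillen adjunction $F_{*}:\mathrm{U}(C)\rightleftarrows\mathrm{U}(B):F^{*}$ (the universal adjunction of $F$), where $F^*Y=Y\circ F$ and $F_*X(b)=\operatorname{colim}_{\langle c,\,b\to Fc\rangle\in (b\downarrow F)^{\mathrm{op}}}X(c)$. $F$ is called a universal equivalence if its universal adjunction is a Quillen equivalence. *)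

theory Defs
  imports "HOL-Analysis.Analysis" "HOL-Homology.Simplices"
begin

section \<open>Categories, functors, natural transformations\<close>

text \<open>\<open>Comp C g f\<close> is the composite of \<open>g\<close> after \<open>f\<close>; its value is only
  meaningful when \<open>Cod C f = Dom C g\<close>.\<close>

record ('o, 'm) cat =
  Obj :: "'o set"
  Arr :: "'m set"
  Dom :: "'m \<Rightarrow> 'o"
  Cod :: "'m \<Rightarrow> 'o"
  Ide :: "'o \<Rightarrow> 'm"
  Comp :: "'m \<Rightarrow> 'm \<Rightarrow> 'm"

definition Hom :: "('o, 'm) cat \<Rightarrow> 'o \<Rightarrow> 'o \<Rightarrow> 'm set" where
  "Hom C x y = {f \<in> Arr C. Dom C f = x \<and> Cod C f = y}"

locale category =
  fixes C :: "('o, 'm) cat"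
  assumes Dom_in: "f \<in> Arr C \<Longrightarrow> Dom C f \<in> Obj C"
    and Cod_in: "f \<in> Arr C \<Longrightarrow> Cod C f \<in> Obj C"
    and Ide_in: "x \<in> Obj C \<Longrightarrow> Ide C x \<in> Hom C x x"
    and Comp_in: "f \<in> Hom C x y \<Longrightarrow> g \<in> Hom C y z \<Longrightarrow> Comp C g f \<in> Hom C x z"
    and Comp_Ide: "f \<in> Hom C x y \<Longrightarrow> Comp C f (Ide C x) = f"
    and Ide_Comp: "f \<in> Hom C x y \<Longrightarrow> Comp C (Ide C y) f = f"
    and Comp_assoc: "f \<in> Hom C w x \<Longrightarrow> g \<in> Hom C x y \<Longrightarrow> h \<in> Hom C y z \<Longrightarrow>
           Comp C h (Comp C g f) = Comp C (Comp C h g) f"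

definition op_cat :: "('o, 'm) cat \<Rightarrow> ('o, 'm) cat" where
  "op_cat C = \<lparr>Obj = Obj C, Arr = Arr C, Dom = Cod C, Cod = Dom C, Ide = Ide C,
               Comp = (\<lambda>g f. Comp C f g)\<rparr>"

definition is_iso :: "('o, 'm) cat \<Rightarrow> 'm \<Rightarrow> bool" where
  "is_iso C f \<longleftrightarrow> f \<in> Arr C \<and>
     (\<exists>g \<in> Hom C (Cod C f) (Dom C f).
        Comp C g f = Ide C (Dom C f) \<and> Comp C f g = Ide C (Cod C f))"

record ('o, 'm, 'p, 'n) ftor =
  fobj :: "'o \<Rightarrow> 'p"
  farr :: "'m \<Rightarrow> 'n"

locale cat_functor =
  fixes C :: "('o, 'm) cat" and D :: "('p, 'n) cat" and F :: "('o, 'm, 'p, 'n) ftor"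
  assumes fobj_in: "x \<in> Obj C \<Longrightarrow> fobj F x \<in> Obj D"
    and farr_in: "f \<in> Hom C x y \<Longrightarrow> farr F f \<in> Hom D (fobj F x) (fobj F y)"
    and farr_Ide: "x \<in> Obj C \<Longrightarrow> farr F (Ide C x) = Ide D (fobj F x)"
    and farr_Comp: "f \<in> Hom C x y \<Longrightarrow> g \<in> Hom C y z \<Longrightarrow>
           farr F (Comp C g f) = Comp D (farr F g) (farr F f)"

definition ftor_id :: "('o, 'm) cat \<Rightarrow> ('o, 'm, 'o, 'm) ftor" where
  "ftor_id C = \<lparr>fobj = (\<lambda>x\<in>Obj C. x), farr = (\<lambda>f\<in>Arr C. f)\<rparr>"

text \<open>\<open>C\<close> is the source of \<open>F\<close>.  Since \<open>op_cat C\<close> has the objects and arrows of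
  \<open>C\<close>, a functor \<open>C \<rightarrow> D\<close> is, as a record, also a functor \<open>op_cat C \<rightarrow> op_cat D\<close>.\<close>

definition ftor_comp ::
  "('o, 'm) cat \<Rightarrow> ('p, 'n, 'q, 'k) ftor \<Rightarrow> ('o, 'm, 'p, 'n) ftor \<Rightarrow> ('o, 'm, 'q, 'k) ftor" where
  "ftor_comp C G F =
     \<lparr>fobj = (\<lambda>x\<in>Obj C. fobj G (fobj F x)), farr = (\<lambda>f\<in>Arr C. farr G (farr F f))\<rparr>"

definition nat_trans ::
  "('o, 'm) cat \<Rightarrow> ('p, 'n) cat \<Rightarrow> ('o, 'm, 'p, 'n) ftor \<Rightarrow> ('o, 'm, 'p, 'n) ftor \<Rightarrow>
   ('o \<Rightarrow> 'n) \<Rightarrow> bool" where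
  "nat_trans C D F G \<alpha> \<longleftrightarrow>
     (\<forall>x \<in> Obj C. \<alpha> x \<in> Hom D (fobj F x) (fobj G x)) \<and>
     (\<forall>f \<in> Arr C. Comp D (farr G f) (\<alpha> (Dom C f)) = Comp D (\<alpha> (Cod C f)) (farr F f))"

definition naturally_iso ::
  "('o, 'm) cat \<Rightarrow> ('p, 'n) cat \<Rightarrow> ('o, 'm, 'p, 'n) ftor \<Rightarrow> ('o, 'm, 'p, 'n) ftor \<Rightarrow> bool" where
  "naturally_iso C D F G \<longleftrightarrow>
     (\<exists>\<alpha>. nat_trans C D F G \<alpha> \<and> (\<forall>x \<in> Obj C. is_iso D (\<alpha> x)))"

definition equivalence_of_categories ::
  "('o, 'm) cat \<Rightarrow> ('p, 'n) cat \<Rightarrow> ('o, 'm, 'p, 'n) ftor \<Rightarrow> bool" where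
  "equivalence_of_categories C D F \<longleftrightarrow> cat_functor C D F \<and>
     (\<exists>G. cat_functor D C G \<and>
        naturally_iso C C (ftor_comp C G F) (ftor_id C) \<and>
        naturally_iso D D (ftor_comp D F G) (ftor_id D))"

text \<open>Functors and natural transformations are extensional outside their domains, so that
  equality in the functor category is equality of the mathematical objects.\<close>

definition functor_cat ::
  "('o, 'm) cat \<Rightarrow> ('p, 'n) cat \<Rightarrow>
   (('o, 'm, 'p, 'n) ftor, ('o, 'm, 'p, 'n) ftor \<times> ('o \<Rightarrow> 'n) \<times> ('o, 'm, 'p, 'n) ftor) cat" where
  "functor_cat C D =
     (let Fs = {F. cat_functor C D F \<and> fobj F \<in> extensional (Obj C) \<and>
                   farr F \<in> extensional (Arr C)}
      in \<lparr>Obj = Fs,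
          Arr = {(F, \<alpha>, G). F \<in> Fs \<and> G \<in> Fs \<and> nat_trans C D F G \<alpha> \<and>
                            \<alpha> \<in> extensional (Obj C)},
          Dom = fst,
          Cod = (\<lambda>t. snd (snd t)),
          Ide = (\<lambda>F. (F, (\<lambda>x\<in>Obj C. Ide D (fobj F x)), F)),
          Comp = (\<lambda>t s. (fst s, (\<lambda>x\<in>Obj C. Comp D (fst (snd t) x) (fst (snd s) x)),
                         snd (snd t)))\<rparr>)"

section \<open>Limits and colimits\<close>

definition is_cone ::
  "('j, 'i) cat \<Rightarrow> ('o, 'm) cat \<Rightarrow> ('j, 'i, 'o, 'm) ftor \<Rightarrow> 'o \<Rightarrow> ('j \<Rightarrow> 'm) \<Rightarrow> bool" where
  "is_cone J C D l p \<longleftrightarrow> l \<in> Obj C \<and> (\<forall>j \<in> Obj J. p j \<in> Hom C l (fobj D j)) \<and>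
     (\<forall>f \<in> Arr J. Comp C (farr D f) (p (Dom J f)) = p (Cod J f))"

definition is_limit ::
  "('j, 'i) cat \<Rightarrow> ('o, 'm) cat \<Rightarrow> ('j, 'i, 'o, 'm) ftor \<Rightarrow> 'o \<Rightarrow> ('j \<Rightarrow> 'm) \<Rightarrow> bool" where
  "is_limit J C D l p \<longleftrightarrow> is_cone J C D l p \<and>
     (\<forall>l' p'. is_cone J C D l' p' \<longrightarrow>
        (\<exists>!u. u \<in> Hom C l' l \<and> (\<forall>j \<in> Obj J. Comp C (p j) u = p' j)))"

definition is_cocone ::
  "('j, 'i) cat \<Rightarrow> ('o, 'm) cat \<Rightarrow> ('j, 'i, 'o, 'm) ftor \<Rightarrow> 'o \<Rightarrow> ('j \<Rightarrow> 'm) \<Rightarrow> bool" where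
  "is_cocone J C D l p \<longleftrightarrow> l \<in> Obj C \<and> (\<forall>j \<in> Obj J. p j \<in> Hom C (fobj D j) l) \<and>
     (\<forall>f \<in> Arr J. Comp C (p (Cod J f)) (farr D f) = p (Dom J f))"

definition is_colimit ::
  "('j, 'i) cat \<Rightarrow> ('o, 'm) cat \<Rightarrow> ('j, 'i, 'o, 'm) ftor \<Rightarrow> 'o \<Rightarrow> ('j \<Rightarrow> 'm) \<Rightarrow> bool" where
  "is_colimit J C D l p \<longleftrightarrow> is_cocone J C D l p \<and>
     (\<forall>l' p'. is_cocone J C D l' p' \<longrightarrow>
        (\<exists>!u. u \<in> Hom C l l' \<and> (\<forall>j \<in> Obj J. Comp C u (p j) = p' j)))"

definition colimit ::
  "('j, 'i) cat \<Rightarrow> ('o, 'm) cat \<Rightarrow> ('j, 'i, 'o, 'm) ftor \<Rightarrow> 'o \<times> ('j \<Rightarrow> 'm)" where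
  "colimit J C D = (SOME (l, p). is_colimit J C D l p)"

definition is_initial :: "('o, 'm) cat \<Rightarrow> 'o \<Rightarrow> bool" where
  "is_initial C x \<longleftrightarrow> x \<in> Obj C \<and> (\<forall>y \<in> Obj C. \<exists>!f. f \<in> Hom C x y)"

definition is_terminal :: "('o, 'm) cat \<Rightarrow> 'o \<Rightarrow> bool" where
  "is_terminal C x \<longleftrightarrow> x \<in> Obj C \<and> (\<forall>y \<in> Obj C. \<exists>!f. f \<in> Hom C y x)"

text \<open>Every finite category is isomorphic to one whose objects and arrows are natural numbers,
  so quantifying over the type \<open>(nat, nat) cat\<close> loses no finite diagram shape.\<close>

definition finite_category :: "(nat, nat) cat \<Rightarrow> bool" where
  "finite_category J \<longleftrightarrow> category J \<and> finite (Obj J) \<and> finite (Arr J)"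

definition has_finite_limits :: "('o, 'm) cat \<Rightarrow> bool" where
  "has_finite_limits C \<longleftrightarrow>
     (\<forall>J D. finite_category J \<longrightarrow> cat_functor J C D \<longrightarrow> (\<exists>l p. is_limit J C D l p))"

definition preserves_finite_limits ::
  "('o, 'm) cat \<Rightarrow> ('p, 'n) cat \<Rightarrow> ('o, 'm, 'p, 'n) ftor \<Rightarrow> bool" where
  "preserves_finite_limits C B F \<longleftrightarrow>
     (\<forall>J D l p. finite_category J \<longrightarrow> cat_functor J C D \<longrightarrow> is_limit J C D l p \<longrightarrow>
        is_limit J B (ftor_comp J F D) (fobj F l) (\<lambda>j. farr F (p j)))"

section \<open>Sets and simplicial sets\<close>

text \<open>The type \<open>'u\<close> plays the role of the universe: the small sets are the subsets of \<open>'u\<close>,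
  i.e. up to bijection the sets of cardinality at most that of \<open>'u\<close>.  It will always be assumed
  infinite.\<close>

type_synonym 'u set_arr = "'u set \<times> ('u \<Rightarrow> 'u) \<times> 'u set"

definition SET :: "('u set, 'u set_arr) cat" where
  "SET = \<lparr>Obj = UNIV,
          Arr = {(A, f, B). f \<in> A \<rightarrow>\<^sub>E B},
          Dom = fst,
          Cod = (\<lambda>t. snd (snd t)),
          Ide = (\<lambda>A. (A, (\<lambda>x\<in>A. x), A)),
          Comp = (\<lambda>t s. (fst s, compose (fst s) (fst (snd t)) (fst (snd s)), snd (snd t)))\<rparr>"

definition small :: "'u itself \<Rightarrow> ('o, 'm) cat \<Rightarrow> bool" where
  "small (_ :: 'u itself) C \<longleftrightarrow> Obj C \<lesssim> (UNIV :: 'u set) \<and> Arr C \<lesssim> (UNIV :: 'u set)"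

text \<open>The object \<open>n\<close> of \<open>DELTA\<close> is the ordinal \<open>[n] = {0, \<dots>, n}\<close>, represented by \<open>{..n}\<close>.\<close>

type_synonym delta_arr = "nat \<times> (nat \<Rightarrow> nat) \<times> nat"

definition DELTA :: "(nat, delta_arr) cat" where
  "DELTA = \<lparr>Obj = UNIV,
            Arr = {(m, \<theta>, n). \<theta> \<in> {..m} \<rightarrow>\<^sub>E {..n} \<and> mono_on {..m} \<theta>},
            Dom = fst,
            Cod = (\<lambda>t. snd (snd t)),
            Ide = (\<lambda>n. (n, (\<lambda>i\<in>{..n}. i), n)),
            Comp = (\<lambda>t s. (fst s, compose {..fst s} (fst (snd t)) (fst (snd s)), snd (snd t)))\<rparr>"

type_synonym 'u sset = "(nat, delta_arr, 'u set, 'u set_arr) ftor"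
type_synonym 'u sset_map = "'u sset \<times> (nat \<Rightarrow> 'u set_arr) \<times> 'u sset"

definition sSet :: "('u sset, 'u sset_map) cat" where
  "sSet = functor_cat (op_cat DELTA) SET"

definition act :: "'u sset \<Rightarrow> delta_arr \<Rightarrow> 'u \<Rightarrow> 'u" where
  "act X \<theta> = fst (snd (farr X \<theta>))"

definition level :: "'u sset_map \<Rightarrow> nat \<Rightarrow> 'u \<Rightarrow> 'u" where
  "level f n = fst (snd (fst (snd f) n))"

text \<open>\<open>face X n i\<close> is \<open>d\<^sub>i : X\<^sub>n\<^sub>+\<^sub>1 \<rightarrow> X\<^sub>n\<close>, induced by the injection
  \<open>[n] \<rightarrow> [n+1]\<close> omitting \<open>i\<close>.\<close>

definition face :: "'u sset \<Rightarrow> nat \<Rightarrow> nat \<Rightarrow> 'u \<Rightarrow> 'u" where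
  "face X n i = act X (n, (\<lambda>j\<in>{..n}. if j < i then j else Suc j), Suc n)"

text \<open>The family \<open>x\<close> is a horn \<open>\<Lambda>\<^sup>n\<^sub>k \<rightarrow> X\<close>.  For \<open>n = 1\<close> the compatibility
  condition is vacuous.\<close>

definition kan_fibration :: "'u sset_map \<Rightarrow> bool" where
  "kan_fibration p \<longleftrightarrow> p \<in> Arr sSet \<and>
     (let X = fst p; Y = snd (snd p) in
      \<forall>n \<ge> 1. \<forall>k \<le> n. \<forall>x. \<forall>y \<in> fobj Y n.
        (\<forall>i \<le> n. i \<noteq> k \<longrightarrow> x i \<in> fobj X (n - 1)) \<longrightarrow>
        (\<forall>i j. i < j \<longrightarrow> j \<le> n \<longrightarrow> i \<noteq> k \<longrightarrow> j \<noteq> k \<longrightarrow>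
            face X (n - 2) i (x j) = face X (n - 2) (j - 1) (x i)) \<longrightarrow>
        (\<forall>i \<le> n. i \<noteq> k \<longrightarrow> face Y (n - 1) i y = level p (n - 1) (x i)) \<longrightarrow>
        (\<exists>z \<in> fobj X n. level p n z = y \<and>
            (\<forall>i \<le> n. i \<noteq> k \<longrightarrow> face X (n - 1) i z = x i)))"

section \<open>Geometric realization and weak equivalences\<close>

text \<open>The map of standard topological simplices induced by a map of ordinals.\<close>

definition simplex_push :: "delta_arr \<Rightarrow> (nat \<Rightarrow> real) \<Rightarrow> nat \<Rightarrow> real" where
  "simplex_push = (\<lambda>(m, \<theta>, n) t j. \<Sum>i \<in> {i. i \<le> m \<and> \<theta> i = j}. t i)"

type_synonym 'u cell_point = "(nat \<times> 'u) \<times> (nat \<Rightarrow> real)"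

text \<open>The disjoint union of the spaces \<open>X\<^sub>n \<times> \<Delta>\<^sup>n\<close>, with \<open>X\<^sub>n\<close> discrete.\<close>

definition cells :: "'u sset \<Rightarrow> 'u cell_point topology" where
  "cells X = sum_topology
     (\<lambda>(n, x). subtopology (powertop_real UNIV) (standard_simplex n)) (SIGMA n:UNIV. fobj X n)"

definition glue :: "'u sset \<Rightarrow> ('u cell_point \<times> 'u cell_point) set" where
  "glue X =
     (let R = {(((m, act X (m, \<theta>, n) x), t), ((n, x), simplex_push (m, \<theta>, n) t)) | m \<theta> n x t.
                 (m, \<theta>, n) \<in> Arr DELTA \<and> x \<in> fobj X n \<and> t \<in> standard_simplex m}
      in (R \<union> R\<inverse>)\<^sup>*)"

text \<open>The quotient topology: \<open>U\<close> is open iff its preimage under the projection is open.\<close>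

definition realization :: "'u sset \<Rightarrow> 'u cell_point set topology" where
  "realization X =
     topology (\<lambda>U. U \<subseteq> topspace (cells X) // glue X \<and>
                   openin (cells X) {c \<in> topspace (cells X). glue X `` {c} \<in> U})"

lemma istopology_realization:
  "istopology (\<lambda>U. U \<subseteq> topspace (cells X) // glue X \<and>
                   openin (cells X) {c \<in> topspace (cells X). glue X `` {c} \<in> U})"
proof -
  let ?P = "\<lambda>U. {c \<in> topspace (cells X). glue X `` {c} \<in> U}"
  have "?P (S \<inter> T) = ?P S \<inter> ?P T" for S T by auto
  moreover have "?P (\<Union>\<K>) = (\<Union>K\<in>\<K>. ?P K)" for \<K> by auto
  ultimately show ?thesis
    unfolding istopology_def by (auto intro!: openin_Int openin_Union)
qed

definition realization_map :: "'u sset_map \<Rightarrow> 'u cell_point set \<Rightarrow> 'u cell_point set" where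
  "realization_map f K =
     glue (snd (snd f)) `` ((\<lambda>((n, x), t). ((n, level f n x), t)) ` K)"

text \<open>Realizations are CW complexes, so asking for a homotopy equivalence is the same as asking
  for a weak homotopy equivalence.\<close>

definition weak_equivalence :: "'u sset_map \<Rightarrow> bool" where
  "weak_equivalence f \<longleftrightarrow> f \<in> Arr sSet \<and>
     (let X = realization (fst f); Y = realization (snd (snd f)); r = realization_map f in
      continuous_map X Y r \<and>
      (\<exists>g. continuous_map Y X g \<and>
           homotopic_with (\<lambda>_. True) X X (g \<circ> r) id \<and>
           homotopic_with (\<lambda>_. True) Y Y (r \<circ> g) id))"

section \<open>Model structures and Quillen equivalences\<close>

record ('o, 'm) model_cat =
  Und :: "('o, 'm) cat"
  Weq :: "'m set"
  Fib :: "'m set"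
  Cof :: "'m set"

definition has_lifting :: "('o, 'm) cat \<Rightarrow> 'm \<Rightarrow> 'm \<Rightarrow> bool" where
  "has_lifting C i p \<longleftrightarrow>
     (\<forall>u \<in> Hom C (Dom C i) (Dom C p). \<forall>v \<in> Hom C (Cod C i) (Cod C p).
        Comp C p u = Comp C v i \<longrightarrow>
        (\<exists>h \<in> Hom C (Cod C i) (Dom C p). Comp C h i = u \<and> Comp C p h = v))"

definition cofibrant :: "('o, 'm) model_cat \<Rightarrow> 'o \<Rightarrow> bool" where
  "cofibrant M X \<longleftrightarrow> (\<exists>I i. is_initial (Und M) I \<and> i \<in> Hom (Und M) I X \<and> i \<in> Cof M)"

definition fibrant :: "('o, 'm) model_cat \<Rightarrow> 'o \<Rightarrow> bool" where
  "fibrant M X \<longleftrightarrow> (\<exists>T p. is_terminal (Und M) T \<and> p \<in> Hom (Und M) X T \<and> p \<in> Fib M)"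

text \<open>The adjunction \<open>L \<stileturn> R\<close> is given by its unit \<open>\<eta>\<close>; the adjunct of
  \<open>f : L X \<rightarrow> Y\<close> is \<open>R f \<circ> \<eta> X\<close>.\<close>

definition adjunct ::
  "('o, 'm) cat \<Rightarrow> ('p, 'n, 'o, 'm) ftor \<Rightarrow> ('o \<Rightarrow> 'm) \<Rightarrow> 'o \<Rightarrow> 'n \<Rightarrow> 'm" where
  "adjunct C R \<eta> X f = Comp C (farr R f) (\<eta> X)"

definition adjunction ::
  "('o, 'm) cat \<Rightarrow> ('p, 'n) cat \<Rightarrow> ('o, 'm, 'p, 'n) ftor \<Rightarrow> ('p, 'n, 'o, 'm) ftor \<Rightarrow>
   ('o \<Rightarrow> 'm) \<Rightarrow> bool" where
  "adjunction C D L R \<eta> \<longleftrightarrow> cat_functor C D L \<and> cat_functor D C R \<and>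
     nat_trans C C (ftor_id C) (ftor_comp C R L) \<eta> \<and>
     (\<forall>X \<in> Obj C. \<forall>Y \<in> Obj D.
        bij_betw (adjunct C R \<eta> X) (Hom D (fobj L X) Y) (Hom C X (fobj R Y)))"

definition quillen_adjunction ::
  "('o, 'm) model_cat \<Rightarrow> ('p, 'n) model_cat \<Rightarrow> ('o, 'm, 'p, 'n) ftor \<Rightarrow> ('p, 'n, 'o, 'm) ftor \<Rightarrow>
   ('o \<Rightarrow> 'm) \<Rightarrow> bool" where
  "quillen_adjunction M N L R \<eta> \<longleftrightarrow> adjunction (Und M) (Und N) L R \<eta> \<and>
     (\<forall>i \<in> Cof M. farr L i \<in> Cof N) \<and>
     (\<forall>i \<in> Cof M \<inter> Weq M. farr L i \<in> Cof N \<inter> Weq N)"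

definition quillen_equivalence ::
  "('o, 'm) model_cat \<Rightarrow> ('p, 'n) model_cat \<Rightarrow> ('o, 'm, 'p, 'n) ftor \<Rightarrow> ('p, 'n, 'o, 'm) ftor \<Rightarrow>
   ('o \<Rightarrow> 'm) \<Rightarrow> bool" where
  "quillen_equivalence M N L R \<eta> \<longleftrightarrow> quillen_adjunction M N L R \<eta> \<and>
     (\<forall>X Y. cofibrant M X \<longrightarrow> fibrant N Y \<longrightarrow>
        (\<forall>f \<in> Hom (Und N) (fobj L X) Y. f \<in> Weq N \<longleftrightarrow> adjunct (Und M) R \<eta> X f \<in> Weq M))"

section \<open>Simplicial presheaves and the universal adjunction\<close>

type_synonym ('o, 'm, 'u) spsh = "('o, 'm, 'u sset, 'u sset_map) ftor"
type_synonym ('o, 'm, 'u) spsh_map =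
  "('o, 'm, 'u) spsh \<times> ('o \<Rightarrow> 'u sset_map) \<times> ('o, 'm, 'u) spsh"

definition sPSh :: "('o, 'm) cat \<Rightarrow> (('o, 'm, 'u) spsh, ('o, 'm, 'u) spsh_map) cat" where
  "sPSh A = functor_cat (op_cat A) sSet"

definition bousfield_kan ::
  "('o, 'm) cat \<Rightarrow> (('o, 'm, 'u) spsh, ('o, 'm, 'u) spsh_map) model_cat" where
  "bousfield_kan A =
     (let W = {f \<in> Arr (sPSh A). \<forall>a \<in> Obj A. weak_equivalence (fst (snd f) a)};
          Fb = {f \<in> Arr (sPSh A). \<forall>a \<in> Obj A. kan_fibration (fst (snd f) a)}
      in \<lparr>Und = sPSh A, Weq = W, Fib = Fb,
          Cof = {i \<in> Arr (sPSh A). \<forall>p \<in> Fb \<inter> W. has_lifting (sPSh A) i p}\<rparr>)"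

text \<open>\<open>F\<^sup>*\<close>\<close>

definition restr ::
  "('c, 'k) cat \<Rightarrow> ('b, 'l) cat \<Rightarrow> ('c, 'k, 'b, 'l) ftor \<Rightarrow>
   (('b, 'l, 'u) spsh, ('b, 'l, 'u) spsh_map, ('c, 'k, 'u) spsh, ('c, 'k, 'u) spsh_map) ftor" where
  "restr C B F =
     \<lparr>fobj = (\<lambda>Y. ftor_comp (op_cat C) Y F),
      farr = (\<lambda>(Y, \<beta>, Y'). (ftor_comp (op_cat C) Y F, (\<lambda>c\<in>Obj C. \<beta> (fobj F c)),
                             ftor_comp (op_cat C) Y' F))\<rparr>"

text \<open>The comma category \<open>b \<down> F\<close>: an object \<open>(c, h)\<close> is an arrow \<open>h : b \<rightarrow> F c\<close>.\<close>

definition comma ::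
  "('c, 'k) cat \<Rightarrow> ('b, 'l) cat \<Rightarrow> ('c, 'k, 'b, 'l) ftor \<Rightarrow> 'b \<Rightarrow>
   ('c \<times> 'l, ('c \<times> 'l) \<times> 'k \<times> ('c \<times> 'l)) cat" where
  "comma C B F b =
     (let Os = {(c, h). c \<in> Obj C \<and> h \<in> Hom B b (fobj F c)}
      in \<lparr>Obj = Os,
          Arr = {((c, h), k, (c', h')). (c, h) \<in> Os \<and> (c', h') \<in> Os \<and> k \<in> Hom C c c' \<and>
                                        Comp B (farr F k) h = h'},
          Dom = fst,
          Cod = (\<lambda>t. snd (snd t)),
          Ide = (\<lambda>(c, h). ((c, h), Ide C c, (c, h))),
          Comp = (\<lambda>t s. (fst s, Comp C (fst (snd t)) (fst (snd s)), snd (snd t)))\<rparr>)"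

text \<open>The diagram \<open>(b \<down> F)\<^sup>o\<^sup>p \<rightarrow> sSet\<close> sending \<open>(c, h)\<close> to \<open>X c\<close>.\<close>

definition lan_diagram ::
  "('c, 'k) cat \<Rightarrow> ('b, 'l) cat \<Rightarrow> ('c, 'k, 'b, 'l) ftor \<Rightarrow> ('c, 'k, 'u) spsh \<Rightarrow> 'b \<Rightarrow>
   ('c \<times> 'l, ('c \<times> 'l) \<times> 'k \<times> ('c \<times> 'l), 'u sset, 'u sset_map) ftor" where
  "lan_diagram C B F X b =
     ftor_comp (op_cat (comma C B F b)) X \<lparr>fobj = fst, farr = (\<lambda>t. fst (snd t))\<rparr>"

definition lan_val ::
  "('c, 'k) cat \<Rightarrow> ('b, 'l) cat \<Rightarrow> ('c, 'k, 'b, 'l) ftor \<Rightarrow> ('c, 'k, 'u) spsh \<Rightarrow> 'b \<Rightarrow>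
   'u sset" where
  "lan_val C B F X b = fst (colimit (op_cat (comma C B F b)) sSet (lan_diagram C B F X b))"

definition lan_leg ::
  "('c, 'k) cat \<Rightarrow> ('b, 'l) cat \<Rightarrow> ('c, 'k, 'b, 'l) ftor \<Rightarrow> ('c, 'k, 'u) spsh \<Rightarrow> 'b \<Rightarrow>
   'c \<times> 'l \<Rightarrow> 'u sset_map" where
  "lan_leg C B F X b = snd (colimit (op_cat (comma C B F b)) sSet (lan_diagram C B F X b))"

text \<open>\<open>F\<^sub>* X\<close>; its action on \<open>g : b' \<rightarrow> b\<close> is induced by the functor
  \<open>(c, h) \<mapsto> (c, h \<circ> g)\<close> from \<open>b \<down> F\<close> to \<open>b' \<down> F\<close>.\<close>

definition lan_obj ::
  "('c, 'k) cat \<Rightarrow> ('b, 'l) cat \<Rightarrow> ('c, 'k, 'b, 'l) ftor \<Rightarrow> ('c, 'k, 'u) spsh \<Rightarrow>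
   ('b, 'l, 'u) spsh" where
  "lan_obj C B F X =
     \<lparr>fobj = (\<lambda>b\<in>Obj B. lan_val C B F X b),
      farr = (\<lambda>g\<in>Arr B. THE u.
                u \<in> Hom sSet (lan_val C B F X (Cod B g)) (lan_val C B F X (Dom B g)) \<and>
                (\<forall>(c, h) \<in> Obj (comma C B F (Cod B g)).
                   Comp sSet u (lan_leg C B F X (Cod B g) (c, h)) =
                   lan_leg C B F X (Dom B g) (c, Comp B h g)))\<rparr>"

definition lan ::
  "('c, 'k) cat \<Rightarrow> ('b, 'l) cat \<Rightarrow> ('c, 'k, 'b, 'l) ftor \<Rightarrow>
   (('c, 'k, 'u) spsh, ('c, 'k, 'u) spsh_map, ('b, 'l, 'u) spsh, ('b, 'l, 'u) spsh_map) ftor" where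
  "lan C B F =
     \<lparr>fobj = lan_obj C B F,
      farr = (\<lambda>(X, \<alpha>, X').
        (lan_obj C B F X,
         (\<lambda>b\<in>Obj B. THE u.
            u \<in> Hom sSet (lan_val C B F X b) (lan_val C B F X' b) \<and>
            (\<forall>(c, h) \<in> Obj (comma C B F b).
               Comp sSet u (lan_leg C B F X b (c, h)) =
               Comp sSet (lan_leg C B F X' b (c, h)) (\<alpha> c))),
         lan_obj C B F X'))\<rparr>"

text \<open>The unit \<open>X \<rightarrow> F\<^sup>* F\<^sub>* X\<close>: at \<open>c\<close>, the leg of the colimit at
  \<open>(c, id : F c \<rightarrow> F c)\<close>.\<close>

definition lan_unit ::
  "('c, 'k) cat \<Rightarrow> ('b, 'l) cat \<Rightarrow> ('c, 'k, 'b, 'l) ftor \<Rightarrow> ('c, 'k, 'u) spsh \<Rightarrow>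
   ('c, 'k, 'u) spsh_map" where
  "lan_unit C B F X =
     (X, (\<lambda>c\<in>Obj C. lan_leg C B F X (fobj F c) (c, Ide B (fobj F c))),
      fobj (restr C B F) (lan_obj C B F X))"

definition universal_equivalence ::
  "'u itself \<Rightarrow> ('c, 'k) cat \<Rightarrow> ('b, 'l) cat \<Rightarrow> ('c, 'k, 'b, 'l) ftor \<Rightarrow> bool" where
  "universal_equivalence (_ :: 'u itself) C B F \<longleftrightarrow>
     quillen_equivalence
       (bousfield_kan C :: (('c, 'k, 'u) spsh, ('c, 'k, 'u) spsh_map) model_cat)
       (bousfield_kan B) (lan C B F) (restr C B F) (lan_unit C B F)"

end

theory Submission
  imports Defs
begin

text \<open>Suppose first that $F$ is an equivalence.  An isomorphism $h : b \to Fc$ makes $(c, h)$ an initial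
object of $b \downarrow F$, so the colimit that defines $F_*X(b)$ is just $X(c)$, and every
component of the unit $X \to F^*F_*X$ is an isomorphism (\<open>equivalence_imp_universal_equivalence\<close>).
Since weak equivalences of simplicial sets are invariant under isomorphism, a map
$F_*X \to Y$ and its adjunct are weak equivalences together.  Cofibrations are preserved because
lifting problems transpose along the adjunction and $F^*$ preserves trivial fibrations, these being
defined objectwise.  Initial objects in all the comma categories already yield the adjunction
$F_* \dashv F^*$ (\<open>functor_with_initial_commas\<close>).

For the converse it is enough to test the Quillen equivalence on a representable source $h_c$,
which is cofibrant, and a discrete target, which is fibrant.  By the Yoneda lemma and the
adjunction, $F_*h_c \cong h_{Fc}$ (\<open>ex_lan_repr_iso\<close>).  The adjunct of this isomorphism is the map
$h_c \to F^*h_{Fc}$ that applies $F$ to arrows; it is a weak equivalence between discrete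
presheaves, hence bijective, which says that $F$ is fully faithful.

For essential surjectivity fix $b$ and collapse, in the presheaf $h_b$, all arrows that factor
through an object $Fc$ to a single base point.  The result $Y$ is a discrete presheaf whose
restriction along $F$ is a point, that is, $F^*Y \cong h_T$ for the terminal object $T$ of $C$.
Hence $F_*h_T \to Y$ is a weak equivalence and so is surjective.  But $F_*h_T$ is generated by one
element over $FT$, which goes to the base point, so $Y(b)$ contains nothing else: the identity
of $b$ factors through some $Fc$ (\<open>retract\<close>).  The idempotent of $Fc$ belonging to this retraction
comes from an idempotent of $c$, which an equalizer splits, and $F$ carries the splitting to one
through $b$ (\<open>retracts_imp_essentially_surjective\<close>).

The only homotopy theory needed concerns connected components.  A set of vertices that contains
with one end of an edge also the other end determines a clopen subset of the geometric
realization, and homotopic maps cannot be told apart by clopen subsets.  This shows that trivial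
fibrations are surjective on vertices, which makes $h_c$ cofibrant, and that a weak equivalence
between discrete simplicial sets is a bijection.\<close>

section \<open>Categories and functor categories\<close>

lemma ex1_unique: "\<exists>!x. P x \<Longrightarrow> P u \<Longrightarrow> P v \<Longrightarrow> u = v"
  by blast

lemma HomD:
  assumes "f \<in> Hom C x y"
  shows "f \<in> Arr C" "Dom C f = x" "Cod C f = y"
  using assms by (auto simp: Hom_def)

lemma Arr_Hom: "f \<in> Arr C \<Longrightarrow> f \<in> Hom C (Dom C f) (Cod C f)"
  by (simp add: Hom_def)

lemma (in category) Hom_Obj:
  assumes "f \<in> Hom C x y"
  shows "x \<in> Obj C" "y \<in> Obj C"
  using assms Dom_in Cod_in by (auto simp: Hom_def)

lemma op_cat_simps [simp]:
  "Obj (op_cat C) = Obj C" "Arr (op_cat C) = Arr C" "Dom (op_cat C) = Cod C"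
  "Cod (op_cat C) = Dom C" "Ide (op_cat C) = Ide C" "Comp (op_cat C) g f = Comp C f g"
  by (simp_all add: op_cat_def)

lemma Hom_op_cat [simp]: "Hom (op_cat C) x y = Hom C y x"
  by (auto simp: Hom_def)

lemma category_op_cat:
  assumes "category C"
  shows "category (op_cat C)"
proof -
  interpret category C by fact
  show ?thesis
    by unfold_locales
      (simp_all add: Dom_in Cod_in Ide_in Comp_in Comp_Ide Ide_Comp Comp_assoc)
qed

lemma cat_functor_op_cat:
  assumes "cat_functor C D F"
  shows "cat_functor (op_cat C) (op_cat D) F"
proof -
  interpret cat_functor C D F by fact
  show ?thesis by unfold_locales (simp_all add: fobj_in farr_in farr_Ide farr_Comp)
qed

lemma ftor_comp_simps [simp]:
  "x \<in> Obj C \<Longrightarrow> fobj (ftor_comp C G F) x = fobj G (fobj F x)"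
  "f \<in> Arr C \<Longrightarrow> farr (ftor_comp C G F) f = farr G (farr F f)"
  by (simp_all add: ftor_comp_def)

lemma ftor_id_simps [simp]:
  "x \<in> Obj C \<Longrightarrow> fobj (ftor_id C) x = x"
  "f \<in> Arr C \<Longrightarrow> farr (ftor_id C) f = f"
  by (simp_all add: ftor_id_def)

lemma cat_functor_ftor_comp:
  assumes "category C" "cat_functor C D F" "cat_functor D E G"
  shows "cat_functor C E (ftor_comp C G F)"
proof -
  interpret C: category C by fact
  interpret F: cat_functor C D F by fact
  interpret G: cat_functor D E G by fact
  show ?thesis
  proof
    fix x assume "x \<in> Obj C"
    then show "fobj (ftor_comp C G F) x \<in> Obj E"
      and "farr (ftor_comp C G F) (Ide C x) = Ide E (fobj (ftor_comp C G F) x)"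
      using HomD(1) [OF C.Ide_in] by (simp_all add: F.fobj_in G.fobj_in F.farr_Ide G.farr_Ide)
  next
    fix f x y assume f: "f \<in> Hom C x y"
    then show "farr (ftor_comp C G F) f \<in> Hom E (fobj (ftor_comp C G F) x) (fobj (ftor_comp C G F) y)"
      using C.Hom_Obj [OF f] HomD(1) [OF f] by (simp add: F.farr_in G.farr_in)
    fix g z assume g: "g \<in> Hom C y z"
    show "farr (ftor_comp C G F) (Comp C g f) =
        Comp E (farr (ftor_comp C G F) g) (farr (ftor_comp C G F) f)"
      using HomD(1) [OF C.Comp_in [OF f g]] HomD(1) [OF f] HomD(1) [OF g]
        F.farr_Comp [OF f g] G.farr_Comp [OF F.farr_in [OF f] F.farr_in [OF g]] by simp
  qed
qed

lemma nat_transI: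
  assumes "category C"
    and "\<And>x. x \<in> Obj C \<Longrightarrow> \<alpha> x \<in> Hom D (fobj F x) (fobj G x)"
    and "\<And>f x y. f \<in> Hom C x y \<Longrightarrow> Comp D (farr G f) (\<alpha> x) = Comp D (\<alpha> y) (farr F f)"
  shows "nat_trans C D F G \<alpha>"
  using assms(2) assms(3) [OF Arr_Hom] by (simp add: nat_trans_def)

lemma nat_transD:
  assumes "nat_trans C D F G \<alpha>"
  shows "x \<in> Obj C \<Longrightarrow> \<alpha> x \<in> Hom D (fobj F x) (fobj G x)"
    and "f \<in> Hom C x y \<Longrightarrow> Comp D (farr G f) (\<alpha> x) = Comp D (\<alpha> y) (farr F f)"
  using assms by (auto simp: nat_trans_def Hom_def)

lemma Obj_functor_cat:
  "F \<in> Obj (functor_cat C D) \<longleftrightarrow>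
     cat_functor C D F \<and> fobj F \<in> extensional (Obj C) \<and> farr F \<in> extensional (Arr C)"
  by (simp add: functor_cat_def Let_def)

lemma Arr_functor_cat:
  "(F, \<alpha>, G) \<in> Arr (functor_cat C D) \<longleftrightarrow>
     F \<in> Obj (functor_cat C D) \<and> G \<in> Obj (functor_cat C D) \<and> nat_trans C D F G \<alpha> \<and>
     \<alpha> \<in> extensional (Obj C)"
  by (auto simp add: functor_cat_def Let_def)

lemma functor_cat_simps [simp]:
  "Dom (functor_cat C D) t = fst t"
  "Cod (functor_cat C D) t = snd (snd t)"
  "Ide (functor_cat C D) F = (F, (\<lambda>x\<in>Obj C. Ide D (fobj F x)), F)"
  "Comp (functor_cat C D) t s =
     (fst s, (\<lambda>x\<in>Obj C. Comp D (fst (snd t) x) (fst (snd s) x)), snd (snd t))"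
  by (simp_all add: functor_cat_def Let_def)

lemma Hom_functor_catI:
  assumes "F \<in> Obj (functor_cat C D)" "G \<in> Obj (functor_cat C D)" "nat_trans C D F G \<alpha>"
    "\<alpha> \<in> extensional (Obj C)"
  shows "(F, \<alpha>, G) \<in> Hom (functor_cat C D) F G"
  using assms by (simp add: Hom_def Arr_functor_cat)

lemma Hom_functor_catD:
  assumes "t \<in> Hom (functor_cat C D) F G"
  shows "t = (F, fst (snd t), G)" "F \<in> Obj (functor_cat C D)" "G \<in> Obj (functor_cat C D)"
    "nat_trans C D F G (fst (snd t))" "fst (snd t) \<in> extensional (Obj C)"
  using assms by (auto simp: Hom_def functor_cat_def Let_def)

lemma functor_cat_eqI:
  assumes "s \<in> Hom (functor_cat C D) F G" "t \<in> Hom (functor_cat C D) F G"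
    and "\<And>x. x \<in> Obj C \<Longrightarrow> fst (snd s) x = fst (snd t) x"
  shows "s = t"
  using Hom_functor_catD [OF assms(1)] Hom_functor_catD [OF assms(2)] assms(3)
  by (metis extensionalityI)

lemma category_functor_cat:
  assumes "category C" "category D"
  shows "category (functor_cat C D)"
proof -
  interpret C: category C by fact
  interpret D: category D by fact
  note nt = nat_transD [OF Hom_functor_catD(4)]
  have comp: "Comp (functor_cat C D) t s \<in> Hom (functor_cat C D) F H"
    if s: "s \<in> Hom (functor_cat C D) F G" and t: "t \<in> Hom (functor_cat C D) G H" for s t F G H
  proof -
    have "nat_trans C D F H (\<lambda>x\<in>Obj C. Comp D (fst (snd t) x) (fst (snd s) x))"
    proof (rule nat_transI [OF assms(1)])
      fix x assume "x \<in> Obj C"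
      then show "(\<lambda>x\<in>Obj C. Comp D (fst (snd t) x) (fst (snd s) x)) x \<in> Hom D (fobj F x) (fobj H x)"
        using D.Comp_in [OF nt(1) [OF s] nt(1) [OF t]] by simp
    next
      fix f x y assume f: "f \<in> Hom C x y"
      note xy = C.Hom_Obj [OF f]
      have F: "farr F f \<in> Hom D (fobj F x) (fobj F y)" and G: "farr G f \<in> Hom D (fobj G x) (fobj G y)"
        and H: "farr H f \<in> Hom D (fobj H x) (fobj H y)"
        using Hom_functor_catD(2,3) [OF s] Hom_functor_catD(3) [OF t] f
        by (auto simp: Obj_functor_cat intro: cat_functor.farr_in)
      have "Comp D (farr H f) (Comp D (fst (snd t) x) (fst (snd s) x)) =
          Comp D (Comp D (fst (snd t) y) (farr G f)) (fst (snd s) x)"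
        using D.Comp_assoc [OF nt(1) [OF s xy(1)] nt(1) [OF t xy(1)] H] nt(2) [OF t f] by simp
      also have "\<dots> = Comp D (fst (snd t) y) (Comp D (fst (snd s) y) (farr F f))"
        using D.Comp_assoc [OF nt(1) [OF s xy(1)] G nt(1) [OF t xy(2)]] nt(2) [OF s f] by simp
      also have "\<dots> = Comp D (Comp D (fst (snd t) y) (fst (snd s) y)) (farr F f)"
        using D.Comp_assoc [OF F nt(1) [OF s xy(2)] nt(1) [OF t xy(2)]] by simp
      finally show "Comp D (farr H f) ((\<lambda>x\<in>Obj C. Comp D (fst (snd t) x) (fst (snd s) x)) x) =
          Comp D ((\<lambda>x\<in>Obj C. Comp D (fst (snd t) x) (fst (snd s) x)) y) (farr F f)"
        using xy by simp
    qed
    moreover have "fst s = F" "snd (snd t) = H"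
      using HomD(2) [OF s] HomD(3) [OF t] by simp_all
    ultimately show ?thesis
      using Hom_functor_catD(2) [OF s] Hom_functor_catD(3) [OF t]
      by (simp add: Hom_functor_catI)
  qed
  have ide: "Ide (functor_cat C D) F \<in> Hom (functor_cat C D) F F"
    if F: "F \<in> Obj (functor_cat C D)" for F
  proof -
    interpret F: cat_functor C D F using F by (simp add: Obj_functor_cat)
    have "nat_trans C D F F (\<lambda>x\<in>Obj C. Ide D (fobj F x))"
    proof (rule nat_transI [OF assms(1)])
      fix f x y assume f: "f \<in> Hom C x y"
      show "Comp D (farr F f) ((\<lambda>x\<in>Obj C. Ide D (fobj F x)) x) =
          Comp D ((\<lambda>x\<in>Obj C. Ide D (fobj F x)) y) (farr F f)"
        using C.Hom_Obj [OF f] D.Comp_Ide [OF F.farr_in [OF f]] D.Ide_Comp [OF F.farr_in [OF f]]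
        by simp
    qed (simp add: D.Ide_in F.fobj_in)
    then show ?thesis using F by (simp add: Hom_functor_catI)
  qed
  show ?thesis
  proof
    fix t F G assume t: "t \<in> Hom (functor_cat C D) F G"
    show "Comp (functor_cat C D) t (Ide (functor_cat C D) F) = t"
      using D.Comp_Ide [OF nt(1) [OF t]] Hom_functor_catD(2) [OF t]
      by (intro functor_cat_eqI [OF comp [OF ide t] t]) simp_all
    show "Comp (functor_cat C D) (Ide (functor_cat C D) G) t = t"
      using D.Ide_Comp [OF nt(1) [OF t]] Hom_functor_catD(3) [OF t]
      by (intro functor_cat_eqI [OF comp [OF t ide] t]) simp_all
  next
    fix r s t F G H K
    assume r: "r \<in> Hom (functor_cat C D) F G" and s: "s \<in> Hom (functor_cat C D) G H"
      and t: "t \<in> Hom (functor_cat C D) H K"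
    show "Comp (functor_cat C D) t (Comp (functor_cat C D) s r) =
          Comp (functor_cat C D) (Comp (functor_cat C D) t s) r"
      using D.Comp_assoc [OF nt(1) [OF r] nt(1) [OF s] nt(1) [OF t]]
      by (intro functor_cat_eqI [OF comp [OF comp [OF r s] t] comp [OF r comp [OF s t]]]) simp
  next
    fix t assume "t \<in> Arr (functor_cat C D)"
    note t = Hom_functor_catD(2,3) [OF Arr_Hom [OF this]]
    show "Dom (functor_cat C D) t \<in> Obj (functor_cat C D)" by (rule t(1))
    show "Cod (functor_cat C D) t \<in> Obj (functor_cat C D)" by (rule t(2))
  qed (fact ide comp)+
qed

section \<open>Isomorphisms\<close>

lemma is_isoI:
  assumes "f \<in> Hom C x y" "g \<in> Hom C y x" "Comp C g f = Ide C x" "Comp C f g = Ide C y"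
  shows "is_iso C f"
  using assms by (auto simp: is_iso_def Hom_def)

lemma is_isoE:
  assumes "is_iso C f" "f \<in> Hom C x y"
  obtains g where "g \<in> Hom C y x" "Comp C g f = Ide C x" "Comp C f g = Ide C y" "is_iso C g"
proof -
  obtain g where g: "g \<in> Hom C y x" "Comp C g f = Ide C x" "Comp C f g = Ide C y"
    using assms by (auto simp: is_iso_def HomD(2,3) [OF assms(2)])
  then show thesis using that is_isoI [OF g(1) assms(2) g(3,2)] by blast
qed

lemma (in category) is_iso_Ide: "x \<in> Obj C \<Longrightarrow> is_iso C (Ide C x)"
  using Ide_in Ide_Comp by (intro is_isoI [of _ C x x "Ide C x"]) auto

lemma (in category) Comp_inverse_cancel:
  assumes "f \<in> Hom C x y" "g \<in> Hom C y x" "Comp C g f = Ide C x"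
  shows "h \<in> Hom C w x \<Longrightarrow> Comp C g (Comp C f h) = h"
    and "h \<in> Hom C x z \<Longrightarrow> Comp C (Comp C h g) f = h"
proof -
  show "Comp C g (Comp C f h) = h" if h: "h \<in> Hom C w x"
    using Comp_assoc [OF h assms(1,2)] Ide_Comp [OF h] assms(3) by simp
  show "Comp C (Comp C h g) f = h" if h: "h \<in> Hom C x z"
    using Comp_assoc [OF assms(1,2) h] Comp_Ide [OF h] assms(3) by simp
qed

lemma (in category) is_iso_cancel_left:
  assumes "is_iso C g" "g \<in> Hom C y z" "f \<in> Hom C x y" "f' \<in> Hom C x y" "Comp C g f = Comp C g f'"
  shows "f = f'"
proof -
  obtain i where i: "i \<in> Hom C z y" "Comp C i g = Ide C y" using is_isoE [OF assms(1,2)] by metis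
  show ?thesis
    using Comp_inverse_cancel(1) [OF assms(2) i assms(3)] Comp_inverse_cancel(1) [OF assms(2) i assms(4)]
    unfolding assms(5) by (rule trans [OF sym])
qed

lemma (in category) is_iso_cancel_right:
  assumes "is_iso C f" "f \<in> Hom C x y" "g \<in> Hom C y z" "g' \<in> Hom C y z" "Comp C g f = Comp C g' f"
  shows "g = g'"
proof -
  obtain i where i: "i \<in> Hom C y x" "Comp C f i = Ide C y" using is_isoE [OF assms(1,2)] by metis
  show ?thesis
    using Comp_inverse_cancel(2) [OF i(1) assms(2) i(2) assms(3)] Comp_inverse_cancel(2) [OF i(1) assms(2) i(2) assms(4)]
    unfolding assms(5) by (rule trans [OF sym])
qed

lemma (in cat_functor) farr_is_iso:
  assumes "category C" "f \<in> Hom C x y" "is_iso C f"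
  shows "is_iso D (farr F f)"
proof -
  interpret category C by fact
  obtain g where g: "g \<in> Hom C y x" "Comp C g f = Ide C x" "Comp C f g = Ide C y"
    using is_isoE [OF assms(3,2)] by metis
  show ?thesis
    using farr_Comp [OF assms(2) g(1)] farr_Comp [OF g(1) assms(2)] g(2,3) Hom_Obj [OF assms(2)]
    by (intro is_isoI [OF farr_in [OF assms(2)] farr_in [OF g(1)]]) (simp_all add: farr_Ide)
qed

lemma is_iso_functor_cat_component:
  assumes "t \<in> Hom (functor_cat C D) F G" "is_iso (functor_cat C D) t" "x \<in> Obj C"
  shows "is_iso D (fst (snd t) x)"
proof -
  obtain s where s: "s \<in> Hom (functor_cat C D) G F"
    "Comp (functor_cat C D) s t = Ide (functor_cat C D) F"
    "Comp (functor_cat C D) t s = Ide (functor_cat C D) G"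
    using is_isoE [OF assms(2,1)] by metis
  show ?thesis
  proof (rule is_isoI)
    show "fst (snd t) x \<in> Hom D (fobj F x) (fobj G x)" "fst (snd s) x \<in> Hom D (fobj G x) (fobj F x)"
      using nat_transD(1) [OF Hom_functor_catD(4) [OF assms(1)] assms(3)]
        nat_transD(1) [OF Hom_functor_catD(4) [OF s(1)] assms(3)] by simp_all
    show "Comp D (fst (snd s) x) (fst (snd t) x) = Ide D (fobj F x)"
      using arg_cong [OF s(2), of "\<lambda>a. fst (snd a) x"] assms(3) by simp
    show "Comp D (fst (snd t) x) (fst (snd s) x) = Ide D (fobj G x)"
      using arg_cong [OF s(3), of "\<lambda>a. fst (snd a) x"] assms(3) by simp
  qed
qed

section \<open>Colimits over a category with a terminal object\<close>

lemma is_terminal_op_cat: "is_terminal (op_cat A) x \<longleftrightarrow> is_initial A x"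
  by (simp add: is_terminal_def is_initial_def)

text \<open>A cocone under a diagram whose shape has a terminal object $t$ is determined by its leg
at $t$.  The colimit obtained in this way has an identity as leg at $t$, which identifies the
corresponding leg of any other colimit as an isomorphism.\<close>

lemma (in category) terminal_colimit:
  assumes J: "category J" and D: "cat_functor J C D" and t: "is_terminal J t"
  obtains p where "is_colimit J C D (fobj D t) p" "p t = Ide C (fobj D t)"
proof -
  interpret J: category J by fact
  interpret D: cat_functor J C D by fact
  have t_in: "t \<in> Obj J" using t by (simp add: is_terminal_def)
  define e where "e j = (THE f. f \<in> Hom J j t)" for j
  have ex1: "\<exists>!f. f \<in> Hom J j t" if "j \<in> Obj J" for j
    using t that by (simp add: is_terminal_def)
  have e: "e j \<in> Hom J j t" if "j \<in> Obj J" for j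
    using theI' [OF ex1 [OF that]] by (simp add: e_def)
  have uniq: "f = g" if "f \<in> Hom J j t" "g \<in> Hom J j t" for f g j
    using ex1 [OF J.Hom_Obj(1) [OF that(1)]] that by blast
  have cocone: "is_cocone J C D (fobj D t) (\<lambda>j. farr D (e j))"
    unfolding is_cocone_def
  proof (intro conjI ballI)
    fix f assume "f \<in> Arr J"
    then have f: "f \<in> Hom J (Dom J f) (Cod J f)" by (rule Arr_Hom)
    note ef = e [OF J.Hom_Obj(2) [OF f]]
    have "Comp J (e (Cod J f)) f = e (Dom J f)"
      using J.Comp_in [OF f ef] e [OF J.Hom_Obj(1) [OF f]] uniq by blast
    then show "Comp C (farr D (e (Cod J f))) (farr D f) = farr D (e (Dom J f))"
      using D.farr_Comp [OF f ef] by simp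
  qed (auto simp: D.fobj_in D.farr_in t_in e)
  have univ: "\<exists>!u. u \<in> Hom C (fobj D t) l' \<and> (\<forall>j\<in>Obj J. Comp C u (farr D (e j)) = p' j)"
    if p': "is_cocone J C D l' p'" for l' p'
  proof (intro ex1I [of _ "p' t"] conjI ballI)
    show "p' t \<in> Hom C (fobj D t) l'" using p' t_in by (simp add: is_cocone_def)
    show "Comp C (p' t) (farr D (e j)) = p' j" if "j \<in> Obj J" for j
      using p' HomD [OF e [OF that]] by (auto simp: is_cocone_def)
    fix u assume u: "u \<in> Hom C (fobj D t) l' \<and> (\<forall>j\<in>Obj J. Comp C u (farr D (e j)) = p' j)"
    have "e t = Ide J t" using uniq [OF e [OF t_in] J.Ide_in [OF t_in]] .
    then show "u = p' t" using u t_in D.farr_Ide Comp_Ide by metis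
  qed
  have "e t = Ide J t" using uniq [OF e [OF t_in] J.Ide_in [OF t_in]] .
  then have "farr D (e t) = Ide C (fobj D t)" using D.farr_Ide [OF t_in] by simp
  moreover have "is_colimit J C D (fobj D t) (\<lambda>j. farr D (e j))"
    using cocone univ unfolding is_colimit_def by blast
  ultimately show thesis using that by blast
qed

lemma (in category) terminal_colimit_leg_is_iso:
  assumes J: "category J" and D: "cat_functor J C D" and t: "is_terminal J t"
    and l: "is_colimit J C D l p"
  shows "is_iso C (p t)"
proof -
  have t_in: "t \<in> Obj J" using t by (simp add: is_terminal_def)
  interpret J: category J by fact
  interpret D: cat_functor J C D by fact
  have p: "p j \<in> Hom C (fobj D j) l" if "j \<in> Obj J" for j
    using l that by (simp add: is_colimit_def is_cocone_def)
  obtain q where q: "is_colimit J C D (fobj D t) q" and qt_Ide: "q t = Ide C (fobj D t)"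
    using terminal_colimit [OF J D t] by blast
  have qt: "q j \<in> Hom C (fobj D j) (fobj D t)" if "j \<in> Obj J" for j
    using q that by (simp add: is_colimit_def is_cocone_def)
  have pu: "\<exists>!u. u \<in> Hom C l l' \<and> (\<forall>j\<in>Obj J. Comp C u (p j) = p' j)"
    if "is_cocone J C D l' p'" for l' p'
    using l that by (simp add: is_colimit_def)
  have qu: "\<exists>!u. u \<in> Hom C (fobj D t) l' \<and> (\<forall>j\<in>Obj J. Comp C u (q j) = p' j)"
    if "is_cocone J C D l' p'" for l' p'
    using q that by (simp add: is_colimit_def)
  have cp: "is_cocone J C D l p" using l by (simp add: is_colimit_def)
  have cq: "is_cocone J C D (fobj D t) q" using q by (simp add: is_colimit_def)
  obtain u where u: "u \<in> Hom C l (fobj D t)" "\<And>j. j \<in> Obj J \<Longrightarrow> Comp C u (p j) = q j"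
    using pu [OF cq] by blast
  obtain v where v: "v \<in> Hom C (fobj D t) l" "\<And>j. j \<in> Obj J \<Longrightarrow> Comp C v (q j) = p j"
    using qu [OF cp] by blast
  have vu: "Comp C v u = Ide C l"
  proof -
    have "Comp C v u \<in> Hom C l l" "\<And>j. j \<in> Obj J \<Longrightarrow> Comp C (Comp C v u) (p j) = p j"
      using Comp_in [OF u(1) v(1)] Comp_assoc [OF p u(1) v(1)] u(2) v(2) by simp_all
    moreover have "Ide C l \<in> Hom C l l" "\<And>j. j \<in> Obj J \<Longrightarrow> Comp C (Ide C l) (p j) = p j"
      using Ide_in Hom_Obj [OF v(1)] Ide_Comp [OF p] by simp_all
    ultimately show ?thesis using pu [OF cp] by blast
  qed
  have uv: "Comp C u v = Ide C (fobj D t)"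
  proof -
    have "Comp C u v \<in> Hom C (fobj D t) (fobj D t)"
      "\<And>j. j \<in> Obj J \<Longrightarrow> Comp C (Comp C u v) (q j) = q j"
      using Comp_in [OF v(1) u(1)] Comp_assoc [OF qt v(1) u(1)] u(2) v(2) by simp_all
    moreover have "Ide C (fobj D t) \<in> Hom C (fobj D t) (fobj D t)"
      "\<And>j. j \<in> Obj J \<Longrightarrow> Comp C (Ide C (fobj D t)) (q j) = q j"
      using Ide_in Hom_Obj [OF v(1)] Ide_Comp [OF qt] by simp_all
    ultimately show ?thesis using qu [OF cq] by blast
  qed
  have "p t = v" using v(2) [OF t_in] Comp_Ide [OF v(1)] qt_Ide by simp
  then show ?thesis using is_isoI [OF v(1) u(1) uv vu] by simp
qed

section \<open>Sets and simplicial sets\<close>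

lemma SET_simps [simp]:
  "Obj SET = UNIV" "Dom SET t = fst t" "Cod SET t = snd (snd t)" "Ide SET A = (A, (\<lambda>x\<in>A. x), A)"
  "Comp SET t s = (fst s, compose (fst s) (fst (snd t)) (fst (snd s)), snd (snd t))"
  by (simp_all add: SET_def)

lemma Hom_SET: "(A', f, B') \<in> Hom SET A B \<longleftrightarrow> A' = A \<and> B' = B \<and> f \<in> A \<rightarrow>\<^sub>E B"
  by (auto simp: Hom_def SET_def)

lemma Hom_SETD:
  assumes "t \<in> Hom SET A B"
  shows "t = (A, fst (snd t), B)" "fst (snd t) \<in> A \<rightarrow>\<^sub>E B"
  using assms by (auto simp: Hom_def SET_def)

lemma category_SET: "category SET"
proof
  fix t :: "'a set_arr" and A B assume t: "t \<in> Hom SET A B"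
  obtain f where f: "t = (A, f, B)" "f \<in> A \<rightarrow>\<^sub>E B" using Hom_SETD [OF t] by blast
  show "Comp SET t (Ide SET A) = t" "Comp SET (Ide SET B) t = t"
    using f by (auto simp: compose_def fun_eq_iff PiE_def extensional_def Pi_def)
  fix u D assume u: "u \<in> Hom SET B D"
  obtain g where g: "u = (B, g, D)" "g \<in> B \<rightarrow>\<^sub>E D" using Hom_SETD [OF u] by blast
  show "Comp SET u t \<in> Hom SET A D"
    using f g by (auto simp: Hom_SET compose_def)
  fix v E assume v: "v \<in> Hom SET D E"
  show "Comp SET v (Comp SET u t) = Comp SET (Comp SET v u) t"
    using f g by (auto simp: compose_def fun_eq_iff)
qed (auto simp: Hom_SET)

lemma DELTA_simps [simp]:
  "Obj DELTA = UNIV" "Dom DELTA t = fst t" "Cod DELTA t = snd (snd t)"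
  "Ide DELTA n = (n, (\<lambda>i\<in>{..n}. i), n)"
  "Comp DELTA t s = (fst s, compose {..fst s} (fst (snd t)) (fst (snd s)), snd (snd t))"
  by (simp_all add: DELTA_def)

lemma Arr_DELTA: "(m, \<theta>, n) \<in> Arr DELTA \<longleftrightarrow> \<theta> \<in> {..m} \<rightarrow>\<^sub>E {..n} \<and> mono_on {..m} \<theta>"
  by (simp add: DELTA_def)

lemma Hom_DELTA:
  "(m', \<theta>, n') \<in> Hom DELTA m n \<longleftrightarrow>
     m' = m \<and> n' = n \<and> \<theta> \<in> {..m} \<rightarrow>\<^sub>E {..n} \<and> mono_on {..m} \<theta>"
  by (auto simp: Hom_def DELTA_def)

lemma Hom_DELTAD:
  assumes "t \<in> Hom DELTA m n"
  shows "t = (m, fst (snd t), n)" "fst (snd t) \<in> {..m} \<rightarrow>\<^sub>E {..n}" "mono_on {..m} (fst (snd t))"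
  using assms by (auto simp: Hom_def DELTA_def)

lemma category_DELTA: "category DELTA"
proof
  fix t and m n :: nat assume t: "t \<in> Hom DELTA m n"
  obtain f where f: "t = (m, f, n)" "f \<in> {..m} \<rightarrow>\<^sub>E {..n}" "mono_on {..m} f"
    using Hom_DELTAD [OF t] by blast
  show "Comp DELTA t (Ide DELTA m) = t" "Comp DELTA (Ide DELTA n) t = t"
    using f by (auto simp: compose_def fun_eq_iff PiE_def extensional_def Pi_def)
  fix u k assume u: "u \<in> Hom DELTA n k"
  obtain g where g: "u = (n, g, k)" "g \<in> {..n} \<rightarrow>\<^sub>E {..k}" "mono_on {..n} g"
    using Hom_DELTAD [OF u] by blast
  have "mono_on {..m} (compose {..m} g f)"
  proof (rule mono_onI)
    fix r s assume "r \<in> {..m}" "s \<in> {..m}" "r \<le> s"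
    then show "compose {..m} g f r \<le> compose {..m} g f s"
      using mono_onD [OF f(3), of r s] f(2) by (auto simp: compose_def intro!: mono_onD [OF g(3)])
  qed
  then show "Comp DELTA u t \<in> Hom DELTA m k"
    using f(1,2) g(1,2) by (auto simp: Hom_DELTA compose_def)
  fix v l assume v: "v \<in> Hom DELTA k l"
  show "Comp DELTA v (Comp DELTA u t) = Comp DELTA (Comp DELTA v u) t"
    using f g by (auto simp: compose_def fun_eq_iff)
qed (auto simp: Hom_DELTA monotone_on_def)

lemma category_sSet: "category sSet"
  unfolding sSet_def by (intro category_functor_cat category_op_cat category_DELTA category_SET)

lemma farr_sSet:
  assumes X: "X \<in> Obj sSet" and \<theta>: "\<theta> \<in> Hom DELTA m n"
  shows "farr X \<theta> = (fobj X n, act X \<theta>, fobj X m)"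
    and "act X \<theta> \<in> fobj X n \<rightarrow>\<^sub>E fobj X m"
proof -
  have "farr X \<theta> \<in> Hom SET (fobj X n) (fobj X m)"
    using cat_functor.farr_in [of "op_cat DELTA" SET X \<theta> n m] X \<theta>
    by (simp add: sSet_def Obj_functor_cat)
  from Hom_SETD [OF this]
  show "farr X \<theta> = (fobj X n, act X \<theta>, fobj X m)" "act X \<theta> \<in> fobj X n \<rightarrow>\<^sub>E fobj X m"
    unfolding act_def by this+
qed

lemma act_in: "X \<in> Obj sSet \<Longrightarrow> \<theta> \<in> Hom DELTA m n \<Longrightarrow> x \<in> fobj X n \<Longrightarrow> act X \<theta> x \<in> fobj X m"
  using farr_sSet(2) by blast

lemma act_Ide: "X \<in> Obj sSet \<Longrightarrow> x \<in> fobj X n \<Longrightarrow> act X (Ide DELTA n) x = x"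
  using cat_functor.farr_Ide [of "op_cat DELTA" SET X n]
  by (auto simp: sSet_def Obj_functor_cat act_def simp del: DELTA_simps(4))

lemma act_Comp:
  assumes X: "X \<in> Obj sSet" and \<theta>: "\<theta> \<in> Hom DELTA m n" and \<eta>: "\<eta> \<in> Hom DELTA n k"
    and x: "x \<in> fobj X k"
  shows "act X (Comp DELTA \<eta> \<theta>) x = act X \<theta> (act X \<eta> x)"
proof -
  have "farr X (Comp DELTA \<eta> \<theta>) = Comp SET (farr X \<theta>) (farr X \<eta>)"
    using cat_functor.farr_Comp [of "op_cat DELTA" SET X \<eta> k n \<theta> m] X \<theta> \<eta>
    by (simp add: sSet_def Obj_functor_cat del: DELTA_simps)
  then have "act X (Comp DELTA \<eta> \<theta>) = fst (snd (Comp SET (farr X \<theta>) (farr X \<eta>)))"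
    by (simp only: act_def)
  also have "\<dots> = compose (fobj X k) (act X \<theta>) (act X \<eta>)"
    unfolding farr_sSet(1) [OF X \<theta>] farr_sSet(1) [OF X \<eta>] by simp
  finally show ?thesis using x by (simp only: compose_eq)
qed

lemma Hom_sSetD:
  assumes f: "f \<in> Hom sSet X Y"
  shows "X \<in> Obj sSet" "Y \<in> Obj sSet" "fst f = X" "snd (snd f) = Y"
    and "fst (snd f) n = (fobj X n, level f n, fobj Y n)"
    and "level f n \<in> fobj X n \<rightarrow>\<^sub>E fobj Y n"
    and "\<theta> \<in> Hom DELTA m n \<Longrightarrow> x \<in> fobj X n \<Longrightarrow> act Y \<theta> (level f n x) = level f m (act X \<theta> x)"
proof -
  note f' = Hom_functor_catD [OF f [unfolded sSet_def]]
  show X: "X \<in> Obj sSet" and Y: "Y \<in> Obj sSet" and "fst f = X" "snd (snd f) = Y"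
    using f'(2,3) HomD(2,3) [OF f] by (simp_all add: sSet_def)
  have f1: "fst (snd f) n \<in> Hom SET (fobj X n) (fobj Y n)" for n
    using nat_transD(1) [OF f'(4), of n] by simp
  show eq: "fst (snd f) n = (fobj X n, level f n, fobj Y n)"
    and lev: "level f n \<in> fobj X n \<rightarrow>\<^sub>E fobj Y n" for n
    unfolding level_def by (fact Hom_SETD [OF f1])+
  assume \<theta>: "\<theta> \<in> Hom DELTA m n" and x: "x \<in> fobj X n"
  have "Comp SET (farr Y \<theta>) (fst (snd f) n) = Comp SET (fst (snd f) m) (farr X \<theta>)"
    using nat_transD(2) [OF f'(4), of \<theta> n m] \<theta> by (simp del: SET_simps)
  then have "compose (fobj X n) (act Y \<theta>) (level f n) x = compose (fobj X n) (level f m) (act X \<theta>) x"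
    unfolding farr_sSet(1) [OF X \<theta>] farr_sSet(1) [OF Y \<theta>] eq by simp
  then show "act Y \<theta> (level f n x) = level f m (act X \<theta> x)"
    using x by (simp add: compose_def)
qed

lemma level_in: "f \<in> Hom sSet X Y \<Longrightarrow> x \<in> fobj X n \<Longrightarrow> level f n x \<in> fobj Y n"
  using Hom_sSetD(6) by blast

lemma level_Ide: "x \<in> fobj X n \<Longrightarrow> level (Ide sSet X) n x = x"
  by (simp add: sSet_def level_def)

lemma level_Comp:
  assumes "f \<in> Hom sSet X Y" "g \<in> Hom sSet Y Z" "x \<in> fobj X n"
  shows "level (Comp sSet g f) n x = level g n (level f n x)"
proof -
  have "fst (snd (Comp sSet g f)) n = Comp SET (fst (snd g) n) (fst (snd f) n)"
    by (simp add: sSet_def)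
  also have "\<dots> = (fobj X n, compose (fobj X n) (level g n) (level f n), fobj Z n)"
    unfolding Hom_sSetD(5) [OF assms(1), of n] Hom_sSetD(5) [OF assms(2), of n] by simp
  finally show ?thesis
    using assms(3) by (simp add: level_def [of "Comp sSet g f"] compose_def del: functor_cat_simps)
qed

lemma sSet_map_eqI:
  assumes f: "f \<in> Hom sSet X Y" and g: "g \<in> Hom sSet X Y"
    and "\<And>n x. x \<in> fobj X n \<Longrightarrow> level f n x = level g n x"
  shows "f = g"
proof (rule functor_cat_eqI [OF f [unfolded sSet_def] g [unfolded sSet_def]])
  fix n
  have "level f n = level g n"
    using assms(3) Hom_sSetD(6) [OF f, of n] Hom_sSetD(6) [OF g, of n]
    by (intro extensionalityI [of _ "fobj X n"]) (auto simp: PiE_def)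
  then show "fst (snd f) n = fst (snd g) n"
    using Hom_sSetD(5) [OF f, of n] Hom_sSetD(5) [OF g, of n] by simp
qed

definition sset_map :: "'u sset \<Rightarrow> (nat \<Rightarrow> 'u \<Rightarrow> 'u) \<Rightarrow> 'u sset \<Rightarrow> 'u sset_map" where
  "sset_map X \<phi> Y = (X, (\<lambda>n. (fobj X n, restrict (\<phi> n) (fobj X n), fobj Y n)), Y)"

lemma level_sset_map [simp]: "x \<in> fobj X n \<Longrightarrow> level (sset_map X \<phi> Y) n x = \<phi> n x"
  by (simp add: level_def sset_map_def)

lemma sset_map_in_Hom:
  assumes X: "X \<in> Obj sSet" and Y: "Y \<in> Obj sSet"
    and in_Y: "\<And>n x. x \<in> fobj X n \<Longrightarrow> \<phi> n x \<in> fobj Y n"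
    and natural: "\<And>m n \<theta> x. \<theta> \<in> Hom DELTA m n \<Longrightarrow> x \<in> fobj X n \<Longrightarrow>
      act Y \<theta> (\<phi> n x) = \<phi> m (act X \<theta> x)"
  shows "sset_map X \<phi> Y \<in> Hom sSet X Y"
  unfolding sSet_def sset_map_def
proof (intro Hom_functor_catI nat_transI category_op_cat category_DELTA)
  fix \<theta> and n m :: nat assume \<theta>: "\<theta> \<in> Hom (op_cat DELTA) n m"
  show "Comp SET (farr Y \<theta>) (fobj X n, restrict (\<phi> n) (fobj X n), fobj Y n) =
        Comp SET (fobj X m, restrict (\<phi> m) (fobj X m), fobj Y m) (farr X \<theta>)"
    using \<theta> farr_sSet(1) [OF X, of \<theta> m n] farr_sSet(1) [OF Y, of \<theta> m n]
      natural [of \<theta> m n] act_in [OF X, of \<theta> m n]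
    by (auto simp: compose_def fun_eq_iff)
qed (use X Y in_Y in \<open>auto simp: Hom_SET sSet_def\<close>)

lemma is_iso_sSet_map:
  assumes f: "f \<in> Hom sSet X Y" and bij: "\<And>n. bij_betw (level f n) (fobj X n) (fobj Y n)"
  shows "is_iso sSet f"
proof -
  interpret category sSet by (rule category_sSet)
  define \<psi> where "\<psi> n = the_inv_into (fobj X n) (level f n)" for n
  have \<psi>: "\<psi> n (level f n x) = x" if "x \<in> fobj X n" for n x
    using bij that unfolding \<psi>_def bij_betw_def by (simp add: the_inv_into_f_f)
  have \<psi>': "\<psi> n y \<in> fobj X n" "level f n (\<psi> n y) = y" if "y \<in> fobj Y n" for n y
    using bij [of n] that unfolding \<psi>_def bij_betw_def
    by (auto simp: f_the_inv_into_f intro: the_inv_into_into)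
  have g: "sset_map Y \<psi> X \<in> Hom sSet Y X"
  proof (rule sset_map_in_Hom)
    fix m n \<theta> y assume *: "\<theta> \<in> Hom DELTA m n" "y \<in> fobj Y n"
    show "act X \<theta> (\<psi> n y) = \<psi> m (act Y \<theta> y)"
      using Hom_sSetD(7) [OF f *(1) \<psi>'(1) [OF *(2)]] \<psi>' [OF *(2)]
        \<psi> [OF act_in [OF Hom_sSetD(1) [OF f] *(1) \<psi>'(1) [OF *(2)]]] by simp
  qed (use Hom_sSetD [OF f] \<psi>' in auto)
  show ?thesis
  proof (rule is_isoI [OF f g])
    show "Comp sSet (sset_map Y \<psi> X) f = Ide sSet X"
      using Hom_sSetD(1) [OF f] level_in [OF f]
      by (intro sSet_map_eqI [OF Comp_in [OF f g] Ide_in]) (simp_all add: level_Comp [OF f g] level_Ide \<psi>)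
    show "Comp sSet f (sset_map Y \<psi> X) = Ide sSet Y"
      using Hom_sSetD(2) [OF f]
      by (intro sSet_map_eqI [OF Comp_in [OF g f] Ide_in]) (simp_all add: level_Comp [OF g f] level_Ide \<psi>')
  qed
qed

section \<open>Discrete simplicial sets\<close>

definition disc :: "'u set \<Rightarrow> 'u sset" where
  "disc S = \<lparr>fobj = (\<lambda>n. S), farr = (\<lambda>\<theta>\<in>Arr DELTA. Ide SET S)\<rparr>"

lemma fobj_disc [simp]: "fobj (disc S) n = S"
  by (simp add: disc_def)

lemma act_disc: "\<theta> \<in> Hom DELTA m n \<Longrightarrow> x \<in> S \<Longrightarrow> act (disc S) \<theta> x = x"
  by (simp add: disc_def act_def HomD)

lemma disc_in_Obj [simp]: "disc S \<in> Obj sSet"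
proof -
  interpret DELTA: category DELTA by (rule category_DELTA)
  interpret SET: category SET by (rule category_SET)
  have Ide: "Ide SET S \<in> Hom SET S S" by (rule SET.Ide_in) simp
  have "cat_functor (op_cat DELTA) SET (disc S)"
  proof
    fix \<theta> \<eta> and m n k :: nat
    assume \<theta>: "\<theta> \<in> Hom (op_cat DELTA) m n" and \<eta>: "\<eta> \<in> Hom (op_cat DELTA) n k"
    have "Comp (op_cat DELTA) \<eta> \<theta> \<in> Arr DELTA"
      using \<theta> \<eta> DELTA.Comp_in [of \<eta> k n \<theta> m] by (simp add: HomD del: DELTA_simps)
    then show "farr (disc S) (Comp (op_cat DELTA) \<eta> \<theta>) =
          Comp SET (farr (disc S) \<eta>) (farr (disc S) \<theta>)"
      using HomD(1) [OF \<theta>] HomD(1) [OF \<eta>] SET.Comp_Ide [OF Ide] by (simp add: disc_def del: SET_simps DELTA_simps)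
  next
    fix \<theta> and m n :: nat assume "\<theta> \<in> Hom (op_cat DELTA) m n"
    then have "\<theta> \<in> Arr DELTA" using HomD(1) [of \<theta> "op_cat DELTA"] by (simp del: DELTA_simps)
    then show "farr (disc S) \<theta> \<in> Hom SET (fobj (disc S) m) (fobj (disc S) n)"
      using Ide by (simp add: disc_def del: SET_simps DELTA_simps)
  next
    fix n :: nat
    have "Ide DELTA n \<in> Arr DELTA" using HomD(1) [OF DELTA.Ide_in, of n] by simp
    then show "farr (disc S) (Ide (op_cat DELTA) n) = Ide SET (fobj (disc S) n)"
      by (simp add: disc_def del: SET_simps DELTA_simps)
  qed simp
  then show ?thesis
    by (simp add: sSet_def Obj_functor_cat) (simp add: disc_def)
qed

definition vertex_map :: "nat \<Rightarrow> delta_arr" where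
  "vertex_map n = (n, (\<lambda>i\<in>{..n}. 0), 0)"

lemma vertex_map_in_Hom: "vertex_map n \<in> Hom DELTA n 0"
  by (simp add: vertex_map_def Hom_DELTA monotone_on_def)

lemma vertex_map_unique:
  assumes "\<theta> \<in> Hom DELTA n 0"
  shows "\<theta> = vertex_map n"
proof -
  have "fst (snd \<theta>) = (\<lambda>i\<in>{..n}. 0)"
    using Hom_DELTAD(2) [OF assms] by (intro extensionalityI [of _ "{..n}"]) (auto simp: PiE_def Pi_def)
  then show ?thesis
    using Hom_DELTAD(1) [OF assms] by (simp add: vertex_map_def)
qed

lemma level_from_disc:
  assumes f: "f \<in> Hom sSet (disc S) Z" and s: "s \<in> S"
  shows "level f n s = act Z (vertex_map n) (level f 0 s)"
  using Hom_sSetD(7) [OF f vertex_map_in_Hom, of s] s act_disc [OF vertex_map_in_Hom s] by simp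

lemma map_from_disc_in_Hom:
  assumes Z: "Z \<in> Obj sSet" and g: "\<And>s. s \<in> S \<Longrightarrow> g s \<in> fobj Z 0"
  shows "sset_map (disc S) (\<lambda>n s. act Z (vertex_map n) (g s)) Z \<in> Hom sSet (disc S) Z"
proof (rule sset_map_in_Hom)
  interpret DELTA: category DELTA by (rule category_DELTA)
  fix m n \<theta> s assume \<theta>: "\<theta> \<in> Hom DELTA m n" and s: "s \<in> fobj (disc S) n"
  show "act Z \<theta> (act Z (vertex_map n) (g s)) = act Z (vertex_map m) (g (act (disc S) \<theta> s))"
    using act_Comp [OF Z \<theta> vertex_map_in_Hom g, of s] s act_disc [OF \<theta>, of s S]
      vertex_map_unique [OF DELTA.Comp_in [OF \<theta> vertex_map_in_Hom]] by simp
next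
  show "act Z (vertex_map n) (g s) \<in> fobj Z n" if "s \<in> fobj (disc S) n" for n s
    using that by (simp add: act_in [OF Z vertex_map_in_Hom g])
qed (simp_all add: Z)

lemma act_vertex_map_0: "Z \<in> Obj sSet \<Longrightarrow> z \<in> fobj Z 0 \<Longrightarrow> act Z (vertex_map 0) z = z"
  using act_Ide [of Z z 0] vertex_map_unique [OF category.Ide_in [OF category_DELTA]]
  by (simp del: DELTA_simps(4))

section \<open>Adjunctions and lifting properties\<close>

lemma adjunctionD:
  assumes "adjunction C D L R \<eta>"
  shows "cat_functor C D L" "cat_functor D C R"
    and "X \<in> Obj C \<Longrightarrow> \<eta> X \<in> Hom C X (fobj R (fobj L X))"
    and "category C \<Longrightarrow> i \<in> Hom C X X' \<Longrightarrow> Comp C (farr R (farr L i)) (\<eta> X) = Comp C (\<eta> X') i"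
    and "X \<in> Obj C \<Longrightarrow> Y \<in> Obj D \<Longrightarrow>
      bij_betw (adjunct C R \<eta> X) (Hom D (fobj L X) Y) (Hom C X (fobj R Y))"
proof -
  have n: "nat_trans C C (ftor_id C) (ftor_comp C R L) \<eta>"
    using assms by (simp add: adjunction_def)
  show "\<eta> X \<in> Hom C X (fobj R (fobj L X))" if "X \<in> Obj C"
    using nat_transD(1) [OF n that] that by simp
  show "Comp C (farr R (farr L i)) (\<eta> X) = Comp C (\<eta> X') i" if "category C" "i \<in> Hom C X X'"
    using nat_transD(2) [OF n that(2)] HomD(1) [OF that(2)] by simp
qed (use assms in \<open>simp_all add: adjunction_def\<close>)

lemma adjunct_Comp_right:
  assumes "category C" "adjunction C D L R \<eta>"
    and X: "X \<in> Obj C" and f: "f \<in> Hom D (fobj L X) Y" and g: "g \<in> Hom D Y Y'"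
  shows "adjunct C R \<eta> X (Comp D g f) = Comp C (farr R g) (adjunct C R \<eta> X f)"
proof -
  interpret C: category C by fact
  note adj = adjunctionD [OF assms(2)]
  interpret R: cat_functor D C R by (rule adj)
  show ?thesis
    using C.Comp_assoc [OF adj(3) [OF X] R.farr_in [OF f] R.farr_in [OF g]] R.farr_Comp [OF f g]
    by (simp add: adjunct_def)
qed

lemma adjunct_Comp_left:
  assumes "category C" "adjunction C D L R \<eta>"
    and i: "i \<in> Hom C X X'" and f: "f \<in> Hom D (fobj L X') Y"
  shows "adjunct C R \<eta> X (Comp D f (farr L i)) = Comp C (adjunct C R \<eta> X' f) i"
proof -
  interpret C: category C by fact
  note adj = adjunctionD [OF assms(2)]
  interpret L: cat_functor C D L by (rule adj)
  interpret R: cat_functor D C R by (rule adj)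
  note X = C.Hom_Obj [OF i]
  have "adjunct C R \<eta> X (Comp D f (farr L i)) = Comp C (farr R f) (Comp C (farr R (farr L i)) (\<eta> X))"
    using adjunct_Comp_right [OF assms(1,2) X(1) L.farr_in [OF i] f] by (simp add: adjunct_def)
  also have "\<dots> = Comp C (farr R f) (Comp C (\<eta> X') i)"
    using adj(4) [OF assms(1) i] by simp
  also have "\<dots> = Comp C (adjunct C R \<eta> X' f) i"
    using C.Comp_assoc [OF i adj(3) [OF X(2)] R.farr_in [OF f]] by (simp add: adjunct_def)
  finally show ?thesis .
qed

text \<open>A square from $Li$ to $p$ transposes to a square from $i$ to $Rp$, and a diagonal of the
latter transposes back.\<close>

lemma adjunction_has_lifting:
  assumes C: "category C" and D: "category D" and adj: "adjunction C D L R \<eta>"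
    and i: "i \<in> Arr C" and p: "p \<in> Arr D" and lift: "has_lifting C i (farr R p)"
  shows "has_lifting D (farr L i) p"
proof -
  interpret C: category C by fact
  interpret D: category D by fact
  note a = adjunctionD [OF adj]
  interpret L: cat_functor C D L by (rule a)
  interpret R: cat_functor D C R by (rule a)
  obtain X X' where i': "i \<in> Hom C X X'" using Arr_Hom [OF i] by blast
  obtain E E' where p': "p \<in> Hom D E E'" using Arr_Hom [OF p] by blast
  note X = C.Hom_Obj [OF i'] and E = D.Hom_Obj [OF p']
  have ends [simp]: "Dom C i = X" "Cod C i = X'" "Dom D (farr L i) = fobj L X"
    "Cod D (farr L i) = fobj L X'" "Dom D p = E" "Cod D p = E'" "Dom C (farr R p) = fobj R E"
    "Cod C (farr R p) = fobj R E'"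
    using HomD(2,3) [OF i'] HomD(2,3) [OF L.farr_in [OF i']] HomD(2,3) [OF p']
      HomD(2,3) [OF R.farr_in [OF p']] by simp_all
  note bij = bij_betwE [OF a(5)] and inj = bij_betw_imp_inj_on [OF a(5), THEN inj_onD]
  show ?thesis
    unfolding has_lifting_def ends
  proof (intro ballI impI)
    fix u v
    assume u: "u \<in> Hom D (fobj L X) E" and v: "v \<in> Hom D (fobj L X') E'"
      and sq: "Comp D p u = Comp D v (farr L i)"
    let ?u = "adjunct C R \<eta> X u" and ?v = "adjunct C R \<eta> X' v"
    have u': "?u \<in> Hom C X (fobj R E)" and v': "?v \<in> Hom C X' (fobj R E')"
      using bij X E u v by blast+
    have "Comp C (farr R p) ?u = Comp C ?v i"
      using adjunct_Comp_right [OF C adj X(1) u p'] adjunct_Comp_left [OF C adj i' v] sq by simp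
    then obtain h where h: "h \<in> Hom C X' (fobj R E)" "Comp C h i = ?u" "Comp C (farr R p) h = ?v"
      using lift u' v' unfolding has_lifting_def ends by blast
    obtain k where k: "k \<in> Hom D (fobj L X') E" "adjunct C R \<eta> X' k = h"
      using bij_betw_imp_surj_on [OF a(5) [OF X(2) E(1)]] h(1) by (metis imageE)
    have "Comp D k (farr L i) = u"
      using adjunct_Comp_left [OF C adj i' k(1)] k(2) h(2)
      by (intro inj [OF X(1) E(1) _ D.Comp_in [OF L.farr_in [OF i'] k(1)] u]) simp
    moreover have "Comp D p k = v"
      using adjunct_Comp_right [OF C adj X(2) k(1) p'] k(2) h(3)
      by (intro inj [OF X(2) E(2) _ D.Comp_in [OF k(1) p'] v]) simp
    ultimately show "\<exists>h\<in>Hom D (fobj L X') E. Comp D h (farr L i) = u \<and> Comp D p h = v"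
      using k(1) by blast
  qed
qed

section \<open>Simplicial presheaves\<close>

abbreviation component :: "'x \<times> ('a \<Rightarrow> 'y) \<times> 'z \<Rightarrow> 'a \<Rightarrow> 'y" where
  "component t a \<equiv> fst (snd t) a"

lemma category_sPSh: "category A \<Longrightarrow> category (sPSh A)"
  unfolding sPSh_def by (intro category_functor_cat category_op_cat category_sSet)

lemma sPSh_functor: "X \<in> Obj (sPSh A) \<Longrightarrow> cat_functor (op_cat A) sSet X"
  by (simp add: sPSh_def Obj_functor_cat)

lemma sPSh_ObjI:
  assumes "cat_functor (op_cat A) sSet X" "fobj X \<in> extensional (Obj A)" "farr X \<in> extensional (Arr A)"
  shows "X \<in> Obj (sPSh A)"
  using assms by (simp add: sPSh_def Obj_functor_cat)

lemma sPSh_obj_in: "X \<in> Obj (sPSh A) \<Longrightarrow> a \<in> Obj A \<Longrightarrow> fobj X a \<in> Obj sSet"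
  using cat_functor.fobj_in [OF sPSh_functor] by fastforce

lemma sPSh_arr_in:
  "X \<in> Obj (sPSh A) \<Longrightarrow> k \<in> Hom A a a' \<Longrightarrow> farr X k \<in> Hom sSet (fobj X a') (fobj X a)"
  using cat_functor.farr_in [OF sPSh_functor] by fastforce

lemma sPSh_Ide: "X \<in> Obj (sPSh A) \<Longrightarrow> a \<in> Obj A \<Longrightarrow> farr X (Ide A a) = Ide sSet (fobj X a)"
  using cat_functor.farr_Ide [OF sPSh_functor, of X A a] by simp

lemma sPSh_Comp:
  assumes "X \<in> Obj (sPSh A)" "k \<in> Hom A a a'" "k' \<in> Hom A a' a''"
  shows "farr X (Comp A k' k) = Comp sSet (farr X k) (farr X k')"
  using cat_functor.farr_Comp [OF sPSh_functor [OF assms(1)], of k' a'' a' k a] assms(2,3) by simp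

lemma sPSh_HomD:
  assumes "t \<in> Hom (sPSh A) X Y"
  shows "X \<in> Obj (sPSh A)" "Y \<in> Obj (sPSh A)" "fst t = X" "snd (snd t) = Y"
    and "a \<in> Obj A \<Longrightarrow> component t a \<in> Hom sSet (fobj X a) (fobj Y a)"
    and "k \<in> Hom A a a' \<Longrightarrow>
      Comp sSet (farr Y k) (component t a') = Comp sSet (component t a) (farr X k)"
proof -
  note t = Hom_functor_catD [OF assms [unfolded sPSh_def]]
  show "X \<in> Obj (sPSh A)" "Y \<in> Obj (sPSh A)" using t(2,3) by (simp_all add: sPSh_def)
  show "fst t = X" "snd (snd t) = Y" using HomD(2,3) [OF assms] by (simp_all add: sPSh_def)
  show "component t a \<in> Hom sSet (fobj X a) (fobj Y a)" if "a \<in> Obj A"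
    using nat_transD(1) [OF t(4)] that by simp
  show "Comp sSet (farr Y k) (component t a') = Comp sSet (component t a) (farr X k)"
    if "k \<in> Hom A a a'"
    using nat_transD(2) [OF t(4), of k a' a] that by simp
qed

lemma sPSh_map_eqI:
  assumes "s \<in> Hom (sPSh A) X Y" "t \<in> Hom (sPSh A) X Y"
    and "\<And>a. a \<in> Obj A \<Longrightarrow> component s a = component t a"
  shows "s = t"
  using functor_cat_eqI [OF assms(1,2) [unfolded sPSh_def]] assms(3) by simp

lemma sPSh_mapI:
  assumes "category A" "X \<in> Obj (sPSh A)" "Y \<in> Obj (sPSh A)"
    and in_Hom: "\<And>a. a \<in> Obj A \<Longrightarrow> \<alpha> a \<in> Hom sSet (fobj X a) (fobj Y a)"
    and natural: "\<And>k a a'. k \<in> Hom A a a' \<Longrightarrow>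
      Comp sSet (farr Y k) (\<alpha> a') = Comp sSet (\<alpha> a) (farr X k)"
  shows "(X, restrict \<alpha> (Obj A), Y) \<in> Hom (sPSh A) X Y"
  unfolding sPSh_def
proof (intro Hom_functor_catI nat_transI category_op_cat)
  fix k a' a assume "k \<in> Hom (op_cat A) a' a"
  then have k: "k \<in> Hom A a a'" by simp
  show "Comp sSet (farr Y k) (restrict \<alpha> (Obj A) a') = Comp sSet (restrict \<alpha> (Obj A) a) (farr X k)"
    using natural [OF k] category.Hom_Obj [OF assms(1) k] by simp
qed (use assms in \<open>simp_all add: sPSh_def\<close>)

lemma component_Comp [simp]:
  "a \<in> Obj A \<Longrightarrow> component (Comp (sPSh A) t s) a = Comp sSet (component t a) (component s a)"
  by (simp add: sPSh_def)

lemma component_Ide [simp]: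
  "a \<in> Obj A \<Longrightarrow> component (Ide (sPSh A) X) a = Ide sSet (fobj X a)"
  by (simp add: sPSh_def)

lemma restr_fobj_in_Obj:
  assumes "category C" "cat_functor C B F" "Y \<in> Obj (sPSh B)"
  shows "fobj (restr C B F) Y \<in> Obj (sPSh C)"
proof (rule sPSh_ObjI)
  show "cat_functor (op_cat C) sSet (fobj (restr C B F) Y)"
    using cat_functor_ftor_comp [OF category_op_cat [OF assms(1)] cat_functor_op_cat [OF assms(2)]
        sPSh_functor [OF assms(3)]]
    by (simp add: restr_def)
qed (simp_all add: restr_def ftor_comp_def)

lemma restr_simps [simp]:
  "c \<in> Obj C \<Longrightarrow> fobj (fobj (restr C B F) Y) c = fobj Y (fobj F c)"
  "k \<in> Arr C \<Longrightarrow> farr (fobj (restr C B F) Y) k = farr Y (farr F k)"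
  "c \<in> Obj C \<Longrightarrow> component (farr (restr C B F) t) c = component t (fobj F c)"
  by (simp_all add: restr_def case_prod_beta)

lemma cat_functor_restr:
  assumes C: "category C" and B: "category B" and F: "cat_functor C B F"
  shows "cat_functor (sPSh B) (sPSh C) (restr C B F)"
proof -
  interpret C: category C by fact
  interpret F: cat_functor C B F by fact
  interpret PB: category "sPSh B" by (rule category_sPSh [OF B])
  interpret PC: category "sPSh C" by (rule category_sPSh [OF C])
  have arr: "farr (restr C B F) t \<in> Hom (sPSh C) (fobj (restr C B F) X) (fobj (restr C B F) Y)"
    if t: "t \<in> Hom (sPSh B) X Y" for t X Y
  proof -
    have "farr (restr C B F) t =
        (fobj (restr C B F) X, \<lambda>c\<in>Obj C. component t (fobj F c), fobj (restr C B F) Y)"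
      using sPSh_HomD(3,4) [OF t] by (simp add: restr_def case_prod_beta)
    also have "\<dots> \<in> Hom (sPSh C) (fobj (restr C B F) X) (fobj (restr C B F) Y)"
    proof (rule sPSh_mapI [OF C])
      fix k c c' assume k: "k \<in> Hom C c c'"
      show "Comp sSet (farr (fobj (restr C B F) Y) k) (component t (fobj F c')) =
            Comp sSet (component t (fobj F c)) (farr (fobj (restr C B F) X) k)"
        using sPSh_HomD(6) [OF t F.farr_in [OF k]] HomD(1) [OF k] by simp
    qed (use sPSh_HomD [OF t] restr_fobj_in_Obj [OF C F] F.fobj_in in simp_all)
    finally show ?thesis .
  qed
  show ?thesis
  proof
    show "fobj (restr C B F) X \<in> Obj (sPSh C)" if "X \<in> Obj (sPSh B)" for X :: "('c, 'd, 'e) spsh"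
      by (rule restr_fobj_in_Obj [OF C F that])
    show "farr (restr C B F) (Ide (sPSh B) X) = Ide (sPSh C) (fobj (restr C B F) X)"
      if X: "X \<in> Obj (sPSh B)" for X :: "('c, 'd, 'e) spsh"
      using F.fobj_in
      by (intro sPSh_map_eqI [OF arr [OF PB.Ide_in [OF X]] PC.Ide_in [OF restr_fobj_in_Obj [OF C F X]]])
        simp
    fix s t :: "('c, 'd, 'e) spsh_map" and X Y Z
    assume s: "s \<in> Hom (sPSh B) X Y" and t: "t \<in> Hom (sPSh B) Y Z"
    show "farr (restr C B F) (Comp (sPSh B) t s) =
        Comp (sPSh C) (farr (restr C B F) t) (farr (restr C B F) s)"
      using F.fobj_in
      by (intro sPSh_map_eqI [OF arr [OF PB.Comp_in [OF s t]] PC.Comp_in [OF arr [OF s] arr [OF t]]])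
        simp
  qed (rule arr)
qed

section \<open>Comma categories and the left Kan extension\<close>

lemma Obj_comma: "(c, h) \<in> Obj (comma C B F b) \<longleftrightarrow> c \<in> Obj C \<and> h \<in> Hom B b (fobj F c)"
  by (simp add: comma_def)

lemma Hom_comma:
  "((x, k, y)) \<in> Hom (comma C B F b) (c, h) (c', h') \<longleftrightarrow>
     x = (c, h) \<and> y = (c', h') \<and> (c, h) \<in> Obj (comma C B F b) \<and> (c', h') \<in> Obj (comma C B F b) \<and>
     k \<in> Hom C c c' \<and> Comp B (farr F k) h = h'"
  by (auto simp: Hom_def comma_def)

lemma comma_simps [simp]:
  "Dom (comma C B F b) t = fst t" "Cod (comma C B F b) t = snd (snd t)"
  "Ide (comma C B F b) (c, h) = ((c, h), Ide C c, (c, h))"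
  "Comp (comma C B F b) t s = (fst s, Comp C (fst (snd t)) (fst (snd s)), snd (snd t))"
  by (simp_all add: comma_def)

lemma comma_HomE:
  assumes "t \<in> Hom (comma C B F b) x y"
  obtains c h c' k where "x = (c, h)" "y = (c', Comp B (farr F k) h)"
    "t = ((c, h), k, (c', Comp B (farr F k) h))" "c \<in> Obj C" "h \<in> Hom B b (fobj F c)" "k \<in> Hom C c c'"
  using assms by (auto simp: Hom_def comma_def)

context
  fixes C :: "('c, 'k) cat" and B :: "('b, 'l) cat" and F :: "('c, 'k, 'b, 'l) ftor" and b :: 'b
  assumes C: "category C" and B: "category B" and F: "cat_functor C B F"
begin

interpretation C: category C by (rule C)
interpretation B: category B by (rule B)
interpretation F: cat_functor C B F by (rule F)

lemma comma_HomI: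
  assumes "h \<in> Hom B b (fobj F c)" "k \<in> Hom C c c'"
  shows "((c, h), k, (c', Comp B (farr F k) h)) \<in> Hom (comma C B F b) (c, h) (c', Comp B (farr F k) h)"
  using assms C.Hom_Obj [OF assms(2)] B.Comp_in [OF assms(1) F.farr_in [OF assms(2)]]
  by (simp add: Hom_comma Obj_comma)

lemma category_comma: "category (comma C B F b)"
proof
  fix t x y assume t: "t \<in> Hom (comma C B F b) x y"
  obtain c h c' k where 1: "x = (c, h)" "y = (c', Comp B (farr F k) h)"
    "t = ((c, h), k, (c', Comp B (farr F k) h))" "c \<in> Obj C" "h \<in> Hom B b (fobj F c)" "k \<in> Hom C c c'"
    using comma_HomE [OF t] .
  show "Comp (comma C B F b) t (Ide (comma C B F b) x) = t"
    "Comp (comma C B F b) (Ide (comma C B F b) y) t = t"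
    using 1 C.Comp_Ide C.Ide_Comp by simp_all
  fix s z assume s: "s \<in> Hom (comma C B F b) y z"
  obtain c'' k' where 2: "s = (y, k', z)" "k' \<in> Hom C c' c''"
    "z = (c'', Comp B (farr F k') (Comp B (farr F k) h))"
    using comma_HomE [OF s] 1(2) by (metis fst_conv snd_conv)
  have z: "z = (c'', Comp B (farr F (Comp C k' k)) h)"
    using 2 B.Comp_assoc [OF 1(5) F.farr_in [OF 1(6)] F.farr_in [OF 2(2)]] F.farr_Comp [OF 1(6) 2(2)]
    by simp
  show "Comp (comma C B F b) s t \<in> Hom (comma C B F b) x z"
    using comma_HomI [OF 1(5) C.Comp_in [OF 1(6) 2(2)]] 1 2(1) z by simp
  fix r w assume r: "r \<in> Hom (comma C B F b) z w"
  obtain c3 k'' where 3: "r = (z, k'', w)" "k'' \<in> Hom C c'' c3"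
    using comma_HomE [OF r] z by (metis fst_conv snd_conv)
  show "Comp (comma C B F b) r (Comp (comma C B F b) s t) =
        Comp (comma C B F b) (Comp (comma C B F b) r s) t"
    using 1 2 3 C.Comp_assoc by simp
next
  fix x assume "x \<in> Obj (comma C B F b)"
  then obtain c h where x: "x = (c, h)" "c \<in> Obj C" "h \<in> Hom B b (fobj F c)"
    by (cases x) (auto simp: Obj_comma)
  show "Ide (comma C B F b) x \<in> Hom (comma C B F b) x x"
    using comma_HomI [OF x(3) C.Ide_in [OF x(2)]] x B.Ide_Comp [OF x(3)] F.farr_Ide by simp
next
  fix t assume t: "t \<in> Arr (comma C B F b)"
  then show "Dom (comma C B F b) t \<in> Obj (comma C B F b)"
    and "Cod (comma C B F b) t \<in> Obj (comma C B F b)"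
    by (auto simp: comma_def)
qed

lemma cat_functor_lan_diagram:
  assumes "X \<in> Obj (sPSh C)"
  shows "cat_functor (op_cat (comma C B F b)) sSet (lan_diagram C B F X b)"
proof -
  have "cat_functor (comma C B F b) C \<lparr>fobj = fst, farr = \<lambda>t. fst (snd t)\<rparr>"
    by unfold_locales (auto simp: Obj_comma elim!: comma_HomE)
  then show ?thesis
    unfolding lan_diagram_def
    by (intro cat_functor_ftor_comp [OF category_op_cat [OF category_comma] cat_functor_op_cat
          sPSh_functor [OF assms]])
qed

lemma is_cocone_lan_diagram:
  "is_cocone (op_cat (comma C B F b)) sSet (lan_diagram C B F X b) l p \<longleftrightarrow>
     l \<in> Obj sSet \<and>
     (\<forall>c h. c \<in> Obj C \<longrightarrow> h \<in> Hom B b (fobj F c) \<longrightarrow> p (c, h) \<in> Hom sSet (fobj X c) l) \<and>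
     (\<forall>c h c' k. h \<in> Hom B b (fobj F c) \<longrightarrow> k \<in> Hom C c c' \<longrightarrow>
        Comp sSet (p (c, h)) (farr X k) = p (c', Comp B (farr F k) h))"
proof -
  have "(\<forall>j\<in>Obj (comma C B F b). p j \<in> Hom sSet (fobj (lan_diagram C B F X b) j) l) \<longleftrightarrow>
      (\<forall>c h. c \<in> Obj C \<longrightarrow> h \<in> Hom B b (fobj F c) \<longrightarrow> p (c, h) \<in> Hom sSet (fobj X c) l)"
    by (auto simp add: lan_diagram_def Ball_def Obj_comma split_paired_all)
  moreover have "(\<forall>f\<in>Arr (comma C B F b).
        Comp sSet (p (fst f)) (farr (lan_diagram C B F X b) f) = p (snd (snd f))) \<longleftrightarrow>
      (\<forall>c h c' k. h \<in> Hom B b (fobj F c) \<longrightarrow> k \<in> Hom C c c' \<longrightarrow>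
        Comp sSet (p (c, h)) (farr X k) = p (c', Comp B (farr F k) h))" (is "?L \<longleftrightarrow> ?R")
  proof
    assume L: ?L
    show ?R
    proof (intro allI impI)
      fix c h c' k assume hk: "h \<in> Hom B b (fobj F c)" "k \<in> Hom C c c'"
      note t = HomD(1) [OF comma_HomI [OF hk]]
      from bspec [OF L t] show "Comp sSet (p (c, h)) (farr X k) = p (c', Comp B (farr F k) h)"
        using t by (simp add: lan_diagram_def)
    qed
  next
    assume R: ?R
    show ?L
    proof
      fix f assume f: "f \<in> Arr (comma C B F b)"
      from comma_HomE [OF Arr_Hom [OF this]] obtain c h c' k
        where "f = ((c, h), k, (c', Comp B (farr F k) h))" "h \<in> Hom B b (fobj F c)" "k \<in> Hom C c c'"
        by metis
      then show "Comp sSet (p (fst f)) (farr (lan_diagram C B F X b) f) = p (snd (snd f))"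
        using R f by (simp add: lan_diagram_def)
    qed
  qed
  ultimately show ?thesis by (simp add: is_cocone_def)
qed

end

text \<open>Initial objects in all comma categories $b \downarrow F$ mean that $F$ has a left adjoint.  Then
each colimit defining $F_*$ runs over a shape with a terminal object; hence it exists, and $F_*$ has
the universal property of a left Kan extension.\<close>

locale functor_with_initial_commas =
  C: category C + B: category B + F: cat_functor C B F
  for C :: "('c, 'k) cat" and B :: "('b, 'l) cat" and F :: "('c, 'k, 'b, 'l) ftor" +
  assumes comma_initial: "b \<in> Obj B \<Longrightarrow> \<exists>t. is_initial (comma C B F b) t"
begin

sublocale sSet: category sSet by (rule category_sSet)
sublocale PC: category "sPSh C" by (rule category_sPSh [OF C.category_axioms])
sublocale PB: category "sPSh B" by (rule category_sPSh [OF B.category_axioms])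

lemmas axms = C.category_axioms B.category_axioms F.cat_functor_axioms

abbreviation "val \<equiv> lan_val C B F"
abbreviation "leg \<equiv> lan_leg C B F"
abbreviation "mate \<equiv> adjunct (sPSh C) (restr C B F) (lan_unit C B F)"

lemma lan_is_colimit:
  assumes "X \<in> Obj (sPSh C)" "b \<in> Obj B"
  shows "is_colimit (op_cat (comma C B F b)) sSet (lan_diagram C B F X b)
    (val X b) (leg X b)"
proof -
  let ?P = "\<lambda>z. case z of (l, p) \<Rightarrow> is_colimit (op_cat (comma C B F b)) sSet (lan_diagram C B F X b) l p"
  obtain t where "is_initial (comma C B F b) t" using comma_initial [OF assms(2)] by blast
  then obtain p where "?P (fobj (lan_diagram C B F X b) t, p)"
    using sSet.terminal_colimit [OF category_op_cat [OF category_comma [OF axms]]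
        cat_functor_lan_diagram [OF axms assms(1)]] is_terminal_op_cat by (metis case_prodI)
  then have "?P (SOME z. ?P z)" by (rule someI)
  then show ?thesis
    unfolding lan_val_def lan_leg_def colimit_def case_prod_unfold .
qed

lemma lan_leg_is_iso:
  assumes "X \<in> Obj (sPSh C)" "b \<in> Obj B" "is_initial (comma C B F b) t"
  shows "is_iso sSet (leg X b t)"
  using sSet.terminal_colimit_leg_is_iso [OF category_op_cat [OF category_comma [OF axms]]
      cat_functor_lan_diagram [OF axms assms(1)] _ lan_is_colimit [OF assms(1,2)]] assms(3)
  by (simp add: is_terminal_op_cat)

lemma lan_cocone:
  assumes "X \<in> Obj (sPSh C)" "b \<in> Obj B"
  shows "val X b \<in> Obj sSet"
    and "c \<in> Obj C \<Longrightarrow> h \<in> Hom B b (fobj F c) \<Longrightarrow>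
      leg X b (c, h) \<in> Hom sSet (fobj X c) (val X b)"
    and "h \<in> Hom B b (fobj F c) \<Longrightarrow> k \<in> Hom C c c' \<Longrightarrow>
      Comp sSet (leg X b (c, h)) (farr X k) = leg X b (c', Comp B (farr F k) h)"
  using lan_is_colimit [OF assms] by (simp_all add: is_colimit_def is_cocone_lan_diagram [OF axms])

lemma lan_desc:
  assumes X: "X \<in> Obj (sPSh C)" and b: "b \<in> Obj B" and Z: "Z \<in> Obj sSet"
    and q: "\<And>c h. c \<in> Obj C \<Longrightarrow> h \<in> Hom B b (fobj F c) \<Longrightarrow> q c h \<in> Hom sSet (fobj X c) Z"
    and natural: "\<And>c h c' k. h \<in> Hom B b (fobj F c) \<Longrightarrow> k \<in> Hom C c c' \<Longrightarrow>
      Comp sSet (q c h) (farr X k) = q c' (Comp B (farr F k) h)"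
  shows "\<exists>!u. u \<in> Hom sSet (val X b) Z \<and>
    (\<forall>(c, h) \<in> Obj (comma C B F b). Comp sSet u (leg X b (c, h)) = q c h)"
proof -
  have "is_cocone (op_cat (comma C B F b)) sSet (lan_diagram C B F X b) Z (\<lambda>(c, h). q c h)"
    using Z q natural by (simp add: is_cocone_lan_diagram [OF axms])
  then have "\<exists>!u. u \<in> Hom sSet (val X b) Z \<and>
      (\<forall>j\<in>Obj (comma C B F b). Comp sSet u (leg X b j) = (\<lambda>(c, h). q c h) j)"
    using lan_is_colimit [OF X b] by (simp add: is_colimit_def)
  then show ?thesis by (simp add: case_prod_beta)
qed

lemma lan_val_map_eqI:
  assumes X: "X \<in> Obj (sPSh C)" and b: "b \<in> Obj B"
    and u: "u \<in> Hom sSet (val X b) Z" and v: "v \<in> Hom sSet (val X b) Z"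
    and eq: "\<And>c h. c \<in> Obj C \<Longrightarrow> h \<in> Hom B b (fobj F c) \<Longrightarrow>
      Comp sSet u (leg X b (c, h)) = Comp sSet v (leg X b (c, h))"
  shows "u = v"
proof -
  let ?P = "\<lambda>w. w \<in> Hom sSet (val X b) Z \<and>
    (\<forall>(c, h) \<in> Obj (comma C B F b). Comp sSet w (leg X b (c, h)) =
      Comp sSet v (leg X b (c, h)))"
  have "\<exists>!w. ?P w"
  proof (rule lan_desc [OF X b sSet.Hom_Obj(2) [OF v]])
    fix c h c' k assume hk: "h \<in> Hom B b (fobj F c)" "k \<in> Hom C c c'"
    show "Comp sSet (Comp sSet v (leg X b (c, h))) (farr X k) =
        Comp sSet v (leg X b (c', Comp B (farr F k) h))"
      using sSet.Comp_assoc [OF sPSh_arr_in [OF X hk(2)] lan_cocone(2) [OF X b _ hk(1)] v]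
        C.Hom_Obj [OF hk(2)] lan_cocone(3) [OF X b hk] by simp
  qed (blast intro: sSet.Comp_in lan_cocone(2) [OF X b] v)
  moreover have "?P u"
  proof (intro conjI u ballI)
    fix j assume "j \<in> Obj (comma C B F b)"
    then show "case j of (c, h) \<Rightarrow> Comp sSet u (leg X b (c, h)) =
        Comp sSet v (leg X b (c, h))"
      using eq by (cases j) (simp add: Obj_comma)
  qed
  moreover have "?P v" using v by simp
  ultimately show ?thesis by (rule ex1_unique)
qed

lemma lan_obj_fobj [simp]: "b \<in> Obj B \<Longrightarrow> fobj (lan_obj C B F X) b = val X b"
  by (simp add: lan_obj_def)

lemma lan_obj_farr:
  assumes X: "X \<in> Obj (sPSh C)" and g: "g \<in> Hom B b' b"
  shows "farr (lan_obj C B F X) g \<in> Hom sSet (val X b) (val X b')"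
    and "c \<in> Obj C \<Longrightarrow> h \<in> Hom B b (fobj F c) \<Longrightarrow>
      Comp sSet (farr (lan_obj C B F X) g) (leg X b (c, h)) = leg X b' (c, Comp B h g)"
proof -
  note bs = B.Hom_Obj [OF g]
  have "\<exists>!u. u \<in> Hom sSet (val X b) (val X b') \<and>
    (\<forall>(c, h) \<in> Obj (comma C B F b).
      Comp sSet u (leg X b (c, h)) = leg X b' (c, Comp B h g))"
  proof (rule lan_desc [OF X bs(2)])
    show "val X b' \<in> Obj sSet" by (rule lan_cocone(1) [OF X bs(1)])
    show "leg X b' (c, Comp B h g) \<in> Hom sSet (fobj X c) (val X b')"
      if "c \<in> Obj C" "h \<in> Hom B b (fobj F c)" for c h
      by (rule lan_cocone(2) [OF X bs(1) that(1) B.Comp_in [OF g that(2)]])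
    show "Comp sSet (leg X b' (c, Comp B h g)) (farr X k) =
        leg X b' (c', Comp B (Comp B (farr F k) h) g)"
      if "h \<in> Hom B b (fobj F c)" "k \<in> Hom C c c'" for c h c' k
      using lan_cocone(3) [OF X bs(1) B.Comp_in [OF g that(1)] that(2)]
        B.Comp_assoc [OF g that(1) F.farr_in [OF that(2)]] by simp
  qed
  from theI' [OF this]
  have "farr (lan_obj C B F X) g \<in> Hom sSet (val X b) (val X b') \<and>
    (\<forall>(c, h) \<in> Obj (comma C B F b).
      Comp sSet (farr (lan_obj C B F X) g) (leg X b (c, h)) = leg X b' (c, Comp B h g))"
    using HomD [OF g] by (simp add: lan_obj_def)
  then show "farr (lan_obj C B F X) g \<in> Hom sSet (val X b) (val X b')"
    and "c \<in> Obj C \<Longrightarrow> h \<in> Hom B b (fobj F c) \<Longrightarrow>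
      Comp sSet (farr (lan_obj C B F X) g) (leg X b (c, h)) = leg X b' (c, Comp B h g)"
    by (auto simp: Obj_comma)
qed

lemma lan_obj_in_Obj:
  assumes X: "X \<in> Obj (sPSh C)"
  shows "lan_obj C B F X \<in> Obj (sPSh B)"
proof (rule sPSh_ObjI)
  show "cat_functor (op_cat B) sSet (lan_obj C B F X)"
  proof
    fix b assume "b \<in> Obj (op_cat B)"
    then have b: "b \<in> Obj B" by simp
    show "fobj (lan_obj C B F X) b \<in> Obj sSet" using lan_cocone(1) [OF X b] b by simp
    note I = lan_obj_farr [OF X B.Ide_in [OF b]]
    have "farr (lan_obj C B F X) (Ide B b) = Ide sSet (val X b)"
    proof (rule lan_val_map_eqI [OF X b I(1) sSet.Ide_in [OF lan_cocone(1) [OF X b]]])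
      fix c h assume ch: "c \<in> Obj C" "h \<in> Hom B b (fobj F c)"
      show "Comp sSet (farr (lan_obj C B F X) (Ide B b)) (leg X b (c, h)) =
          Comp sSet (Ide sSet (val X b)) (leg X b (c, h))"
        using I(2) [OF ch] B.Comp_Ide [OF ch(2)] sSet.Ide_Comp [OF lan_cocone(2) [OF X b ch]] by simp
    qed
    then show "farr (lan_obj C B F X) (Ide (op_cat B) b) = Ide sSet (fobj (lan_obj C B F X) b)"
      using b by simp
  next
    fix g b b' assume "g \<in> Hom (op_cat B) b b'"
    then have g: "g \<in> Hom B b' b" by simp
    show "farr (lan_obj C B F X) g \<in> Hom sSet (fobj (lan_obj C B F X) b) (fobj (lan_obj C B F X) b')"
      using lan_obj_farr(1) [OF X g] B.Hom_Obj [OF g] by simp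
    fix g' b'' assume "g' \<in> Hom (op_cat B) b' b''"
    then have g': "g' \<in> Hom B b'' b'" by simp
    note gg = lan_obj_farr [OF X B.Comp_in [OF g' g]]
    note g1 = lan_obj_farr [OF X g] and g2 = lan_obj_farr [OF X g']
    show "farr (lan_obj C B F X) (Comp (op_cat B) g' g) =
        Comp sSet (farr (lan_obj C B F X) g') (farr (lan_obj C B F X) g)"
    proof (rule lan_val_map_eqI [OF X B.Hom_Obj(2) [OF g]])
      fix c h assume c: "c \<in> Obj C" and h: "h \<in> Hom B b (fobj F c)"
      have "Comp sSet (Comp sSet (farr (lan_obj C B F X) g') (farr (lan_obj C B F X) g)) (leg X b (c, h)) =
        leg X b'' (c, Comp B (Comp B h g) g')"
        using sSet.Comp_assoc [OF lan_cocone(2) [OF X B.Hom_Obj(2) [OF g] c h] g1(1) g2(1)] g1(2) [OF c h]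
          g2(2) [OF c B.Comp_in [OF g h]] by simp
      then show "Comp sSet (farr (lan_obj C B F X) (Comp (op_cat B) g' g)) (leg X b (c, h)) =
        Comp sSet (Comp sSet (farr (lan_obj C B F X) g') (farr (lan_obj C B F X) g)) (leg X b (c, h))"
        using gg(2) [OF c h] B.Comp_assoc [OF g' g h] by simp
    qed (use gg(1) sSet.Comp_in [OF g1(1) g2(1)] in simp_all)
  qed
qed (simp_all add: lan_obj_def)

lemma lan_fobj [simp]: "fobj (lan C B F) X = lan_obj C B F X"
  by (simp add: lan_def)

lemma lan_farr_component:
  assumes t: "t \<in> Hom (sPSh C) X X'" and b: "b \<in> Obj B"
  shows "component (farr (lan C B F) t) b \<in> Hom sSet (val X b) (val X' b)"
    and "c \<in> Obj C \<Longrightarrow> h \<in> Hom B b (fobj F c) \<Longrightarrow>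
      Comp sSet (component (farr (lan C B F) t) b) (leg X b (c, h)) =
      Comp sSet (leg X' b (c, h)) (component t c)"
proof -
  note t' = sPSh_HomD [OF t]
  have "\<exists>!u. u \<in> Hom sSet (val X b) (val X' b) \<and>
    (\<forall>(c, h) \<in> Obj (comma C B F b). Comp sSet u (leg X b (c, h)) =
      Comp sSet (leg X' b (c, h)) (component t c))"
  proof (rule lan_desc [OF t'(1) b lan_cocone(1) [OF t'(2) b]])
    show "Comp sSet (leg X' b (c, h)) (component t c) \<in> Hom sSet (fobj X c) (val X' b)"
      if "c \<in> Obj C" "h \<in> Hom B b (fobj F c)" for c h
      by (rule sSet.Comp_in [OF t'(5) [OF that(1)] lan_cocone(2) [OF t'(2) b that]])
    fix c h c' k assume hk: "h \<in> Hom B b (fobj F c)" "k \<in> Hom C c c'"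
    note c = C.Hom_Obj [OF hk(2)]
    show "Comp sSet (Comp sSet (leg X' b (c, h)) (component t c)) (farr X k) =
        Comp sSet (leg X' b (c', Comp B (farr F k) h)) (component t c')"
      using sSet.Comp_assoc [OF sPSh_arr_in [OF t'(1) hk(2)] t'(5) [OF c(1)] lan_cocone(2) [OF t'(2) b c(1) hk(1)]]
        sSet.Comp_assoc [OF t'(5) [OF c(2)] sPSh_arr_in [OF t'(2) hk(2)] lan_cocone(2) [OF t'(2) b c(1) hk(1)]]
        t'(6) [OF hk(2)] lan_cocone(3) [OF t'(2) b hk] by simp
  qed
  from theI' [OF this]
  have "component (farr (lan C B F) t) b \<in> Hom sSet (val X b) (val X' b) \<and>
    (\<forall>(c, h) \<in> Obj (comma C B F b).
      Comp sSet (component (farr (lan C B F) t) b) (leg X b (c, h)) =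
      Comp sSet (leg X' b (c, h)) (component t c))"
    using b t'(3,4) by (simp add: lan_def case_prod_beta)
  then show "component (farr (lan C B F) t) b \<in> Hom sSet (val X b) (val X' b)"
    and "c \<in> Obj C \<Longrightarrow> h \<in> Hom B b (fobj F c) \<Longrightarrow>
      Comp sSet (component (farr (lan C B F) t) b) (leg X b (c, h)) =
      Comp sSet (leg X' b (c, h)) (component t c)"
    by (auto simp: Obj_comma)
qed

lemma sPSh_map_from_lanI:
  assumes X: "X \<in> Obj (sPSh C)" and Y: "Y \<in> Obj (sPSh B)"
    and u: "\<And>b. b \<in> Obj B \<Longrightarrow> u b \<in> Hom sSet (val X b) (fobj Y b)"
    and natural: "\<And>g b b' c h. g \<in> Hom B b' b \<Longrightarrow> c \<in> Obj C \<Longrightarrow> h \<in> Hom B b (fobj F c) \<Longrightarrow>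
      Comp sSet (farr Y g) (Comp sSet (u b) (leg X b (c, h))) =
      Comp sSet (u b') (leg X b' (c, Comp B h g))"
  shows "(lan_obj C B F X, restrict u (Obj B), Y) \<in> Hom (sPSh B) (lan_obj C B F X) Y"
proof (rule sPSh_mapI [OF B.category_axioms lan_obj_in_Obj [OF X] Y])
  fix g b' b assume g: "g \<in> Hom B b' b"
  note b = B.Hom_Obj [OF g] and Yg = sPSh_arr_in [OF Y g] and Xg = lan_obj_farr [OF X g]
  show "Comp sSet (farr Y g) (u b) = Comp sSet (u b') (farr (lan_obj C B F X) g)"
  proof (rule lan_val_map_eqI [OF X b(2) sSet.Comp_in [OF u [OF b(2)] Yg] sSet.Comp_in [OF Xg(1) u [OF b(1)]]])
    fix c h assume ch: "c \<in> Obj C" "h \<in> Hom B b (fobj F c)"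
    show "Comp sSet (Comp sSet (farr Y g) (u b)) (leg X b (c, h)) =
        Comp sSet (Comp sSet (u b') (farr (lan_obj C B F X) g)) (leg X b (c, h))"
      using sSet.Comp_assoc [OF lan_cocone(2) [OF X b(2) ch] u [OF b(2)] Yg]
        sSet.Comp_assoc [OF lan_cocone(2) [OF X b(2) ch] Xg(1) u [OF b(1)]]
        Xg(2) [OF ch] natural [OF g ch] by simp
  qed
qed (use u in simp)

lemma lan_farr_in_Hom:
  assumes t: "t \<in> Hom (sPSh C) X X'"
  shows "farr (lan C B F) t \<in> Hom (sPSh B) (lan_obj C B F X) (lan_obj C B F X')"
proof -
  note t' = sPSh_HomD [OF t]
  have "farr (lan C B F) t = (lan_obj C B F X, restrict (component (farr (lan C B F) t)) (Obj B), lan_obj C B F X')"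
    using t'(3,4) by (simp add: lan_def case_prod_beta cong: restrict_cong)
  also have "\<dots> \<in> Hom (sPSh B) (lan_obj C B F X) (lan_obj C B F X')"
  proof (rule sPSh_map_from_lanI [OF t'(1) lan_obj_in_Obj [OF t'(2)]])
    fix g b b' c h assume g: "g \<in> Hom B b' b" and ch: "c \<in> Obj C" "h \<in> Hom B b (fobj F c)"
    note b = B.Hom_Obj [OF g]
    show "Comp sSet (farr (lan_obj C B F X') g)
            (Comp sSet (component (farr (lan C B F) t) b) (leg X b (c, h))) =
          Comp sSet (component (farr (lan C B F) t) b') (leg X b' (c, Comp B h g))"
      using lan_farr_component(2) [OF t b(2) ch] lan_farr_component(2) [OF t b(1) ch(1) B.Comp_in [OF g ch(2)]]
        sSet.Comp_assoc [OF t'(5) [OF ch(1)] lan_cocone(2) [OF t'(2) b(2) ch] lan_obj_farr(1) [OF t'(2) g]]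
        lan_obj_farr(2) [OF t'(2) g ch] by simp
  qed (use lan_farr_component(1) [OF t] in simp)
  finally show ?thesis .
qed

lemma sPSh_map_from_lan_eqI:
  assumes X: "X \<in> Obj (sPSh C)"
    and s: "s \<in> Hom (sPSh B) (lan_obj C B F X) Y" and t: "t \<in> Hom (sPSh B) (lan_obj C B F X) Y"
    and eq: "\<And>b c h. b \<in> Obj B \<Longrightarrow> c \<in> Obj C \<Longrightarrow> h \<in> Hom B b (fobj F c) \<Longrightarrow>
      Comp sSet (component s b) (leg X b (c, h)) =
      Comp sSet (component t b) (leg X b (c, h))"
  shows "s = t"
proof (rule sPSh_map_eqI [OF s t])
  fix b assume b: "b \<in> Obj B"
  have "component s b \<in> Hom sSet (val X b) (fobj Y b)"
    "component t b \<in> Hom sSet (val X b) (fobj Y b)"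
    using sPSh_HomD(5) [OF s b] sPSh_HomD(5) [OF t b] b by simp_all
  then show "component s b = component t b"
    by (rule lan_val_map_eqI [OF X b _ _ eq [OF b]])
qed

lemma cat_functor_lan: "cat_functor (sPSh C) (sPSh B) (lan C B F)"
proof
  fix X :: "('c, 'k, 'u) spsh" assume X: "X \<in> Obj (sPSh C)"
  show "fobj (lan C B F) X \<in> Obj (sPSh B)" using lan_obj_in_Obj [OF X] by simp
  note I = PC.Ide_in [OF X]
  have "farr (lan C B F) (Ide (sPSh C) X) = Ide (sPSh B) (lan_obj C B F X)"
  proof (rule sPSh_map_from_lan_eqI [OF X lan_farr_in_Hom [OF I] PB.Ide_in [OF lan_obj_in_Obj [OF X]]])
    fix b c h assume b: "b \<in> Obj B" and ch: "c \<in> Obj C" "h \<in> Hom B b (fobj F c)"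
    note l = lan_cocone(2) [OF X b ch]
    show "Comp sSet (component (farr (lan C B F) (Ide (sPSh C) X)) b) (leg X b (c, h)) =
        Comp sSet (component (Ide (sPSh B) (lan_obj C B F X)) b) (leg X b (c, h))"
      using lan_farr_component(2) [OF I b ch] sSet.Comp_Ide [OF l] sSet.Ide_Comp [OF l] b ch(1) by simp
  qed
  then show "farr (lan C B F) (Ide (sPSh C) X) = Ide (sPSh B) (fobj (lan C B F) X)" by simp
next
  fix s t :: "('c, 'k, 'u) spsh_map" and X Y Z
  assume s: "s \<in> Hom (sPSh C) X Y"
  then show "farr (lan C B F) s \<in> Hom (sPSh B) (fobj (lan C B F) X) (fobj (lan C B F) Y)"
    using lan_farr_in_Hom by simp
  assume t: "t \<in> Hom (sPSh C) Y Z"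
  note s' = sPSh_HomD [OF s] and t' = sPSh_HomD [OF t]
  show "farr (lan C B F) (Comp (sPSh C) t s) =
      Comp (sPSh B) (farr (lan C B F) t) (farr (lan C B F) s)"
  proof (rule sPSh_map_from_lan_eqI [OF s'(1) lan_farr_in_Hom [OF PC.Comp_in [OF s t]]
        PB.Comp_in [OF lan_farr_in_Hom [OF s] lan_farr_in_Hom [OF t]]])
    fix b c h assume b: "b \<in> Obj B" and ch: "c \<in> Obj C" "h \<in> Hom B b (fobj F c)"
    note l = lan_cocone(2) [OF s'(1) b ch] and l' = lan_cocone(2) [OF s'(2) b ch]
      and l'' = lan_cocone(2) [OF t'(2) b ch]
    note Ls = lan_farr_component [OF s b] and Lt = lan_farr_component [OF t b]
    show "Comp sSet (component (farr (lan C B F) (Comp (sPSh C) t s)) b) (leg X b (c, h)) =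
        Comp sSet (component (Comp (sPSh B) (farr (lan C B F) t) (farr (lan C B F) s)) b) (leg X b (c, h))"
      using lan_farr_component(2) [OF PC.Comp_in [OF s t] b ch] b ch(1)
        sSet.Comp_assoc [OF l Ls(1) Lt(1)] Ls(2) [OF ch] Lt(2) [OF ch]
        sSet.Comp_assoc [OF s'(5) [OF ch(1)] l' Lt(1)]
        sSet.Comp_assoc [OF s'(5) [OF ch(1)] t'(5) [OF ch(1)] l''] by simp
  qed
qed

lemma component_lan_unit [simp]:
  "c \<in> Obj C \<Longrightarrow> component (lan_unit C B F X) c = leg X (fobj F c) (c, Ide B (fobj F c))"
  by (simp add: lan_unit_def)

lemma lan_unit_in_Hom:
  assumes X: "X \<in> Obj (sPSh C)"
  shows "lan_unit C B F X \<in> Hom (sPSh C) X (fobj (restr C B F) (lan_obj C B F X))"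
  unfolding lan_unit_def
proof (rule sPSh_mapI [OF C.category_axioms X restr_fobj_in_Obj [OF axms(1,3) lan_obj_in_Obj [OF X]]])
  fix c assume c: "c \<in> Obj C"
  note Fc = F.fobj_in [OF c]
  show "leg X (fobj F c) (c, Ide B (fobj F c)) \<in>
      Hom sSet (fobj X c) (fobj (fobj (restr C B F) (lan_obj C B F X)) c)"
    using lan_cocone(2) [OF X Fc c B.Ide_in [OF Fc]] c Fc by simp
next
  fix k c c' assume k: "k \<in> Hom C c c'"
  note c = C.Hom_Obj [OF k] and Fk = F.farr_in [OF k]
  note Fc = F.fobj_in [OF c(1)] and Fc' = F.fobj_in [OF c(2)]
  show "Comp sSet (farr (fobj (restr C B F) (lan_obj C B F X)) k)
          (leg X (fobj F c') (c', Ide B (fobj F c'))) =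
        Comp sSet (leg X (fobj F c) (c, Ide B (fobj F c))) (farr X k)"
    using lan_obj_farr(2) [OF X Fk c(2) B.Ide_in [OF Fc']] lan_cocone(3) [OF X Fc B.Ide_in [OF Fc] k]
      HomD(1) [OF k] B.Ide_Comp [OF Fk] B.Comp_Ide [OF Fk] by simp
qed

lemma nat_trans_lan_unit:
  "nat_trans (sPSh C) (sPSh C) (ftor_id (sPSh C))
     (ftor_comp (sPSh C) (restr C B F) (lan C B F)) (lan_unit C B F)"
proof (rule nat_transI [OF PC.category_axioms])
  fix X :: "('c, 'k, 'u) spsh" assume "X \<in> Obj (sPSh C)"
  then show "lan_unit C B F X \<in> Hom (sPSh C) (fobj (ftor_id (sPSh C)) X)
      (fobj (ftor_comp (sPSh C) (restr C B F) (lan C B F)) X)"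
    using lan_unit_in_Hom by simp
next
  fix t :: "('c, 'k, 'u) spsh_map" and X Y assume t: "t \<in> Hom (sPSh C) X Y"
  note t' = sPSh_HomD [OF t]
  note R = cat_functor.farr_in [OF cat_functor_restr [OF axms]]
  have "Comp (sPSh C) (farr (restr C B F) (farr (lan C B F) t)) (lan_unit C B F X) =
      Comp (sPSh C) (lan_unit C B F Y) t"
  proof (rule sPSh_map_eqI [OF PC.Comp_in [OF lan_unit_in_Hom [OF t'(1)] R [OF lan_farr_in_Hom [OF t]]]
        PC.Comp_in [OF t lan_unit_in_Hom [OF t'(2)]]])
    fix c assume c: "c \<in> Obj C"
    show "component (Comp (sPSh C) (farr (restr C B F) (farr (lan C B F) t)) (lan_unit C B F X)) c =
        component (Comp (sPSh C) (lan_unit C B F Y) t) c"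
      using lan_farr_component(2) [OF t F.fobj_in [OF c] c B.Ide_in [OF F.fobj_in [OF c]]] c by simp
  qed
  then show "Comp (sPSh C) (farr (ftor_comp (sPSh C) (restr C B F) (lan C B F)) t) (lan_unit C B F X) =
      Comp (sPSh C) (lan_unit C B F Y) (farr (ftor_id (sPSh C)) t)"
    using HomD(1) [OF t] by simp
qed

text \<open>The leg at $(c, h)$ is the leg at $(c, \mathrm{id})$ followed by restriction along $h$, so a
natural map out of $F_*X$ is known on every leg once its adjunct is known.  This gives
injectivity of transposition, and the right-hand side is the formula for the inverse.\<close>

lemma lan_component_via_unit:
  assumes X: "X \<in> Obj (sPSh C)" and f: "f \<in> Hom (sPSh B) (lan_obj C B F X) Y"
    and b: "b \<in> Obj B" and c: "c \<in> Obj C" and h: "h \<in> Hom B b (fobj F c)"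
  shows "Comp sSet (component f b) (leg X b (c, h)) =
    Comp sSet (farr Y h) (component (mate X f) c)"
proof -
  note f' = sPSh_HomD [OF f]
  note Fc = F.fobj_in [OF c] and Lh = lan_obj_farr [OF X h]
  note l = lan_cocone(2) [OF X Fc c B.Ide_in [OF Fc]]
  have fF: "component f (fobj F c) \<in> Hom sSet (val X (fobj F c)) (fobj Y (fobj F c))"
    and fb: "component f b \<in> Hom sSet (val X b) (fobj Y b)"
    using f'(5) [OF Fc] f'(5) [OF b] Fc b by simp_all
  have "Comp sSet (component f b) (leg X b (c, h)) =
      Comp sSet (component f b) (Comp sSet (farr (lan_obj C B F X) h) (leg X (fobj F c) (c, Ide B (fobj F c))))"
    using Lh(2) [OF c B.Ide_in [OF Fc]] B.Ide_Comp [OF h] by simp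
  also have "\<dots> = Comp sSet (farr Y h) (Comp sSet (component f (fobj F c)) (leg X (fobj F c) (c, Ide B (fobj F c))))"
    using sSet.Comp_assoc [OF l Lh(1) fb] sSet.Comp_assoc [OF l fF sPSh_arr_in [OF f'(2) h]] f'(6) [OF h] by simp
  finally show ?thesis using c by (simp add: adjunct_def)
qed

lemma adjunction_lan_restr:
  "adjunction (sPSh C) (sPSh B) (lan C B F) (restr C B F) (lan_unit C B F)"
  unfolding adjunction_def
proof (intro conjI ballI)
  show "cat_functor (sPSh C) (sPSh B) (lan C B F)" by (rule cat_functor_lan)
  show "cat_functor (sPSh B) (sPSh C) (restr C B F)" by (rule cat_functor_restr [OF axms])
  show "nat_trans (sPSh C) (sPSh C) (ftor_id (sPSh C))
     (ftor_comp (sPSh C) (restr C B F) (lan C B F)) (lan_unit C B F)" by (rule nat_trans_lan_unit)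
  fix X :: "('c, 'k, 'u) spsh" and Y :: "('b, 'l, 'u) spsh"
  assume X: "X \<in> Obj (sPSh C)" and Y: "Y \<in> Obj (sPSh B)"
  let ?adj = "mate X"
  note R = cat_functor.farr_in [OF cat_functor_restr [OF axms]]
  have in_Hom: "?adj f \<in> Hom (sPSh C) X (fobj (restr C B F) Y)" if "f \<in> Hom (sPSh B) (lan_obj C B F X) Y" for f
    unfolding adjunct_def by (rule PC.Comp_in [OF lan_unit_in_Hom [OF X] R [OF that]])
  have inj: "f = g" if f: "f \<in> Hom (sPSh B) (lan_obj C B F X) Y" and g: "g \<in> Hom (sPSh B) (lan_obj C B F X) Y"
    and "?adj f = ?adj g" for f g
    using lan_component_via_unit [OF X f] lan_component_via_unit [OF X g] that(3)
    by (intro sPSh_map_from_lan_eqI [OF X f g]) simp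
  have surj: "\<exists>f\<in>Hom (sPSh B) (lan_obj C B F X) Y. ?adj f = \<phi>"
    if \<phi>: "\<phi> \<in> Hom (sPSh C) X (fobj (restr C B F) Y)" for \<phi>
  proof -
    note \<phi>' = sPSh_HomD [OF \<phi>]
    have \<phi>c: "component \<phi> c \<in> Hom sSet (fobj X c) (fobj Y (fobj F c))" if "c \<in> Obj C" for c
      using \<phi>'(5) [OF that] that by simp
    let ?P = "\<lambda>b u. u \<in> Hom sSet (val X b) (fobj Y b) \<and>
        (\<forall>(c, h) \<in> Obj (comma C B F b).
          Comp sSet u (leg X b (c, h)) = Comp sSet (farr Y h) (component \<phi> c))"
    have ex1: "\<exists>!u. ?P b u" if b: "b \<in> Obj B" for b
    proof (rule lan_desc [OF X b sPSh_obj_in [OF Y b]])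
      show "Comp sSet (farr Y h) (component \<phi> c) \<in> Hom sSet (fobj X c) (fobj Y b)"
        if "c \<in> Obj C" "h \<in> Hom B b (fobj F c)" for c h
        by (rule sSet.Comp_in [OF \<phi>c [OF that(1)] sPSh_arr_in [OF Y that(2)]])
      fix c h c' k assume h: "h \<in> Hom B b (fobj F c)" and k: "k \<in> Hom C c c'"
      note c = C.Hom_Obj [OF k] and Yh = sPSh_arr_in [OF Y h] and Fk = F.farr_in [OF k]
      have "Comp sSet (component \<phi> c) (farr X k) = Comp sSet (farr Y (farr F k)) (component \<phi> c')"
        using \<phi>'(6) [OF k] HomD(1) [OF k] by simp
      then show "Comp sSet (Comp sSet (farr Y h) (component \<phi> c)) (farr X k) =
          Comp sSet (farr Y (Comp B (farr F k) h)) (component \<phi> c')"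
        using sSet.Comp_assoc [OF sPSh_arr_in [OF X k] \<phi>c [OF c(1)] Yh]
          sSet.Comp_assoc [OF \<phi>c [OF c(2)] sPSh_arr_in [OF Y Fk] Yh] sPSh_Comp [OF Y h Fk] by simp
    qed
    define u where "u b = (THE u. ?P b u)" for b
    have P: "?P b (u b)" if "b \<in> Obj B" for b
      unfolding u_def by (rule theI' [OF ex1 [OF that]])
    have u: "u b \<in> Hom sSet (val X b) (fobj Y b)" if "b \<in> Obj B" for b
      using P [OF that] by simp
    have ul: "Comp sSet (u b) (leg X b (c, h)) = Comp sSet (farr Y h) (component \<phi> c)"
      if "b \<in> Obj B" "c \<in> Obj C" "h \<in> Hom B b (fobj F c)" for b c h
    proof -
      have "(c, h) \<in> Obj (comma C B F b)" using that by (simp add: Obj_comma)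
      from bspec [OF conjunct2 [OF P [OF that(1)]] this] show ?thesis by simp
    qed
    let ?f = "(lan_obj C B F X, restrict u (Obj B), Y)"
    have f: "?f \<in> Hom (sPSh B) (lan_obj C B F X) Y"
    proof (rule sPSh_map_from_lanI [OF X Y u])
      fix g b b' c h assume g: "g \<in> Hom B b' b" and c: "c \<in> Obj C" and h: "h \<in> Hom B b (fobj F c)"
      note b = B.Hom_Obj [OF g]
      show "Comp sSet (farr Y g) (Comp sSet (u b) (leg X b (c, h))) =
          Comp sSet (u b') (leg X b' (c, Comp B h g))"
        using ul [OF b(2) c h] ul [OF b(1) c B.Comp_in [OF g h]] sPSh_Comp [OF Y g h]
          sSet.Comp_assoc [OF \<phi>c [OF c] sPSh_arr_in [OF Y h] sPSh_arr_in [OF Y g]] by simp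
    qed
    have "?adj ?f = \<phi>"
    proof (rule sPSh_map_eqI [OF in_Hom [OF f] \<phi>])
      fix c assume c: "c \<in> Obj C"
      note Fc = F.fobj_in [OF c]
      show "component (?adj ?f) c = component \<phi> c"
        using ul [OF Fc c B.Ide_in [OF Fc]] sPSh_Ide [OF Y Fc] sSet.Ide_Comp [OF \<phi>c [OF c]] c Fc
        by (simp add: adjunct_def)
    qed
    then show ?thesis using f by blast
  qed
  show "bij_betw ?adj (Hom (sPSh B) (fobj (lan C B F) X) Y) (Hom (sPSh C) X (fobj (restr C B F) Y))"
  proof (rule bij_betwI')
    fix f g assume "f \<in> Hom (sPSh B) (fobj (lan C B F) X) Y" "g \<in> Hom (sPSh B) (fobj (lan C B F) X) Y"
    then show "?adj f = ?adj g \<longleftrightarrow> f = g" using inj [of f g] by auto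
  next
    fix f assume "f \<in> Hom (sPSh B) (fobj (lan C B F) X) Y"
    then show "?adj f \<in> Hom (sPSh C) X (fobj (restr C B F) Y)" using in_Hom by simp
  next
    fix \<phi> assume "\<phi> \<in> Hom (sPSh C) X (fobj (restr C B F) Y)"
    then show "\<exists>f\<in>Hom (sPSh B) (fobj (lan C B F) X) Y. \<phi> = ?adj f" using surj [of \<phi>] by auto
  qed
qed

end

section \<open>Realization and weak equivalences\<close>

text \<open>The property of the realized map that \<open>weak_equivalence\<close> asks for.  Realization is functorial
only on points of the realized spaces, so invariance under changing a map off the space is
needed along with closure under composition.\<close>

definition homotopy_equivalence_map :: "'a topology \<Rightarrow> 'b topology \<Rightarrow> ('a \<Rightarrow> 'b) \<Rightarrow> bool" where
  "homotopy_equivalence_map X Y r \<longleftrightarrow> continuous_map X Y r \<and>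
     (\<exists>g. continuous_map Y X g \<and> homotopic_with (\<lambda>_. True) X X (g \<circ> r) id \<and>
          homotopic_with (\<lambda>_. True) Y Y (r \<circ> g) id)"

lemma weak_equivalence_iff:
  "f \<in> Hom sSet X Y \<Longrightarrow> weak_equivalence f \<longleftrightarrow>
     homotopy_equivalence_map (realization X) (realization Y) (realization_map f)"
  using Hom_sSetD(3,4) [of f X Y] HomD(1) [of f sSet X Y]
  by (simp add: weak_equivalence_def homotopy_equivalence_map_def Let_def)

lemma homotopy_equivalence_map_comp:
  assumes "homotopy_equivalence_map X Y r" "homotopy_equivalence_map Y Z s"
  shows "homotopy_equivalence_map X Z (s \<circ> r)"
proof -
  obtain g where r: "continuous_map X Y r" and g: "continuous_map Y X g"
    "homotopic_with (\<lambda>_. True) X X (g \<circ> r) id" "homotopic_with (\<lambda>_. True) Y Y (r \<circ> g) id"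
    using assms(1) by (auto simp: homotopy_equivalence_map_def)
  obtain h where s: "continuous_map Y Z s" and h: "continuous_map Z Y h"
    "homotopic_with (\<lambda>_. True) Y Y (h \<circ> s) id" "homotopic_with (\<lambda>_. True) Z Z (s \<circ> h) id"
    using assms(2) by (auto simp: homotopy_equivalence_map_def)
  have "homotopic_with (\<lambda>_. True) X X (g \<circ> ((h \<circ> s) \<circ> r)) (g \<circ> (id \<circ> r))"
    by (rule homotopic_with_compose_continuous_map_left
        [OF homotopic_with_compose_continuous_map_right [OF h(2) r] g(1)]) auto
  then have 1: "homotopic_with (\<lambda>_. True) X X ((g \<circ> h) \<circ> (s \<circ> r)) id"
    using homotopic_with_trans [OF _ g(2)] by (simp add: o_assoc)
  have "homotopic_with (\<lambda>_. True) Z Z (s \<circ> ((r \<circ> g) \<circ> h)) (s \<circ> (id \<circ> h))"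
    by (rule homotopic_with_compose_continuous_map_left
        [OF homotopic_with_compose_continuous_map_right [OF g(3) h(1)] s]) auto
  then have 2: "homotopic_with (\<lambda>_. True) Z Z ((s \<circ> r) \<circ> (g \<circ> h)) id"
    using homotopic_with_trans [OF _ h(3)] by (simp add: o_assoc)
  show ?thesis
    unfolding homotopy_equivalence_map_def
    using 1 2 continuous_map_compose [OF r s] continuous_map_compose [OF h(1) g(1)] by blast
qed

lemma homotopy_equivalence_map_cong:
  assumes "homotopy_equivalence_map X Y r" and eq: "\<And>x. x \<in> topspace X \<Longrightarrow> r x = r' x"
  shows "homotopy_equivalence_map X Y r'"
proof -
  obtain g where r: "continuous_map X Y r" and g: "continuous_map Y X g"
    "homotopic_with (\<lambda>_. True) X X (g \<circ> r) id" "homotopic_with (\<lambda>_. True) Y Y (r \<circ> g) id"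
    using assms(1) by (auto simp: homotopy_equivalence_map_def)
  have r': "continuous_map X Y r'" using continuous_map_eq [OF r] eq by blast
  have "homotopic_with (\<lambda>_. True) X X (g \<circ> r') (g \<circ> r)"
    by (rule homotopic_with_equal) (use eq continuous_map_compose [OF r' g(1)] in auto)
  moreover have "homotopic_with (\<lambda>_. True) Y Y (r' \<circ> g) (r \<circ> g)"
    by (rule homotopic_with_equal)
      (use eq continuous_map_compose [OF g(1) r'] continuous_map_image_subset_topspace [OF g(1)] in auto)
  ultimately show ?thesis
    unfolding homotopy_equivalence_map_def
    using r' g(1) homotopic_with_trans [OF _ g(2)] homotopic_with_trans [OF _ g(3)] by blast
qed

text \<open>A homotopy moves each point along a path, and a path in a discrete space is constant.\<close>

lemma homotopic_maps_agree_in_discrete: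
  assumes "homotopic_with (\<lambda>_. True) X Y p q" and k: "continuous_map Y (discrete_topology UNIV) k"
    and x: "x \<in> topspace X"
  shows "k (p x) = k (q x)"
proof -
  obtain h where h: "continuous_map (prod_topology (top_of_set {0..1::real}) X) Y h"
    and h01: "\<And>x. h (0, x) = p x" "\<And>x. h (1, x) = q x"
    using assms(1) by (auto simp: homotopic_with_def)
  have "continuous_map (top_of_set {0..1::real}) (discrete_topology UNIV) (k \<circ> h \<circ> (\<lambda>t. (t, x)))"
    by (intro continuous_map_compose [OF _ continuous_map_compose [OF h k]])
      (simp add: continuous_map_pairwise o_def x)
  moreover have "connectedin (top_of_set {0..1::real}) {0..1}"
    by (simp add: connectedin_subtopology)
  ultimately have "connectedin (discrete_topology UNIV) ((k \<circ> h \<circ> (\<lambda>t. (t, x))) ` {0..1})"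
    by (rule connectedin_continuous_map_image)
  then obtain a where "(k \<circ> h \<circ> (\<lambda>t. (t, x))) ` {0..1} \<subseteq> {a}"
    by (auto simp: connectedin_discrete_topology)
  then have "(k \<circ> h \<circ> (\<lambda>t. (t, x))) 0 = a" "(k \<circ> h \<circ> (\<lambda>t. (t, x))) 1 = a"
    by (simp_all add: image_subset_iff)
  then show ?thesis using h01 by simp
qed

lemma topspace_cells: "topspace (cells X) = {((n, x), t) | n x t. x \<in> fobj X n \<and> t \<in> standard_simplex n}"
  by (auto simp: cells_def topspace_standard_simplex)

lemma openin_cells:
  "openin (cells X) U \<longleftrightarrow> U \<subseteq> topspace (cells X) \<and>
     (\<forall>n. \<forall>x\<in>fobj X n.
        openin (subtopology (powertop_real UNIV) (standard_simplex n)) {t. ((n, x), t) \<in> U})"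
  unfolding topspace_cells
  by (auto simp: cells_def openin_sum_topology topspace_standard_simplex)

lemma openin_realization:
  "openin (realization X) U \<longleftrightarrow> U \<subseteq> topspace (cells X) // glue X \<and>
     openin (cells X) {c \<in> topspace (cells X). glue X `` {c} \<in> U}"
  unfolding realization_def using istopology_realization [of X] by simp

lemma topspace_realization: "topspace (realization X) = topspace (cells X) // glue X"
proof
  show "topspace (realization X) \<subseteq> topspace (cells X) // glue X"
    using openin_topspace [of "realization X"] openin_realization by blast
  have "{c \<in> topspace (cells X). glue X `` {c} \<in> topspace (cells X) // glue X} = topspace (cells X)"
    by (auto simp: quotient_def)
  then have "openin (realization X) (topspace (cells X) // glue X)"
    by (simp add: openin_realization)
  then show "topspace (cells X) // glue X \<subseteq> topspace (realization X)"
    by (rule openin_subset)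
qed

lemma topspace_realizationE:
  assumes "K \<in> topspace (realization X)"
  obtains n x t where "K = glue X `` {((n, x), t)}" "x \<in> fobj X n" "t \<in> standard_simplex n"
  using assms by (auto simp: topspace_realization quotient_def topspace_cells)

lemma glue_refl: "(c, c) \<in> glue X"
  by (simp add: glue_def Let_def)

text \<open>\<open>glue\<close> is the equivalence relation generated by the pairs in the assumption, so a function that
does not separate these pairs descends to the realization.\<close>

lemma glue_invariant [consumes 1, case_names generator]:
  assumes "(c, d) \<in> glue X"
    and "\<And>m n \<theta> x t. (m, \<theta>, n) \<in> Hom DELTA m n \<Longrightarrow> x \<in> fobj X n \<Longrightarrow> t \<in> standard_simplex m \<Longrightarrow>
      P ((m, act X (m, \<theta>, n) x), t) = P ((n, x), simplex_push (m, \<theta>, n) t)"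
  shows "P c = P d"
proof -
  let ?R = "{(((m, act X (m, \<theta>, n) x), t), ((n, x), simplex_push (m, \<theta>, n) t)) | m \<theta> n x t.
                 (m, \<theta>, n) \<in> Arr DELTA \<and> x \<in> fobj X n \<and> t \<in> standard_simplex m}"
  have R: "P c = P d" if "(c, d) \<in> ?R" for c d
    using that assms(2) by (auto simp: Arr_DELTA Hom_DELTA)
  have "(c, d) \<in> (?R \<union> ?R\<inverse>)\<^sup>*" using assms(1) by (simp add: glue_def Let_def)
  then show ?thesis
  proof (induction rule: rtrancl_induct)
    case (step y z)
    from step(2) have "P y = P z"
    proof
      assume "(y, z) \<in> ?R\<inverse>"
      then show ?thesis using R [of z y] by (simp only: converse_iff)
    qed (rule R)
    then show ?case using step(3) by simp
  qed simp
qed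

lemma glue_generator:
  assumes "(m, \<theta>, n) \<in> Hom DELTA m n" "x \<in> fobj X n" "t \<in> standard_simplex m"
  shows "(((m, act X (m, \<theta>, n) x), t), ((n, x), simplex_push (m, \<theta>, n) t)) \<in> glue X"
  unfolding glue_def Let_def using assms by (intro r_into_rtrancl UnI1) (auto simp: Arr_DELTA Hom_DELTA)

lemma equiv_glue: "equiv UNIV (glue X)"
proof (rule equivI)
  show "sym (glue X)"
    unfolding glue_def Let_def by (rule sym_rtrancl) (auto simp: sym_def)
  show "trans (glue X)"
    unfolding glue_def Let_def by (rule trans_rtrancl)
qed (auto simp: refl_on_def glue_refl)

lemma glue_class_eq: "glue X `` {c} = glue X `` {d} \<longleftrightarrow> (c, d) \<in> glue X"
  using eq_equiv_class_iff [OF equiv_glue, of c d X] by simp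

definition cell_map :: "'u sset_map \<Rightarrow> 'u cell_point \<Rightarrow> 'u cell_point" where
  "cell_map f = (\<lambda>((n, x), t). ((n, level f n x), t))"

lemma cell_map_glue:
  assumes f: "f \<in> Hom sSet X Y" and "(c, d) \<in> glue X"
  shows "(cell_map f c, cell_map f d) \<in> glue Y"
proof -
  have "glue Y `` {cell_map f c} = glue Y `` {cell_map f d}"
    using assms(2)
  proof (induction rule: glue_invariant)
    case (generator m n \<theta> x t)
    have "level f m (act X (m, \<theta>, n) x) = act Y (m, \<theta>, n) (level f n x)"
      using Hom_sSetD(7) [OF f generator(1,2)] by simp
    then show ?case
      using glue_generator [OF generator(1) level_in [OF f generator(2)] generator(3)]
      by (simp add: cell_map_def glue_class_eq)
  qed
  then show ?thesis by (simp add: glue_class_eq)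
qed

lemma realization_map_class:
  assumes f: "f \<in> Hom sSet X Y"
  shows "realization_map f (glue X `` {c}) = glue Y `` {cell_map f c}"
proof -
  have "realization_map f (glue X `` {c}) = glue Y `` (cell_map f ` (glue X `` {c}))"
    using Hom_sSetD(4) [OF f] by (simp add: realization_map_def cell_map_def)
  also have "\<dots> = glue Y `` {cell_map f c}"
  proof
    show "glue Y `` (cell_map f ` (glue X `` {c})) \<subseteq> glue Y `` {cell_map f c}"
    proof
      fix z assume "z \<in> glue Y `` (cell_map f ` (glue X `` {c}))"
      then obtain d where d: "(c, d) \<in> glue X" "(cell_map f d, z) \<in> glue Y" by blast
      have "trans (glue Y)" using equiv_glue [of Y] by (rule equivE)
      from transD [OF this cell_map_glue [OF f d(1)] d(2)] show "z \<in> glue Y `` {cell_map f c}" by blast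
    qed
    show "glue Y `` {cell_map f c} \<subseteq> glue Y `` (cell_map f ` (glue X `` {c}))"
      using glue_refl [of c X] by auto
  qed
  finally show ?thesis .
qed

lemma continuous_realization_map:
  assumes f: "f \<in> Hom sSet X Y"
  shows "continuous_map (realization X) (realization Y) (realization_map f)"
proof -
  have cell: "cell_map f c \<in> topspace (cells Y)" if "c \<in> topspace (cells X)" for c
    using that level_in [OF f] by (auto simp: topspace_cells cell_map_def)
  have "openin (realization X) {K \<in> topspace (realization X). realization_map f K \<in> U}"
    if U: "openin (realization Y) U" for U
  proof -
    let ?V = "{c \<in> topspace (cells Y). glue Y `` {c} \<in> U}"
    have V: "openin (cells Y) ?V" using U by (simp add: openin_realization)
    have "{c \<in> topspace (cells X). glue X `` {c} \<in> {K \<in> topspace (realization X). realization_map f K \<in> U}} =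
        {c \<in> topspace (cells X). cell_map f c \<in> ?V}"
      using cell by (auto simp: topspace_realization realization_map_class [OF f] quotientI)
    moreover have "openin (cells X) {c \<in> topspace (cells X). cell_map f c \<in> ?V}"
      unfolding openin_cells
    proof (intro conjI allI ballI)
      fix n x assume x: "x \<in> fobj X n"
      have "{t. ((n, x), t) \<in> {c \<in> topspace (cells X). cell_map f c \<in> ?V}} = {t. ((n, level f n x), t) \<in> ?V}"
        using x by (auto simp: cell_map_def topspace_cells)
      then show "openin (subtopology (powertop_real UNIV) (standard_simplex n))
          {t. ((n, x), t) \<in> {c \<in> topspace (cells X). cell_map f c \<in> ?V}}"
        using V level_in [OF f x] unfolding openin_cells [of Y] by simp
    qed auto
    ultimately show ?thesis
      by (auto simp: openin_realization topspace_realization)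
  qed
  moreover have "realization_map f K \<in> topspace (realization Y)" if "K \<in> topspace (realization X)" for K
    using that cell by (auto simp: topspace_realization quotient_def realization_map_class [OF f])
  ultimately show ?thesis by (auto simp: continuous_map_def)
qed

lemma realization_map_Comp:
  assumes f: "f \<in> Hom sSet X Y" and g: "g \<in> Hom sSet Y Z" and K: "K \<in> topspace (realization X)"
  shows "realization_map (Comp sSet g f) K = realization_map g (realization_map f K)"
proof -
  interpret category sSet by (rule category_sSet)
  obtain n x t where K: "K = glue X `` {((n, x), t)}" "x \<in> fobj X n"
    using topspace_realizationE [OF K] by metis
  then show ?thesis
    by (simp add: realization_map_class [OF f] realization_map_class [OF g]
        realization_map_class [OF Comp_in [OF f g]] cell_map_def level_Comp [OF f g])
qed

lemma realization_map_Ide: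
  assumes X: "X \<in> Obj sSet" and K: "K \<in> topspace (realization X)"
  shows "realization_map (Ide sSet X) K = K"
proof -
  interpret category sSet by (rule category_sSet)
  obtain n x t where "K = glue X `` {((n, x), t)}" "x \<in> fobj X n"
    using topspace_realizationE [OF K] by metis
  then show ?thesis
    by (simp add: realization_map_class [OF Ide_in [OF X]] cell_map_def level_Ide)
qed

lemma weak_equivalence_Comp:
  assumes f: "f \<in> Hom sSet X Y" and g: "g \<in> Hom sSet Y Z"
    and "weak_equivalence f" "weak_equivalence g"
  shows "weak_equivalence (Comp sSet g f)"
proof -
  interpret category sSet by (rule category_sSet)
  have "homotopy_equivalence_map (realization X) (realization Z) (realization_map g \<circ> realization_map f)"
    using assms(3,4) by (intro homotopy_equivalence_map_comp [of _ "realization Y"])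
      (simp_all add: weak_equivalence_iff [OF f] weak_equivalence_iff [OF g])
  then show ?thesis
    unfolding weak_equivalence_iff [OF Comp_in [OF f g]]
    by (rule homotopy_equivalence_map_cong) (simp add: realization_map_Comp [OF f g])
qed

lemma is_iso_weak_equivalence:
  assumes f: "f \<in> Hom sSet X Y" and "is_iso sSet f"
  shows "weak_equivalence f"
proof -
  interpret category sSet by (rule category_sSet)
  obtain g where g: "g \<in> Hom sSet Y X" "Comp sSet g f = Ide sSet X" "Comp sSet f g = Ide sSet Y"
    using is_isoE [OF assms(2,1)] by metis
  note rf = continuous_realization_map [OF f] and rg = continuous_realization_map [OF g(1)]
  have gf: "realization_map g (realization_map f K) = K" if "K \<in> topspace (realization X)" for K
    using realization_map_Comp [OF f g(1) that] g(2) realization_map_Ide [OF Hom_sSetD(1) [OF f] that]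
    by simp
  have fg: "realization_map f (realization_map g K) = K" if "K \<in> topspace (realization Y)" for K
    using realization_map_Comp [OF g(1) f that] g(3) realization_map_Ide [OF Hom_sSetD(2) [OF f] that]
    by simp
  have "homotopic_with (\<lambda>_. True) (realization X) (realization X) (realization_map g \<circ> realization_map f) id"
    using continuous_map_compose [OF rf rg] by (intro homotopic_with_equal) (simp_all add: gf)
  moreover have "homotopic_with (\<lambda>_. True) (realization Y) (realization Y) (realization_map f \<circ> realization_map g) id"
    using continuous_map_compose [OF rg rf] by (intro homotopic_with_equal) (simp_all add: fg)
  ultimately show ?thesis
    using rf rg by (auto simp: weak_equivalence_iff [OF f] homotopy_equivalence_map_def)
qed

lemma weak_equivalence_cancel_iso:
  assumes f: "f \<in> Hom sSet X Y" and g: "g \<in> Hom sSet Y Z"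
  shows "is_iso sSet f \<Longrightarrow> weak_equivalence (Comp sSet g f) \<longleftrightarrow> weak_equivalence g"
    and "is_iso sSet g \<Longrightarrow> weak_equivalence (Comp sSet g f) \<longleftrightarrow> weak_equivalence f"
proof -
  interpret category sSet by (rule category_sSet)
  show "weak_equivalence (Comp sSet g f) \<longleftrightarrow> weak_equivalence g" if iso: "is_iso sSet f"
  proof
    obtain f' where f': "f' \<in> Hom sSet Y X" "Comp sSet f f' = Ide sSet Y" "is_iso sSet f'"
      using is_isoE [OF iso f] by metis
    assume "weak_equivalence (Comp sSet g f)"
    then have "weak_equivalence (Comp sSet (Comp sSet g f) f')"
      by (intro weak_equivalence_Comp [OF f'(1) Comp_in [OF f g] is_iso_weak_equivalence [OF f'(1,3)]])
    then show "weak_equivalence g"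
      using Comp_inverse_cancel(2) [OF f'(1) f f'(2) g] by simp
  qed (rule weak_equivalence_Comp [OF f g is_iso_weak_equivalence [OF f iso]])
  show "weak_equivalence (Comp sSet g f) \<longleftrightarrow> weak_equivalence f" if iso: "is_iso sSet g"
  proof
    obtain g' where g': "g' \<in> Hom sSet Z Y" "Comp sSet g' g = Ide sSet Y" "is_iso sSet g'"
      using is_isoE [OF iso g] by metis
    assume "weak_equivalence (Comp sSet g f)"
    then have "weak_equivalence (Comp sSet g' (Comp sSet g f))"
      by (rule weak_equivalence_Comp [OF Comp_in [OF f g] g'(1) _ is_iso_weak_equivalence [OF g'(1,3)]])
    then show "weak_equivalence f"
      using Comp_inverse_cancel(1) [OF g g'(1,2) f] by simp
  qed (rule weak_equivalence_Comp [OF f g _ is_iso_weak_equivalence [OF g iso]])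
qed

section \<open>Components\<close>

text \<open>Such a set of vertices is a union of connected components.\<close>

definition edge_closed :: "'u sset \<Rightarrow> 'u set \<Rightarrow> bool" where
  "edge_closed X A \<longleftrightarrow> (\<forall>e\<in>fobj X 1. face X 0 0 e \<in> A \<longleftrightarrow> face X 0 1 e \<in> A)"

definition vertex_incl :: "nat \<Rightarrow> nat \<Rightarrow> delta_arr" where
  "vertex_incl n i = (0, (\<lambda>j\<in>{..0}. i), n)"

lemma vertex_incl_in_Hom: "i \<le> n \<Longrightarrow> vertex_incl n i \<in> Hom DELTA 0 n"
  by (simp add: vertex_incl_def Hom_DELTA monotone_on_def)

lemma Comp_vertex_incl:
  "i \<le> m \<Longrightarrow> Comp DELTA (m, \<theta>, n) (vertex_incl m i) = vertex_incl n (\<theta> i)"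
  by (auto simp: vertex_incl_def compose_def fun_eq_iff)

lemma face_edge: "face X 0 0 = act X (vertex_incl 1 1)" "face X 0 1 = act X (vertex_incl 1 0)"
  by (simp_all add: face_def vertex_incl_def cong: restrict_cong)

text \<open>In any simplex the vertices $0$ and $i$ are joined by an edge.\<close>

lemma edge_closed_vertices:
  assumes X: "X \<in> Obj sSet" and A: "edge_closed X A" and x: "x \<in> fobj X n" and i: "i \<le> n"
  shows "act X (vertex_incl n i) x \<in> A \<longleftrightarrow> act X (vertex_incl n 0) x \<in> A"
proof -
  let ?e = "(1, (\<lambda>j\<in>{..1}. if j = 0 then 0 else i), n)"
  have e: "?e \<in> Hom DELTA 1 n"
    using i by (auto simp: Hom_DELTA monotone_on_def)
  have "act X (vertex_incl 1 1) (act X ?e x) = act X (vertex_incl n i) x"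
    using act_Comp [OF X vertex_incl_in_Hom e x, of 1] Comp_vertex_incl [of 1 1 "fst (snd ?e)" n] by simp
  moreover have "act X (vertex_incl 1 0) (act X ?e x) = act X (vertex_incl n 0) x"
    using act_Comp [OF X vertex_incl_in_Hom e x, of 0] Comp_vertex_incl [of 0 1 "fst (snd ?e)" n] by simp
  ultimately show ?thesis
    using A act_in [OF X e x] unfolding edge_closed_def face_edge by force
qed

text \<open>A union of components, given by its vertices, as a predicate on points of the realization.  A
cell is represented by its vertex $0$; for an edge-closed set any other vertex gives the same answer.\<close>

definition component_indicator :: "'u sset \<Rightarrow> 'u set \<Rightarrow> 'u cell_point set \<Rightarrow> bool" where
  "component_indicator X A K \<longleftrightarrow> (\<exists>n x t. ((n, x), t) \<in> K \<and> act X (vertex_incl n 0) x \<in> A)"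

lemma component_indicator_class:
  assumes X: "X \<in> Obj sSet" and A: "edge_closed X A"
  shows "component_indicator X A (glue X `` {((n, x), t)}) \<longleftrightarrow> act X (vertex_incl n 0) x \<in> A"
proof -
  have "((\<lambda>((n, x), t). act X (vertex_incl n 0) x \<in> A) c) = ((\<lambda>((n, x), t). act X (vertex_incl n 0) x \<in> A) d)"
    if "(c, d) \<in> glue X" for c d
    using that
  proof (induction rule: glue_invariant)
    case (generator m n \<theta> x t)
    have "act X (vertex_incl m 0) (act X (m, \<theta>, n) x) = act X (vertex_incl n (\<theta> 0)) x"
      using act_Comp [OF X vertex_incl_in_Hom [OF le0] generator(1,2)] Comp_vertex_incl [of 0 m \<theta> n]
      by (simp del: DELTA_simps)
    moreover have "act X (vertex_incl n (\<theta> 0)) x \<in> A \<longleftrightarrow> act X (vertex_incl n 0) x \<in> A"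
      using generator(1) by (intro edge_closed_vertices [OF X A generator(2)]) (auto simp: Hom_DELTA)
    ultimately show ?case by simp
  qed
  then show ?thesis
    using glue_refl [of "((n, x), t)" X] unfolding component_indicator_def by fastforce
qed

text \<open>All points of one cell get the same truth value, so preimages in the space of cells are unions
of entire cells.\<close>

lemma continuous_component_indicator:
  assumes X: "X \<in> Obj sSet" and A: "edge_closed X A"
  shows "continuous_map (realization X) (discrete_topology UNIV) (component_indicator X A)"
proof -
  have "openin (realization X) {K \<in> topspace (realization X). component_indicator X A K \<in> U}" for U
  proof -
    let ?V = "{c \<in> topspace (cells X). glue X `` {c} \<in> {K \<in> topspace (realization X). component_indicator X A K \<in> U}}"
    have "openin (subtopology (powertop_real UNIV) (standard_simplex n)) {t. ((n, x), t) \<in> ?V}"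
      if x: "x \<in> fobj X n" for n x
    proof -
      have "((n, x), t) \<in> ?V \<longleftrightarrow> t \<in> standard_simplex n \<and> (act X (vertex_incl n 0) x \<in> A) \<in> U" for t
        using x by (auto simp: topspace_realization topspace_cells component_indicator_class [OF X A] quotientI)
      then have "{t. ((n, x), t) \<in> ?V} =
          (if (act X (vertex_incl n 0) x \<in> A) \<in> U then standard_simplex n else {})"
        by auto
      then show ?thesis
        using openin_topspace [of "subtopology (powertop_real UNIV) (standard_simplex n)"]
        by (simp add: topspace_standard_simplex)
    qed
    then have "openin (cells X) ?V" unfolding openin_cells by blast
    then show ?thesis by (auto simp: openin_realization topspace_realization)
  qed
  then show ?thesis by (simp add: continuous_map_def)
qed

definition vertex_point :: "'u sset \<Rightarrow> 'u \<Rightarrow> 'u cell_point set" where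
  "vertex_point X v = glue X `` {((0, v), (\<lambda>j. if j = 0 then 1 else 0))}"

lemma vertex_point_in: "v \<in> fobj X 0 \<Longrightarrow> vertex_point X v \<in> topspace (realization X)"
  unfolding vertex_point_def topspace_realization
  by (rule quotientI) (simp add: topspace_cells)

lemma component_indicator_vertex_point:
  assumes X: "X \<in> Obj sSet" and A: "edge_closed X A" and v: "v \<in> fobj X 0"
  shows "component_indicator X A (vertex_point X v) \<longleftrightarrow> v \<in> A"
proof -
  have "vertex_incl 0 0 = Ide DELTA 0"
    by (simp add: vertex_incl_def cong: restrict_cong)
  then show ?thesis
    using act_Ide [OF X v] by (simp add: vertex_point_def component_indicator_class [OF X A])
qed

lemma realization_map_vertex_point:
  "f \<in> Hom sSet X Y \<Longrightarrow> realization_map f (vertex_point X v) = vertex_point Y (level f 0 v)"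
  by (simp add: vertex_point_def realization_map_class cell_map_def)

text \<open>Let $g$ be a homotopy inverse of the realization $r$ of $f$.  A vertex $y$ lies in the same component as
$r(g(y))$, and that is a point of the image of $f$.\<close>

lemma weak_equivalence_meets_components:
  assumes f: "f \<in> Hom sSet X Y" and w: "weak_equivalence f" and A: "edge_closed Y A"
    and im: "\<And>x. x \<in> fobj X 0 \<Longrightarrow> level f 0 x \<in> A" and y: "y \<in> fobj Y 0"
  shows "y \<in> A"
proof -
  note X = Hom_sSetD(1) [OF f] and Y = Hom_sSetD(2) [OF f]
  let ?ind = "component_indicator Y A" and ?r = "realization_map f" and ?y = "vertex_point Y y"
  obtain g where g: "continuous_map (realization Y) (realization X) g"
    "homotopic_with (\<lambda>_. True) (realization Y) (realization Y) (?r \<circ> g) id"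
    using w by (auto simp: weak_equivalence_iff [OF f] homotopy_equivalence_map_def)
  have "g ?y \<in> topspace (realization X)"
    using continuous_map_image_subset_topspace [OF g(1)] vertex_point_in [OF y] by blast
  then obtain n x t where x: "g ?y = glue X `` {((n, x), t)}" "x \<in> fobj X n"
    using topspace_realizationE by metis
  have "act Y (vertex_incl n 0) (level f n x) \<in> A"
    using Hom_sSetD(7) [OF f vertex_incl_in_Hom x(2), of 0] im [OF act_in [OF X vertex_incl_in_Hom x(2)]]
    by simp
  then have "?ind (?r (g ?y))"
    unfolding x(1) realization_map_class [OF f] by (simp add: cell_map_def component_indicator_class [OF Y A])
  then have "?ind ?y"
    using homotopic_maps_agree_in_discrete [OF g(2) continuous_component_indicator [OF Y A] vertex_point_in [OF y]]
    by simp
  then show ?thesis using component_indicator_vertex_point [OF Y A y] by simp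
qed

text \<open>A vertex $x$ lies in the same component as $g(r(x))$, which depends only on $f(x)$.\<close>

lemma weak_equivalence_separates_components:
  assumes f: "f \<in> Hom sSet X Y" and w: "weak_equivalence f" and A: "edge_closed X A"
    and x: "x \<in> fobj X 0" "x' \<in> fobj X 0" and eq: "level f 0 x = level f 0 x'"
  shows "x \<in> A \<longleftrightarrow> x' \<in> A"
proof -
  note X = Hom_sSetD(1) [OF f]
  let ?ind = "component_indicator X A" and ?r = "realization_map f"
  obtain g where g: "homotopic_with (\<lambda>_. True) (realization X) (realization X) (g \<circ> ?r) id"
    using w by (auto simp: weak_equivalence_iff [OF f] homotopy_equivalence_map_def)
  have "?ind (g (?r (vertex_point X z))) \<longleftrightarrow> z \<in> A" if z: "z \<in> fobj X 0" for z
    using homotopic_maps_agree_in_discrete [OF g continuous_component_indicator [OF X A] vertex_point_in [OF z]]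
      component_indicator_vertex_point [OF X A z] by simp
  then show ?thesis
    using x eq by (metis realization_map_vertex_point [OF f])
qed

lemma kan_fibration_edge_lift:
  assumes p: "p \<in> Hom sSet E D" and kan: "kan_fibration p" and k: "k \<le> 1"
    and y: "y \<in> fobj D 1" and e: "e \<in> fobj E 0"
    and bd: "\<And>i. i \<le> 1 \<Longrightarrow> i \<noteq> k \<Longrightarrow> face D 0 i y = level p 0 e"
  shows "\<exists>z\<in>fobj E 1. level p 1 z = y"
proof -
  have "\<forall>n\<ge>1. \<forall>k\<le>n. \<forall>x. \<forall>y\<in>fobj D n.
      (\<forall>i\<le>n. i \<noteq> k \<longrightarrow> x i \<in> fobj E (n - 1)) \<longrightarrow>
      (\<forall>i j. i < j \<longrightarrow> j \<le> n \<longrightarrow> i \<noteq> k \<longrightarrow> j \<noteq> k \<longrightarrow>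
        face E (n - 2) i (x j) = face E (n - 2) (j - 1) (x i)) \<longrightarrow>
      (\<forall>i\<le>n. i \<noteq> k \<longrightarrow> face D (n - 1) i y = level p (n - 1) (x i)) \<longrightarrow>
      (\<exists>z\<in>fobj E n. level p n z = y \<and> (\<forall>i\<le>n. i \<noteq> k \<longrightarrow> face E (n - 1) i z = x i))"
    by (rule conjunct2 [OF kan [unfolded kan_fibration_def Let_def Hom_sSetD(3,4) [OF p]]])
  then have "(\<forall>i j. i < j \<longrightarrow> j \<le> 1 \<longrightarrow> i \<noteq> k \<longrightarrow> j \<noteq> k \<longrightarrow>
        face E (1 - 2) i e = face E (1 - 2) (j - 1) e) \<longrightarrow>
      (\<exists>z\<in>fobj E 1. level p 1 z = y \<and> (\<forall>i\<le>1. i \<noteq> k \<longrightarrow> face E (1 - 1) i z = e))"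
    by (elim allE [of _ 1] allE [of _ k] allE [of _ "\<lambda>_. e"] ballE [of _ _ y] impE)
      (use k y e bd in simp_all)
  moreover have "j = k" if "i < j" "j \<le> 1" "i \<noteq> k" for i j :: nat
    using that k by linarith
  ultimately show ?thesis by blast
qed

text \<open>The image of a Kan fibration on vertices is edge-closed: if one end of an edge lifts, then the
lift is a horn $\Lambda^1_k$ whose filler provides a lift of the other end.\<close>

lemma trivial_fibration_surj_on_vertices:
  assumes p: "p \<in> Hom sSet E D" and kan: "kan_fibration p" and w: "weak_equivalence p"
    and d: "d \<in> fobj D 0"
  shows "\<exists>e\<in>fobj E 0. level p 0 e = d"
proof -
  have face: "face D 0 i (level p 1 z) = level p 0 (face E 0 i z)" if "z \<in> fobj E 1" "i \<le> 1" for z i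
    using Hom_sSetD(7) [OF p vertex_incl_in_Hom, of _ 1] that face_edge [of D] face_edge [of E]
    by (cases i) auto
  have face_in: "face E 0 i z \<in> fobj E 0" if "z \<in> fobj E 1" "i \<le> 1" for z i
    using act_in [OF Hom_sSetD(1) [OF p] vertex_incl_in_Hom that(1)] that(2) face_edge [of E]
    by (cases i) auto
  have lift: "face D 0 k y \<in> level p 0 ` fobj E 0"
    if y: "y \<in> fobj D 1" and ki: "k \<le> 1" "i \<le> 1" "i \<noteq> k" and e: "face D 0 i y \<in> level p 0 ` fobj E 0" for y k i
  proof -
    obtain e where e: "e \<in> fobj E 0" "face D 0 i y = level p 0 e" using e by blast
    have all: "j = i" if "j \<le> 1" "j \<noteq> k" for j using that ki by linarith
    obtain z where z: "z \<in> fobj E 1" "level p 1 z = y"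
      using kan_fibration_edge_lift [OF p kan ki(1) y e(1)] e(2) all by blast
    have "face D 0 k y = level p 0 (face E 0 k z)" "face E 0 k z \<in> fobj E 0"
      using face [OF z(1) ki(1)] face_in [OF z(1) ki(1)] z(2) by simp_all
    then show ?thesis by blast
  qed
  have "edge_closed D (level p 0 ` fobj E 0)"
    unfolding edge_closed_def using lift [of _ 0 1] lift [of _ 1 0] by auto
  from weak_equivalence_meets_components [OF p w this _ d] show ?thesis by auto
qed

lemma edge_closed_disc: "edge_closed (disc S) A"
proof -
  have "face (disc S) 0 0 e = e" "face (disc S) 0 1 e = e" if "e \<in> S" for e
    unfolding face_edge using that by (simp_all add: act_disc [OF vertex_incl_in_Hom])
  then show ?thesis by (simp add: edge_closed_def)
qed

lemma weak_equivalence_to_disc_surj: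
  assumes "f \<in> Hom sSet X (disc T)" "weak_equivalence f" "t \<in> T"
  shows "\<exists>x\<in>fobj X 0. level f 0 x = t"
  using weak_equivalence_meets_components [OF assms(1,2) edge_closed_disc, of "level f 0 ` fobj X 0" t] assms(3)
  by auto

lemma weak_equivalence_from_disc_inj:
  assumes "f \<in> Hom sSet (disc S) Y" "weak_equivalence f"
  shows "inj_on (level f 0) S"
  using weak_equivalence_separates_components [OF assms edge_closed_disc] by (force intro!: inj_onI)

lemma face_disc: "i \<le> Suc n \<Longrightarrow> x \<in> S \<Longrightarrow> face (disc S) n i x = x"
  unfolding face_def by (rule act_disc [of _ n "Suc n"]) (auto simp: Hom_DELTA monotone_on_def)

text \<open>In a discrete simplicial set all faces of a horn coincide, and this common element is the filler.\<close>

lemma kan_fibration_disc: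
  assumes p: "p \<in> Hom sSet (disc S) (disc T)"
  shows "kan_fibration p"
  unfolding kan_fibration_def Let_def Hom_sSetD(3,4) [OF p]
proof (intro conjI allI ballI impI)
  show "p \<in> Arr sSet" by (rule HomD(1) [OF p])
  fix n k x y
  assume n: "(1::nat) \<le> n" and k: "k \<le> n" and y: "y \<in> fobj (disc T) n"
    and x: "\<forall>i\<le>n. i \<noteq> k \<longrightarrow> x i \<in> fobj (disc S) (n - 1)"
    and compat: "\<forall>i j. i < j \<longrightarrow> j \<le> n \<longrightarrow> i \<noteq> k \<longrightarrow> j \<noteq> k \<longrightarrow>
      face (disc S) (n - 2) i (x j) = face (disc S) (n - 2) (j - 1) (x i)"
    and bd: "\<forall>i\<le>n. i \<noteq> k \<longrightarrow> face (disc T) (n - 1) i y = level p (n - 1) (x i)"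
  define i where "i = (if k = 0 then 1 else 0 :: nat)"
  have i: "i \<le> n" "i \<noteq> k" using n by (auto simp: i_def)
  have eq: "x a = x b" if "a < b" "b \<le> n" "a \<noteq> k" "b \<noteq> k" for a b
  proof -
    have "face (disc S) (n - 2) a (x b) = x b" "face (disc S) (n - 2) (b - 1) (x a) = x a"
      using that x by (auto intro!: face_disc)
    then show ?thesis using compat that by metis
  qed
  have all: "x j = x i" if "j \<le> n" "j \<noteq> k" for j
    using eq [of i j] eq [of j i] that i by (metis linorder_neqE_nat)
  have xi: "x i \<in> S" using x i by simp
  have "level p m (x i) = level p 0 (x i)" for m
    unfolding level_from_disc [OF p xi, of m]
    using level_in [OF p, of "x i" 0] xi by (intro act_disc [OF vertex_map_in_Hom]) simp
  from this [of n] this [of "n - 1"] have "level p n (x i) = level p (n - 1) (x i)" by simp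
  moreover have "face (disc T) (n - 1) i y = y" using y i n by (intro face_disc) auto
  ultimately have "level p n (x i) = y" using bd i by simp
  moreover have "face (disc S) (n - 1) j (x i) = x j" if "j \<le> n" "j \<noteq> k" for j
    using all [OF that] face_disc [OF _ xi, of j "n - 1"] that n by simp
  ultimately show "\<exists>z\<in>fobj (disc S) n. level p n z = y \<and> (\<forall>i\<le>n. i \<noteq> k \<longrightarrow> face (disc S) (n - 1) i z = x i)"
    using xi by auto
qed

section \<open>Equivalences of categories\<close>

definition fully_faithful :: "('o, 'm) cat \<Rightarrow> ('p, 'n) cat \<Rightarrow> ('o, 'm, 'p, 'n) ftor \<Rightarrow> bool" where
  "fully_faithful C D F \<longleftrightarrow>
     (\<forall>x\<in>Obj C. \<forall>y\<in>Obj C. bij_betw (farr F) (Hom C x y) (Hom D (fobj F x) (fobj F y)))"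

definition essentially_surjective :: "('o, 'm) cat \<Rightarrow> ('p, 'n) cat \<Rightarrow> ('o, 'm, 'p, 'n) ftor \<Rightarrow> bool" where
  "essentially_surjective C D F \<longleftrightarrow> (\<forall>d\<in>Obj D. \<exists>c\<in>Obj C. \<exists>h\<in>Hom D d (fobj F c). is_iso D h)"

lemma fully_faithful_inj:
  assumes "category C" "fully_faithful C D F" "f \<in> Hom C x y" "g \<in> Hom C x y" "farr F f = farr F g"
  shows "f = g"
  using assms category.Hom_Obj [OF assms(1,3)]
  by (auto simp: fully_faithful_def bij_betw_def dest: inj_onD)

lemma fully_faithful_surj:
  assumes "fully_faithful C D F" "x \<in> Obj C" "y \<in> Obj C" "h \<in> Hom D (fobj F x) (fobj F y)"
  obtains f where "f \<in> Hom C x y" "farr F f = h"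
  using assms unfolding fully_faithful_def bij_betw_def by (metis imageE)

lemma fully_faithful_reflects_iso:
  assumes C: "category C" and F: "cat_functor C D F" and ff: "fully_faithful C D F"
    and f: "f \<in> Hom C x y" and iso: "is_iso D (farr F f)"
  shows "is_iso C f"
proof -
  interpret C: category C by fact
  interpret F: cat_functor C D F by fact
  note xy = C.Hom_Obj [OF f]
  obtain h where h: "h \<in> Hom D (fobj F y) (fobj F x)"
    "Comp D h (farr F f) = Ide D (fobj F x)" "Comp D (farr F f) h = Ide D (fobj F y)"
    using is_isoE [OF iso F.farr_in [OF f]] by metis
  obtain g where g: "g \<in> Hom C y x" "farr F g = h"
    using fully_faithful_surj [OF ff xy(2,1) h(1)] .
  show ?thesis
  proof (rule is_isoI [OF f g(1)])
    show "Comp C g f = Ide C x"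
      using F.farr_Comp [OF f g(1)] F.farr_Ide [OF xy(1)] g(2) h(2)
      by (intro fully_faithful_inj [OF C ff C.Comp_in [OF f g(1)] C.Ide_in [OF xy(1)]]) simp
    show "Comp C f g = Ide C y"
      using F.farr_Comp [OF g(1) f] F.farr_Ide [OF xy(2)] g(2) h(3)
      by (intro fully_faithful_inj [OF C ff C.Comp_in [OF g(1) f] C.Ide_in [OF xy(2)]]) simp
  qed
qed

text \<open>Naturality of $GF \cong \mathrm{id}$ expresses an arrow $f$ through $GFf$.  This makes $F$ faithful, and
applied to $FG \cong \mathrm{id}$ it makes $G$ faithful, on which fullness of $F$ depends.\<close>

lemma naturally_iso_id_cancel:
  assumes C: "category C" and nat: "nat_trans C C (ftor_comp C G F) (ftor_id C) \<alpha>"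
    and iso: "\<And>x. x \<in> Obj C \<Longrightarrow> is_iso C (\<alpha> x)"
    and f: "f \<in> Hom C x y" and g: "g \<in> Hom C x y" and eq: "farr G (farr F f) = farr G (farr F g)"
  shows "f = g"
proof -
  interpret C: category C by fact
  note xy = C.Hom_Obj [OF f]
  have \<alpha>: "\<alpha> x \<in> Hom C (fobj G (fobj F x)) x" using nat_transD(1) [OF nat xy(1)] xy(1) by simp
  have *: "Comp C f (\<alpha> x) = Comp C g (\<alpha> x)"
    using nat_transD(2) [OF nat f] nat_transD(2) [OF nat g] HomD(1) [OF f] HomD(1) [OF g] eq by simp
  show ?thesis by (rule C.is_iso_cancel_right [OF iso [OF xy(1)] \<alpha> f g *])
qed

lemma equivalence_imp_fully_faithful:
  assumes C: "category C" and D: "category D" and E: "equivalence_of_categories C D F"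
  shows "fully_faithful C D F"
proof -
  interpret C: category C by fact
  interpret D: category D by fact
  obtain G \<alpha> \<beta> where F: "cat_functor C D F" and G: "cat_functor D C G"
    and \<alpha>: "nat_trans C C (ftor_comp C G F) (ftor_id C) \<alpha>" "\<And>x. x \<in> Obj C \<Longrightarrow> is_iso C (\<alpha> x)"
    and \<beta>: "nat_trans D D (ftor_comp D F G) (ftor_id D) \<beta>" "\<And>x. x \<in> Obj D \<Longrightarrow> is_iso D (\<beta> x)"
    using E unfolding equivalence_of_categories_def naturally_iso_def by blast
  interpret F: cat_functor C D F by fact
  interpret G: cat_functor D C G by fact
  show ?thesis
    unfolding fully_faithful_def
  proof (intro ballI bij_betwI')
    fix x y f g assume "f \<in> Hom C x y" "g \<in> Hom C x y"
    then show "farr F f = farr F g \<longleftrightarrow> f = g"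
      using naturally_iso_id_cancel [OF C \<alpha>] by metis
  next
    fix x y h assume xy: "x \<in> Obj C" "y \<in> Obj C" and h: "h \<in> Hom D (fobj F x) (fobj F y)"
    have a: "\<alpha> z \<in> Hom C (fobj G (fobj F z)) z" if "z \<in> Obj C" for z
      using nat_transD(1) [OF \<alpha>(1) that] that by simp
    note ax = a [OF xy(1)] and ay = a [OF xy(2)] and Gh = G.farr_in [OF h]
    obtain i where i: "i \<in> Hom C x (fobj G (fobj F x))" "Comp C i (\<alpha> x) = Ide C (fobj G (fobj F x))"
      using is_isoE [OF \<alpha>(2) [OF xy(1)] ax] by metis
    define f where "f = Comp C (Comp C (\<alpha> y) (farr G h)) i"
    have aGh: "Comp C (\<alpha> y) (farr G h) \<in> Hom C (fobj G (fobj F x)) y"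
      by (rule C.Comp_in [OF Gh ay])
    have f: "f \<in> Hom C x y" unfolding f_def by (rule C.Comp_in [OF i(1) aGh])
    have GFf: "farr G (farr F f) \<in> Hom C (fobj G (fobj F x)) (fobj G (fobj F y))"
      by (rule G.farr_in [OF F.farr_in [OF f]])
    have "Comp C (\<alpha> y) (farr G (farr F f)) = Comp C f (\<alpha> x)"
      using nat_transD(2) [OF \<alpha>(1) f] HomD(1) [OF f] by simp
    also have "\<dots> = Comp C (\<alpha> y) (farr G h)"
      unfolding f_def by (rule C.Comp_inverse_cancel(2) [OF ax i aGh])
    finally have "farr G (farr F f) = farr G h"
      by (rule C.is_iso_cancel_left [OF \<alpha>(2) [OF xy(2)] ay GFf Gh])
    then have "farr F f = h"
      using naturally_iso_id_cancel [OF D \<beta> F.farr_in [OF f] h] by metis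
    then show "\<exists>f\<in>Hom C x y. h = farr F f" using f by blast
  qed (rule F.farr_in)
qed

lemma equivalence_imp_essentially_surjective:
  assumes E: "equivalence_of_categories C D F"
  shows "essentially_surjective C D F"
  unfolding essentially_surjective_def
proof
  obtain G \<beta> where G: "cat_functor D C G"
    and \<beta>: "nat_trans D D (ftor_comp D F G) (ftor_id D) \<beta>" "\<And>x. x \<in> Obj D \<Longrightarrow> is_iso D (\<beta> x)"
    using E unfolding equivalence_of_categories_def naturally_iso_def by blast
  fix d assume d: "d \<in> Obj D"
  have "\<beta> d \<in> Hom D (fobj F (fobj G d)) d" using nat_transD(1) [OF \<beta>(1) d] d by simp
  then obtain h where "h \<in> Hom D d (fobj F (fobj G d))" "is_iso D h"
    using is_isoE [OF \<beta>(2) [OF d]] by metis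
  then show "\<exists>c\<in>Obj C. \<exists>h\<in>Hom D d (fobj F c). is_iso D h"
    using cat_functor.fobj_in [OF G d] by blast
qed

lemma equivalence_of_categoriesI:
  assumes C: "category C" and D: "category D" and F: "cat_functor C D F"
    and ff: "fully_faithful C D F" and es: "essentially_surjective C D F"
  shows "equivalence_of_categories C D F"
proof -
  interpret C: category C by fact
  interpret D: category D by fact
  interpret F: cat_functor C D F by fact
  have "\<exists>c e e'. c \<in> Obj C \<and> e \<in> Hom D d (fobj F c) \<and> e' \<in> Hom D (fobj F c) d \<and>
      Comp D e' e = Ide D d \<and> Comp D e e' = Ide D (fobj F c)" if d: "d \<in> Obj D" for d
  proof -
    obtain c h where ch: "c \<in> Obj C" "h \<in> Hom D d (fobj F c)" "is_iso D h"
      using es d unfolding essentially_surjective_def by blast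
    obtain e' where "e' \<in> Hom D (fobj F c) d" "Comp D e' h = Ide D d" "Comp D h e' = Ide D (fobj F c)"
      by (rule is_isoE [OF ch(3,2)])
    then show ?thesis using ch(1,2) by blast
  qed
  then obtain g e e' where g: "\<And>d. d \<in> Obj D \<Longrightarrow> g d \<in> Obj C"
    and e: "\<And>d. d \<in> Obj D \<Longrightarrow> e d \<in> Hom D d (fobj F (g d))"
    and e': "\<And>d. d \<in> Obj D \<Longrightarrow> e' d \<in> Hom D (fobj F (g d)) d"
    and e'e: "\<And>d. d \<in> Obj D \<Longrightarrow> Comp D (e' d) (e d) = Ide D d"
    and ee': "\<And>d. d \<in> Obj D \<Longrightarrow> Comp D (e d) (e' d) = Ide D (fobj F (g d))"
    by metis
  \<comment> \<open>$G h$ is the arrow that $F$ sends to the conjugate of $h$ by the chosen isomorphisms $e$; as $F$ is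
    faithful, equations between values of $G$ can be checked in $D$ after composing with $e'$.\<close>
  define conj where "conj d d' h = Comp D (e d') (Comp D h (e' d))" for d d' h
  have conj_in: "conj d d' h \<in> Hom D (fobj F (g d)) (fobj F (g d'))" if h: "h \<in> Hom D d d'" for d d' h
    unfolding conj_def
    using D.Comp_in [OF D.Comp_in [OF e' h] e] D.Hom_Obj [OF h] by blast
  have e'_conj: "Comp D (e' d') (conj d d' h) = Comp D h (e' d)" if h: "h \<in> Hom D d d'" for d d' h
    unfolding conj_def using D.Hom_Obj [OF h]
    by (intro D.Comp_inverse_cancel(1) [OF e e' e'e D.Comp_in [OF e' h]])
  define G where "G = \<lparr>fobj = g, farr = (\<lambda>h. THE k. k \<in> Hom C (g (Dom D h)) (g (Cod D h)) \<and>
      farr F k = conj (Dom D h) (Cod D h) h)\<rparr>"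
  have G: "farr G h \<in> Hom C (g d) (g d')" "farr F (farr G h) = conj d d' h" if h: "h \<in> Hom D d d'" for d d' h
  proof -
    note d = D.Hom_Obj [OF h]
    obtain k where k: "k \<in> Hom C (g d) (g d')" "farr F k = conj d d' h"
      using fully_faithful_surj [OF ff g [OF d(1)] g [OF d(2)] conj_in [OF h]] .
    have "farr G h = k"
      unfolding G_def ftor.select_convs HomD(2,3) [OF h]
    proof (rule the_equality)
      fix k' assume "k' \<in> Hom C (g d) (g d') \<and> farr F k' = conj d d' h"
      then show "k' = k" using fully_faithful_inj [OF C ff _ k(1)] k(2) by simp
    qed (use k in simp)
    then show "farr G h \<in> Hom C (g d) (g d')" "farr F (farr G h) = conj d d' h" using k by simp_all
  qed
  have F_eq: "farr F k = conj d d' h"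
    if "k \<in> Hom C (g d) (g d')" "h \<in> Hom D d d'" "Comp D (e' d') (farr F k) = Comp D h (e' d)" for k d d' h
  proof -
    note d = D.Hom_Obj [OF that(2)]
    have "Comp D (e d') (Comp D (e' d') (farr F k)) = farr F k"
      by (rule D.Comp_inverse_cancel(1) [OF e' [OF d(2)] e [OF d(2)] ee' [OF d(2)] F.farr_in [OF that(1)]])
    then show ?thesis by (simp add: conj_def that(3))
  qed
  have Gf: "cat_functor D C G"
  proof
    show "fobj G d \<in> Obj C" if "d \<in> Obj D" for d using g [OF that] by (simp add: G_def)
    show "farr G h \<in> Hom C (fobj G d) (fobj G d')" if "h \<in> Hom D d d'" for h d d'
      using G(1) [OF that] by (simp add: G_def)
    show "farr G (Ide D d) = Ide C (fobj G d)" if d: "d \<in> Obj D" for d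
    proof -
      note I = D.Ide_in [OF d] and gI = C.Ide_in [OF g [OF d]]
      have "farr F (Ide C (g d)) = conj d d (Ide D d)"
        using D.Comp_Ide [OF e' [OF d]] D.Ide_Comp [OF e' [OF d]] F.farr_Ide [OF g [OF d]]
        by (intro F_eq [OF gI I]) simp
      then have "farr G (Ide D d) = Ide C (g d)"
        using G [OF I] gI by (intro fully_faithful_inj [OF C ff G(1) [OF I]]) simp_all
      then show ?thesis by (simp add: G_def)
    qed
    fix h k d d' d'' assume h: "h \<in> Hom D d d'" and k: "k \<in> Hom D d' d''"
    note hk = D.Comp_in [OF h k] and GG = C.Comp_in [OF G(1) [OF h] G(1) [OF k]]
    note d = D.Hom_Obj [OF h] and d'' = D.Hom_Obj(2) [OF k]
    have "Comp D (e' d'') (Comp D (conj d' d'' k) (conj d d' h)) = Comp D (Comp D k h) (e' d)"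
      using D.Comp_assoc [OF conj_in [OF h] conj_in [OF k] e' [OF d'']] e'_conj [OF k]
        D.Comp_assoc [OF conj_in [OF h] e' [OF d(2)] k] e'_conj [OF h] D.Comp_assoc [OF e' [OF d(1)] h k] by simp
    then have "farr F (Comp C (farr G k) (farr G h)) = conj d d'' (Comp D k h)"
      using F.farr_Comp [OF G(1) [OF h] G(1) [OF k]] G(2) [OF h] G(2) [OF k]
      by (intro F_eq [OF GG hk]) simp
    then show "farr G (Comp D k h) = Comp C (farr G k) (farr G h)"
      using G(2) [OF hk] by (intro fully_faithful_inj [OF C ff G(1) [OF hk] GG]) simp
  qed
  have gG [simp]: "fobj G = g" by (simp add: G_def)
  have FG: "naturally_iso D D (ftor_comp D F G) (ftor_id D)"
    unfolding naturally_iso_def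
  proof (intro exI conjI ballI nat_transI [OF D])
    show "e' d \<in> Hom D (fobj (ftor_comp D F G) d) (fobj (ftor_id D) d)" if "d \<in> Obj D" for d
      using e' [OF that] that by simp
    show "Comp D (farr (ftor_id D) h) (e' d) = Comp D (e' d') (farr (ftor_comp D F G) h)"
      if h: "h \<in> Hom D d d'" for h d d'
      using e'_conj [OF h] G(2) [OF h] HomD(1) [OF h] by simp
    show "is_iso D (e' d)" if "d \<in> Obj D" for d
      by (rule is_isoI [OF e' [OF that] e [OF that] ee' [OF that] e'e [OF that]])
  qed
  have "\<exists>\<gamma>. \<gamma> \<in> Hom C (g (fobj F c)) c \<and> farr F \<gamma> = e' (fobj F c)" if c: "c \<in> Obj C" for c
    using fully_faithful_surj [OF ff g [OF F.fobj_in [OF c]] c e' [OF F.fobj_in [OF c]]] by metis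
  then obtain \<gamma> where \<gamma>: "\<And>c. c \<in> Obj C \<Longrightarrow> \<gamma> c \<in> Hom C (g (fobj F c)) c"
    "\<And>c. c \<in> Obj C \<Longrightarrow> farr F (\<gamma> c) = e' (fobj F c)"
    by metis
  have GF: "naturally_iso C C (ftor_comp C G F) (ftor_id C)"
    unfolding naturally_iso_def
  proof (intro exI conjI ballI nat_transI [OF C])
    show "\<gamma> c \<in> Hom C (fobj (ftor_comp C G F) c) (fobj (ftor_id C) c)" if "c \<in> Obj C" for c
      using \<gamma>(1) [OF that] that by simp
    show "is_iso C (\<gamma> c)" if c: "c \<in> Obj C" for c
    proof (rule fully_faithful_reflects_iso [OF C F ff \<gamma>(1) [OF c]])
      note Fc = F.fobj_in [OF c]
      show "is_iso D (farr F (\<gamma> c))"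
        unfolding \<gamma>(2) [OF c] by (rule is_isoI [OF e' [OF Fc] e [OF Fc] ee' [OF Fc] e'e [OF Fc]])
    qed
    fix k c c' assume k: "k \<in> Hom C c c'"
    note c = C.Hom_Obj [OF k] and Fk = F.farr_in [OF k]
    have "Comp C k (\<gamma> c) = Comp C (\<gamma> c') (farr G (farr F k))"
    proof (rule fully_faithful_inj [OF C ff C.Comp_in [OF \<gamma>(1) [OF c(1)] k] C.Comp_in [OF G(1) [OF Fk] \<gamma>(1) [OF c(2)]]])
      show "farr F (Comp C k (\<gamma> c)) = farr F (Comp C (\<gamma> c') (farr G (farr F k)))"
        using F.farr_Comp [OF \<gamma>(1) [OF c(1)] k] F.farr_Comp [OF G(1) [OF Fk] \<gamma>(1) [OF c(2)]]
          \<gamma>(2) [OF c(1)] \<gamma>(2) [OF c(2)] G(2) [OF Fk] e'_conj [OF Fk] by simp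
    qed
    then show "Comp C (farr (ftor_id C) k) (\<gamma> c) = Comp C (\<gamma> c') (farr (ftor_comp C G F) k)"
      using HomD(1) [OF k] by simp
  qed
  show ?thesis
    unfolding equivalence_of_categories_def using F Gf GF FG by blast
qed

text \<open>An arrow $k$ with $Fk \circ h = h'$ must satisfy $Fk = h' \circ h^{-1}$.\<close>

lemma fully_faithful_initial_comma:
  assumes C: "category C" and B: "category B" and F: "cat_functor C B F" and ff: "fully_faithful C B F"
    and c: "c \<in> Obj C" and h: "h \<in> Hom B b (fobj F c)" and iso: "is_iso B h"
  shows "is_initial (comma C B F b) (c, h)"
proof -
  interpret C: category C by fact
  interpret B: category B by fact
  interpret F: cat_functor C B F by fact
  obtain i where i: "i \<in> Hom B (fobj F c) b" "Comp B i h = Ide B b" "Comp B h i = Ide B (fobj F c)"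
    using is_isoE [OF iso h] by metis
  show ?thesis
    unfolding is_initial_def
  proof (intro conjI ballI)
    show "(c, h) \<in> Obj (comma C B F b)" using c h by (simp add: Obj_comma)
    fix y assume y: "y \<in> Obj (comma C B F b)"
    obtain c' h' where [simp]: "y = (c', h')" by (cases y)
    have c': "c' \<in> Obj C" and h': "h' \<in> Hom B b (fobj F c')" using y by (simp_all add: Obj_comma)
    obtain k where k: "k \<in> Hom C c c'" "farr F k = Comp B h' i"
      using fully_faithful_surj [OF ff c c' B.Comp_in [OF i(1) h']] .
    have kh: "Comp B (farr F k) h = h'"
      unfolding k(2) by (rule B.Comp_inverse_cancel(2) [OF h i(1,2) h'])
    show "\<exists>!f. f \<in> Hom (comma C B F b) (c, h) y"
    proof (rule ex1I [of _ "((c, h), k, y)"])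
      show "((c, h), k, y) \<in> Hom (comma C B F b) (c, h) y"
        using comma_HomI [OF C B F h k(1)] kh by simp
      fix t assume "t \<in> Hom (comma C B F b) (c, h) y"
      then obtain k' where k': "t = ((c, h), k', y)" "k' \<in> Hom C c c'" "Comp B (farr F k') h = h'"
        by (auto elim!: comma_HomE)
      have "farr F k' = Comp B (Comp B (farr F k') h) i"
        using B.Comp_assoc [OF i(1) h F.farr_in [OF k'(2)]] i(3) B.Comp_Ide [OF F.farr_in [OF k'(2)]] by simp
      then have "k' = k"
        using fully_faithful_inj [OF C ff k'(2) k(1)] k'(3) k(2) by simp
      then show "t = ((c, h), k, y)" using k'(1) by simp
    qed
  qed
qed

section \<open>Equivalences are universal equivalences\<close>

lemma bousfield_kan_simps [simp]:
  "Und (bousfield_kan A) = sPSh A"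
  "f \<in> Weq (bousfield_kan A) \<longleftrightarrow> f \<in> Arr (sPSh A) \<and> (\<forall>a\<in>Obj A. weak_equivalence (component f a))"
  "f \<in> Fib (bousfield_kan A) \<longleftrightarrow> f \<in> Arr (sPSh A) \<and> (\<forall>a\<in>Obj A. kan_fibration (component f a))"
  "f \<in> Cof (bousfield_kan A) \<longleftrightarrow> f \<in> Arr (sPSh A) \<and>
     (\<forall>p \<in> Fib (bousfield_kan A) \<inter> Weq (bousfield_kan A). has_lifting (sPSh A) f p)"
  by (simp_all add: bousfield_kan_def Let_def)

lemma (in functor_with_initial_commas) lan_preserves_cofibrations:
  assumes i: "i \<in> Cof (bousfield_kan C)"
  shows "farr (lan C B F) i \<in> Cof (bousfield_kan B)"
proof -
  have i_Arr: "i \<in> Arr (sPSh C)" using i by simp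
  have "has_lifting (sPSh B) (farr (lan C B F) i) p"
    if p: "p \<in> Fib (bousfield_kan B)" "p \<in> Weq (bousfield_kan B)" for p
  proof (rule adjunction_has_lifting [OF PC.category_axioms PB.category_axioms adjunction_lan_restr i_Arr])
    show p_Arr: "p \<in> Arr (sPSh B)" using p by simp
    have "farr (restr C B F) p \<in> Arr (sPSh C)"
      using HomD(1) [OF cat_functor.farr_in [OF cat_functor_restr [OF axms] Arr_Hom [OF p_Arr]]] .
    then have "farr (restr C B F) p \<in> Fib (bousfield_kan C) \<inter> Weq (bousfield_kan C)"
      using p F.fobj_in by simp
    then show "has_lifting (sPSh C) i (farr (restr C B F) p)" using i by simp
  qed
  moreover have "farr (lan C B F) i \<in> Arr (sPSh B)"
    using HomD(1) [OF cat_functor.farr_in [OF cat_functor_lan Arr_Hom [OF i_Arr]]] .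
  ultimately show ?thesis by simp
qed

theorem equivalence_imp_universal_equivalence:
  assumes C: "category C" and B: "category B" and E: "equivalence_of_categories C B F"
  shows "universal_equivalence TYPE('u) C B F"
proof -
  have F: "cat_functor C B F" using E by (simp add: equivalence_of_categories_def)
  note ff = equivalence_imp_fully_faithful [OF C B E]
    and es = equivalence_imp_essentially_surjective [OF E]
  interpret functor_with_initial_commas C B F
  proof (intro functor_with_initial_commas.intro C B F functor_with_initial_commas_axioms.intro)
    fix b assume "b \<in> Obj B"
    then obtain c h where "c \<in> Obj C" "h \<in> Hom B b (fobj F c)" "is_iso B h"
      using es unfolding essentially_surjective_def by blast
    then show "\<exists>t. is_initial (comma C B F b) t"
      using fully_faithful_initial_comma [OF C B F ff] by blast
  qed
  have unit_iso: "is_iso sSet (component (lan_unit C B F X) c)"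
    if X: "X \<in> Obj (sPSh C)" and c: "c \<in> Obj C" for X :: "('a, 'b, 'u) spsh" and c
  proof -
    note Fc = F.fobj_in [OF c]
    have "is_initial (comma C B F (fobj F c)) (c, Ide B (fobj F c))"
      by (rule fully_faithful_initial_comma [OF C B F ff c B.Ide_in [OF Fc] B.is_iso_Ide [OF Fc]])
    then show ?thesis using lan_leg_is_iso [OF X Fc] c by simp
  qed
  \<comment> \<open>Each $b$ is isomorphic to some $Fc$, so weak equivalences of presheaves on $B$ are detected on the
    image of $F$.\<close>
  have weq_at: "weak_equivalence (component t b)"
    if t: "t \<in> Hom (sPSh B) Y Y'" and w: "\<And>c. c \<in> Obj C \<Longrightarrow> weak_equivalence (component t (fobj F c))"
      and b: "b \<in> Obj B" for t :: "('c, 'd, 'u) spsh_map" and Y Y' b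
  proof -
    obtain c h where c: "c \<in> Obj C" and h: "h \<in> Hom B b (fobj F c)" "is_iso B h"
      using es b unfolding essentially_surjective_def by blast
    note t' = sPSh_HomD [OF t] and Fc = F.fobj_in [OF c]
    have iso: "is_iso sSet (farr Z h)" if "Z \<in> Obj (sPSh B)" for Z :: "('c, 'd, 'u) spsh"
    proof -
      have "is_iso (op_cat B) h" using h(2) by (auto simp: is_iso_def)
      then show ?thesis
        using cat_functor.farr_is_iso [OF sPSh_functor [OF that] category_op_cat [OF B], of h] h(1) by simp
    qed
    have "weak_equivalence (Comp sSet (farr Y' h) (component t (fobj F c)))"
      using weak_equivalence_cancel_iso(2) [OF t'(5) [OF Fc] sPSh_arr_in [OF t'(2) h(1)] iso [OF t'(2)]]
        w [OF c] by simp
    then show ?thesis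
      using weak_equivalence_cancel_iso(1) [OF sPSh_arr_in [OF t'(1) h(1)] t'(5) [OF b] iso [OF t'(1)]]
        t'(6) [OF h(1)] by simp
  qed
  \<comment> \<open>At $c$ the adjunct of $f$ is the component of $f$ at $Fc$ precomposed with the unit, which is an isomorphism.\<close>
  have adjunct_weq: "weak_equivalence (component (mate X f) c)
      \<longleftrightarrow> weak_equivalence (component f (fobj F c))"
    if X: "X \<in> Obj (sPSh C)" and f: "f \<in> Hom (sPSh B) (lan_obj C B F X) Y" and c: "c \<in> Obj C"
    for X :: "('a, 'b, 'u) spsh" and f Y c
  proof -
    have "component (lan_unit C B F X) c \<in> Hom sSet (fobj X c) (fobj (lan_obj C B F X) (fobj F c))"
      using sPSh_HomD(5) [OF lan_unit_in_Hom [OF X] c] c by simp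
    from weak_equivalence_cancel_iso(1) [OF this sPSh_HomD(5) [OF f F.fobj_in [OF c]] unit_iso [OF X c]]
    show ?thesis using c by (simp add: adjunct_def del: component_lan_unit)
  qed
  \<comment> \<open>The adjunct of $F_*i$ is $i$ followed by the unit.\<close>
  have weq_lan: "farr (lan C B F) i \<in> Weq (bousfield_kan B)"
    if i: "i \<in> Weq (bousfield_kan C)" for i :: "('a, 'b, 'u) spsh_map"
  proof -
    obtain X X' where iX: "i \<in> Hom (sPSh C) X X'" using i Arr_Hom [of i] by auto
    note X = PC.Hom_Obj [OF iX] and Li = lan_farr_in_Hom [OF iX]
    have "weak_equivalence (component (farr (lan C B F) i) (fobj F c))" if c: "c \<in> Obj C" for c
    proof -
      have "mate X (farr (lan C B F) i) =
          Comp (sPSh C) (lan_unit C B F X') i"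
        using adjunctionD(4) [OF adjunction_lan_restr PC.category_axioms iX] by (simp add: adjunct_def)
      moreover have "weak_equivalence (component (Comp (sPSh C) (lan_unit C B F X') i) c)"
        using weak_equivalence_cancel_iso(2) [OF sPSh_HomD(5) [OF iX c]
            sPSh_HomD(5) [OF lan_unit_in_Hom [OF X(2)] c] unit_iso [OF X(2) c]] i c
        by (simp del: component_lan_unit)
      ultimately show ?thesis using adjunct_weq [OF X(1) Li c] by simp
    qed
    then show ?thesis using weq_at [OF Li] HomD(1) [OF Li] by simp
  qed
  have weq_adjunct: "f \<in> Weq (bousfield_kan B) \<longleftrightarrow>
      mate X f \<in> Weq (bousfield_kan C)"
    if X: "X \<in> Obj (sPSh C)" and f: "f \<in> Hom (sPSh B) (lan_obj C B F X) Y"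
    for X :: "('a, 'b, 'u) spsh" and f Y
  proof -
    have "mate X f \<in> Hom (sPSh C) X (fobj (restr C B F) Y)"
      using bij_betwE [OF adjunctionD(5) [OF adjunction_lan_restr X PB.Hom_Obj(2) [OF f]]] f by simp
    then show ?thesis
      using HomD(1) [OF f] weq_at [OF f] adjunct_weq [OF X f] F.fobj_in by (auto dest: HomD(1))
  qed
  have obj: "X \<in> Obj (sPSh C)" if "cofibrant (bousfield_kan C) X" for X :: "('a, 'b, 'u) spsh"
    using that PC.Hom_Obj(2) unfolding cofibrant_def by auto
  show ?thesis
    unfolding universal_equivalence_def quillen_equivalence_def quillen_adjunction_def bousfield_kan_simps(1)
    using adjunction_lan_restr lan_preserves_cofibrations weq_lan weq_adjunct obj
    by (auto simp del: bousfield_kan_simps(2-))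
qed

section \<open>Discrete presheaves\<close>

text \<open>Set-valued presheaves given by their sets and restriction maps.  Viewing
them as constant simplicial presheaves is left adjoint to taking vertices, so maps out of a discrete
presheaf are determined by what they do to vertices.\<close>

locale set_presheaf = category A for A :: "('o, 'm) cat" +
  fixes P :: "'o \<Rightarrow> 'u set" and \<rho> :: "'m \<Rightarrow> 'u \<Rightarrow> 'u"
  assumes \<rho>_in: "k \<in> Hom A a a' \<Longrightarrow> x \<in> P a' \<Longrightarrow> \<rho> k x \<in> P a"
    and \<rho>_Ide: "a \<in> Obj A \<Longrightarrow> x \<in> P a \<Longrightarrow> \<rho> (Ide A a) x = x"
    and \<rho>_Comp: "k \<in> Hom A a a' \<Longrightarrow> k' \<in> Hom A a' a'' \<Longrightarrow> x \<in> P a'' \<Longrightarrow>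
      \<rho> (Comp A k' k) x = \<rho> k (\<rho> k' x)"

definition disc_presheaf ::
  "('o, 'm) cat \<Rightarrow> ('o \<Rightarrow> 'u set) \<Rightarrow> ('m \<Rightarrow> 'u \<Rightarrow> 'u) \<Rightarrow> ('o, 'm, 'u) spsh" where
  "disc_presheaf A P \<rho> =
     \<lparr>fobj = (\<lambda>a\<in>Obj A. disc (P a)),
      farr = (\<lambda>k\<in>Arr A. sset_map (disc (P (Cod A k))) (\<lambda>n. \<rho> k) (disc (P (Dom A k))))\<rparr>"

lemma disc_presheaf_fobj [simp]: "a \<in> Obj A \<Longrightarrow> fobj (disc_presheaf A P \<rho>) a = disc (P a)"
  by (simp add: disc_presheaf_def)

lemma level_disc_presheaf:
  "k \<in> Hom A a a' \<Longrightarrow> x \<in> P a' \<Longrightarrow> level (farr (disc_presheaf A P \<rho>) k) n x = \<rho> k x"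
  using HomD [of k A a a'] by (simp add: disc_presheaf_def)

context set_presheaf
begin

abbreviation "D \<equiv> disc_presheaf A P \<rho>"

lemma disc_presheaf_farr_in:
  assumes k: "k \<in> Hom A a a'"
  shows "farr D k \<in> Hom sSet (disc (P a')) (disc (P a))"
proof -
  have "sset_map (disc (P a')) (\<lambda>n. \<rho> k) (disc (P a)) \<in> Hom sSet (disc (P a')) (disc (P a))"
  proof (rule sset_map_in_Hom)
    fix m n \<theta> x assume \<theta>: "\<theta> \<in> Hom DELTA m n" and x: "x \<in> fobj (disc (P a')) n"
    then show "act (disc (P a)) \<theta> (\<rho> k x) = \<rho> k (act (disc (P a')) \<theta> x)"
      using \<rho>_in [OF k] by (simp add: act_disc [OF \<theta>])
  qed (use \<rho>_in [OF k] in simp_all)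
  then show ?thesis using HomD [OF k] by (simp add: disc_presheaf_def)
qed

lemma disc_presheaf_in_Obj: "D \<in> Obj (sPSh A)"
proof (rule sPSh_ObjI)
  interpret sSet: category sSet by (rule category_sSet)
  show "cat_functor (op_cat A) sSet D"
  proof
    fix k a a' assume "k \<in> Hom (op_cat A) a' a"
    then have k: "k \<in> Hom A a a'" by simp
    show "farr D k \<in> Hom sSet (fobj D a') (fobj D a)"
      using disc_presheaf_farr_in [OF k] Hom_Obj [OF k] by simp
    fix k' z assume "k' \<in> Hom (op_cat A) a z"
    then have k': "k' \<in> Hom A z a" by simp
    note kk = Comp_in [OF k' k] and in1 = disc_presheaf_farr_in [OF k] and in2 = disc_presheaf_farr_in [OF k']
    show "farr D (Comp (op_cat A) k' k) = Comp sSet (farr D k') (farr D k)"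
    proof (rule sSet_map_eqI)
      show "farr D (Comp (op_cat A) k' k) \<in> Hom sSet (disc (P a')) (disc (P z))"
        using disc_presheaf_farr_in [OF kk] by simp
      show "Comp sSet (farr D k') (farr D k) \<in> Hom sSet (disc (P a')) (disc (P z))"
        by (rule sSet.Comp_in [OF in1 in2])
      fix n x assume x: "x \<in> fobj (disc (P a')) n"
      show "level (farr D (Comp (op_cat A) k' k)) n x = level (Comp sSet (farr D k') (farr D k)) n x"
        using x level_Comp [OF in1 in2 x] level_disc_presheaf [OF kk, of x P] level_disc_presheaf [OF k, of x P]
          level_disc_presheaf [OF k', of "\<rho> k x" P] \<rho>_in [OF k, of x] \<rho>_Comp [OF k' k] by simp
    qed
  next
    fix a assume "a \<in> Obj (op_cat A)"
    then have a: "a \<in> Obj A" by simp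
    then show "fobj D a \<in> Obj sSet" by simp
    have "farr D (Ide A a) = Ide sSet (disc (P a))"
    proof (rule sSet_map_eqI [OF disc_presheaf_farr_in [OF Ide_in [OF a]] sSet.Ide_in [OF disc_in_Obj]])
      fix n x assume x: "x \<in> fobj (disc (P a)) n"
      show "level (farr D (Ide A a)) n x = level (Ide sSet (disc (P a))) n x"
        using x level_Ide [OF x] level_disc_presheaf [OF Ide_in [OF a], of x P] \<rho>_Ide [OF a] by simp
    qed
    then show "farr D (Ide (op_cat A) a) = Ide sSet (fobj D a)" using a by simp
  qed
qed (simp_all add: disc_presheaf_def)

lemma map_from_disc_presheaf:
  assumes Z: "Z \<in> Obj (sPSh A)"
    and g: "\<And>a s. a \<in> Obj A \<Longrightarrow> s \<in> P a \<Longrightarrow> g a s \<in> fobj (fobj Z a) 0"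
    and natural: "\<And>k a a' s. k \<in> Hom A a a' \<Longrightarrow> s \<in> P a' \<Longrightarrow> level (farr Z k) 0 (g a' s) = g a (\<rho> k s)"
  obtains t where "t \<in> Hom (sPSh A) D Z"
    "\<And>a s. a \<in> Obj A \<Longrightarrow> s \<in> P a \<Longrightarrow> level (component t a) 0 s = g a s"
proof -
  interpret sSet: category sSet by (rule category_sSet)
  define \<alpha> where "\<alpha> a = sset_map (disc (P a)) (\<lambda>n s. act (fobj Z a) (vertex_map n) (g a s)) (fobj Z a)" for a
  note Za = sPSh_obj_in [OF Z]
  have \<alpha>: "\<alpha> a \<in> Hom sSet (disc (P a)) (fobj Z a)" if "a \<in> Obj A" for a
    unfolding \<alpha>_def using g [OF that] by (intro map_from_disc_in_Hom [OF Za [OF that]])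
  have "(D, restrict \<alpha> (Obj A), Z) \<in> Hom (sPSh A) D Z"
  proof (rule sPSh_mapI [OF category_axioms disc_presheaf_in_Obj Z])
    show "\<alpha> a \<in> Hom sSet (fobj D a) (fobj Z a)" if "a \<in> Obj A" for a using \<alpha> [OF that] that by simp
    fix k a a' assume k: "k \<in> Hom A a a'"
    note a = Hom_Obj [OF k] and Zk = sPSh_arr_in [OF Z k] and Dk = disc_presheaf_farr_in [OF k]
    show "Comp sSet (farr Z k) (\<alpha> a') = Comp sSet (\<alpha> a) (farr D k)"
    proof (rule sSet_map_eqI [OF sSet.Comp_in [OF \<alpha> [OF a(2)] Zk] sSet.Comp_in [OF Dk \<alpha> [OF a(1)]]])
      fix n x assume x: "x \<in> fobj (disc (P a')) n"
      then have x': "x \<in> P a'" by simp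
      have "level (farr Z k) n (act (fobj Z a') (vertex_map n) (g a' x)) =
          act (fobj Z a) (vertex_map n) (g a (\<rho> k x))"
        using Hom_sSetD(7) [OF Zk vertex_map_in_Hom g [OF a(2) x'], of n] natural [OF k x'] by simp
      then show "level (Comp sSet (farr Z k) (\<alpha> a')) n x = level (Comp sSet (\<alpha> a) (farr D k)) n x"
        unfolding level_Comp [OF \<alpha> [OF a(2)] Zk x] level_Comp [OF Dk \<alpha> [OF a(1)] x]
        using x' \<rho>_in [OF k x'] level_disc_presheaf [OF k, of x P \<rho> n] by (simp add: \<alpha>_def)
    qed
  qed
  moreover have "level (component (D, restrict \<alpha> (Obj A), Z) a) 0 s = g a s" if "a \<in> Obj A" "s \<in> P a" for a s
    using that act_vertex_map_0 [OF Za g] by (simp add: \<alpha>_def)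
  ultimately show thesis using that by blast
qed

lemma map_from_disc_presheaf_eqI:
  assumes s: "s \<in> Hom (sPSh A) D Z" and t: "t \<in> Hom (sPSh A) D Z"
    and eq: "\<And>a x. a \<in> Obj A \<Longrightarrow> x \<in> P a \<Longrightarrow> level (component s a) 0 x = level (component t a) 0 x"
  shows "s = t"
proof (rule sPSh_map_eqI [OF s t])
  fix a assume a: "a \<in> Obj A"
  have sa: "component s a \<in> Hom sSet (disc (P a)) (fobj Z a)" and ta: "component t a \<in> Hom sSet (disc (P a)) (fobj Z a)"
    using sPSh_HomD(5) [OF s a] sPSh_HomD(5) [OF t a] a by simp_all
  show "component s a = component t a"
  proof (rule sSet_map_eqI [OF sa ta])
    fix n x assume "x \<in> fobj (disc (P a)) n"
    then have x: "x \<in> P a" by simp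
    show "level (component s a) n x = level (component t a) n x"
      unfolding level_from_disc [OF sa x, of n] level_from_disc [OF ta x, of n] eq [OF a x] ..
  qed
qed

end

lemma ex_initial_sPSh:
  assumes "category A"
  obtains I where "is_initial (sPSh A) (I :: ('o, 'm, 'u) spsh)"
proof -
  interpret category A by fact
  interpret E: set_presheaf A "\<lambda>a. {} :: 'u set" "\<lambda>k x. x" by unfold_locales simp_all
  have "\<exists>!t. t \<in> Hom (sPSh A) E.D Z" if Z: "Z \<in> Obj (sPSh A)" for Z
  proof -
    obtain t where "t \<in> Hom (sPSh A) E.D Z"
      by (rule E.map_from_disc_presheaf [OF Z, of "\<lambda>a x. x"]) simp_all
    then show ?thesis using E.map_from_disc_presheaf_eqI by blast
  qed
  then show thesis using E.disc_presheaf_in_Obj that unfolding is_initial_def by blast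
qed

text \<open>The constant presheaf at a point is terminal and itself discrete, so the map to it is
objectwise a map of discrete simplicial sets and hence a Kan fibration.\<close>

lemma (in set_presheaf) fibrant_disc_presheaf: "fibrant (bousfield_kan A) D"
proof -
  interpret T: set_presheaf A "\<lambda>a. {u} :: 'u set" "\<lambda>k x. x" for u by unfold_locales simp_all
  fix u :: 'u
  let ?T = "T.D u"
  interpret sSet: category sSet by (rule category_sSet)
  have uniq: "s = t" if s: "s \<in> Hom (sPSh A) Z ?T" and t: "t \<in> Hom (sPSh A) Z ?T" for s t Z
  proof (rule sPSh_map_eqI [OF s t])
    fix a assume a: "a \<in> Obj A"
    note st = sPSh_HomD(5) [OF s a] sPSh_HomD(5) [OF t a]
    show "component s a = component t a"
      using level_in [OF st(1)] level_in [OF st(2)] a by (intro sSet_map_eqI [OF st]) simp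
  qed
  have ex: "\<exists>t. t \<in> Hom (sPSh A) Z ?T" if Z: "Z \<in> Obj (sPSh A)" for Z
  proof -
    let ?\<alpha> = "\<lambda>a. sset_map (fobj Z a) (\<lambda>n x. u) (disc {u})"
    have \<alpha>: "?\<alpha> a \<in> Hom sSet (fobj Z a) (disc {u})" if "a \<in> Obj A" for a
      using sPSh_obj_in [OF Z that] by (intro sset_map_in_Hom) (simp_all add: act_disc)
    have "(Z, restrict ?\<alpha> (Obj A), ?T) \<in> Hom (sPSh A) Z ?T"
    proof (rule sPSh_mapI [OF category_axioms Z T.disc_presheaf_in_Obj])
      show "?\<alpha> a \<in> Hom sSet (fobj Z a) (fobj ?T a)" if "a \<in> Obj A" for a
        using \<alpha> [OF that] that by simp
      fix k a a' assume k: "k \<in> Hom A a a'"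
      note a = Hom_Obj [OF k] and Zk = sPSh_arr_in [OF Z k] and Tk = T.disc_presheaf_farr_in [OF k, of u]
      note l = sSet.Comp_in [OF \<alpha> [OF a(2)] Tk] and r = sSet.Comp_in [OF Zk \<alpha> [OF a(1)]]
      show "Comp sSet (farr ?T k) (?\<alpha> a') = Comp sSet (?\<alpha> a) (farr Z k)"
      proof (rule sSet_map_eqI [OF l r])
        fix n x assume x: "x \<in> fobj (fobj Z a') n"
        show "level (Comp sSet (farr ?T k) (?\<alpha> a')) n x = level (Comp sSet (?\<alpha> a) (farr Z k)) n x"
          using level_in [OF l x] level_in [OF r x] by simp
      qed
    qed
    then show ?thesis by blast
  qed
  have "is_terminal (sPSh A) ?T"
    unfolding is_terminal_def using T.disc_presheaf_in_Obj ex uniq by blast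
  moreover obtain p where p: "p \<in> Hom (sPSh A) D ?T" using ex [OF disc_presheaf_in_Obj] by blast
  moreover have "p \<in> Fib (bousfield_kan A)"
  proof -
    have "kan_fibration (component p a)" if a: "a \<in> Obj A" for a
      using sPSh_HomD(5) [OF p a] a by (intro kan_fibration_disc [of _ "P a" "{u}"]) simp
    then show ?thesis using HomD(1) [OF p] by simp
  qed
  ultimately show ?thesis unfolding fibrant_def bousfield_kan_simps(1) by blast
qed

section \<open>Representable presheaves\<close>

text \<open>Presheaves take values in subsets of the universe \<open>'u\<close>, while arrows live in a type of their
own.  The injection $e$ turns hom-sets into such subsets; \<open>dec\<close> undoes it.\<close>

locale encoded_category = category A for A :: "('o, 'm) cat" +
  fixes e :: "'m \<Rightarrow> 'u"
  assumes inj_e: "inj_on e (Arr A)"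
begin

definition dec :: "'u \<Rightarrow> 'm" where
  "dec = the_inv_into (Arr A) e"

lemma dec_e [simp]: "k \<in> Hom A a b \<Longrightarrow> dec (e k) = k"
  unfolding dec_def by (rule the_inv_into_f_f [OF inj_e HomD(1)])

definition repr :: "'o \<Rightarrow> ('o, 'm, 'u) spsh" where
  "repr c = disc_presheaf A (\<lambda>a. e ` Hom A a c) (\<lambda>k u. e (Comp A (dec u) k))"

sublocale repr: set_presheaf A "\<lambda>a. e ` Hom A a c" "\<lambda>k u. e (Comp A (dec u) k)" for c
proof unfold_locales
  fix k a a' x assume "k \<in> Hom A a a'" "x \<in> e ` Hom A a' c"
  then show "e (Comp A (dec x) k) \<in> e ` Hom A a c" by (auto intro: Comp_in)
next
  fix a x assume "a \<in> Obj A" "x \<in> e ` Hom A a c"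
  then show "e (Comp A (dec x) (Ide A a)) = x" by (auto simp: Comp_Ide)
next
  fix k k' a a' a'' x assume k: "k \<in> Hom A a a'" "k' \<in> Hom A a' a''" and x: "x \<in> e ` Hom A a'' c"
  obtain h where h: "x = e h" "h \<in> Hom A a'' c" using x by blast
  show "e (Comp A (dec x) (Comp A k' k)) = e (Comp A (dec (e (Comp A (dec x) k'))) k)"
    using dec_e [OF h(2)] dec_e [OF Comp_in [OF k(2) h(2)]] Comp_assoc [OF k h(2)] h(1) by simp
qed

lemma repr_in_Obj: "repr c \<in> Obj (sPSh A)"
  unfolding repr_def by (rule repr.disc_presheaf_in_Obj)

lemma repr_fobj [simp]: "a \<in> Obj A \<Longrightarrow> fobj (repr c) a = disc (e ` Hom A a c)"
  by (simp add: repr_def)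

lemma repr_farr:
  "k \<in> Hom A a a' \<Longrightarrow> h \<in> Hom A a' c \<Longrightarrow> level (farr (repr c) k) n (e h) = e (Comp A h k)"
  unfolding repr_def by (subst level_disc_presheaf [of k A a a']) simp_all

lemma yoneda_value:
  assumes t: "t \<in> Hom (sPSh A) (repr c) Z" and k: "k \<in> Hom A a c"
  shows "level (component t a) 0 (e k) = level (farr Z k) 0 (level (component t c) 0 (e (Ide A c)))"
proof -
  note ac = Hom_Obj [OF k] and t' = sPSh_HomD [OF t]
  note I = Ide_in [OF ac(2)]
  have x: "e (Ide A c) \<in> fobj (fobj (repr c) c) 0" using ac(2) I by simp
  have "level (Comp sSet (farr Z k) (component t c)) 0 (e (Ide A c)) =
      level (Comp sSet (component t a) (farr (repr c) k)) 0 (e (Ide A c))"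
    using t'(6) [OF k] by simp
  then show ?thesis
    using level_Comp [OF t'(5) [OF ac(2)] sPSh_arr_in [OF t'(2) k] x]
      level_Comp [OF sPSh_arr_in [OF t'(1) k] t'(5) [OF ac(1)] x] repr_farr [OF k I] Ide_Comp [OF k] by simp
qed

lemma yoneda_eqI:
  assumes c: "c \<in> Obj A" and s: "s \<in> Hom (sPSh A) (repr c) Z" and t: "t \<in> Hom (sPSh A) (repr c) Z"
    and eq: "level (component s c) 0 (e (Ide A c)) = level (component t c) 0 (e (Ide A c))"
  shows "s = t"
proof (rule repr.map_from_disc_presheaf_eqI [OF s [unfolded repr_def] t [unfolded repr_def]])
  fix a x assume "x \<in> e ` Hom A a c"
  then show "level (component s a) 0 x = level (component t a) 0 x"
    using yoneda_value [OF s] yoneda_value [OF t] eq by auto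
qed

lemma yoneda_ex:
  assumes c: "c \<in> Obj A" and Z: "Z \<in> Obj (sPSh A)" and z: "z \<in> fobj (fobj Z c) 0"
  obtains t where "t \<in> Hom (sPSh A) (repr c) Z" "level (component t c) 0 (e (Ide A c)) = z"
proof (rule repr.map_from_disc_presheaf [OF Z, of c "\<lambda>a x. level (farr Z (dec x)) 0 z"])
  fix a s assume "s \<in> e ` Hom A a c"
  then show "level (farr Z (dec s)) 0 z \<in> fobj (fobj Z a) 0"
    using level_in [OF sPSh_arr_in [OF Z] z] by auto
next
  fix k a a' s assume k: "k \<in> Hom A a a'" and "s \<in> e ` Hom A a' c"
  then obtain h where h: "s = e h" "h \<in> Hom A a' c" by blast
  show "level (farr Z k) 0 (level (farr Z (dec s)) 0 z) = level (farr Z (dec (e (Comp A (dec s) k)))) 0 z"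
    using level_Comp [OF sPSh_arr_in [OF Z h(2)] sPSh_arr_in [OF Z k] z] sPSh_Comp [OF Z k h(2)]
      dec_e [OF h(2)] dec_e [OF Comp_in [OF k h(2)]] h(1) by simp
next
  fix t assume t: "t \<in> Hom (sPSh A) (repr.D c) Z"
    and v: "\<And>a s. a \<in> Obj A \<Longrightarrow> s \<in> e ` Hom A a c \<Longrightarrow> level (component t a) 0 s = level (farr Z (dec s)) 0 z"
  have "level (component t c) 0 (e (Ide A c)) = z"
    using v [OF c imageI [OF Ide_in [OF c]]] sPSh_Ide [OF Z c] level_Ide [OF z] dec_e [OF Ide_in [OF c]] by simp
  then show thesis using t that unfolding repr_def by blast
qed

text \<open>By the Yoneda lemma, a lift of $h_c \to D$ through a trivial fibration $E \to D$ is a lift of one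
vertex of $D(c)$ to $E(c)$.\<close>

lemma cofibrant_repr:
  assumes c: "c \<in> Obj A"
  shows "cofibrant (bousfield_kan A) (repr c)"
proof -
  interpret PA: category "sPSh A" by (rule category_sPSh [OF category_axioms])
  obtain I :: "('o, 'm, 'u) spsh" where I: "is_initial (sPSh A) I"
    using ex_initial_sPSh [OF category_axioms] .
  obtain i where i: "i \<in> Hom (sPSh A) I (repr c)"
    using I repr_in_Obj unfolding is_initial_def by blast
  have "has_lifting (sPSh A) i p" if p: "p \<in> Fib (bousfield_kan A) \<inter> Weq (bousfield_kan A)" for p
  proof -
    obtain E D where pED: "p \<in> Hom (sPSh A) E D" using p Arr_Hom [of p] by auto
    note p' = sPSh_HomD [OF pED]
    note pc = p'(5) [OF c]
    have kan: "kan_fibration (component p c)" and w: "weak_equivalence (component p c)"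
      using p c by simp_all
    show ?thesis
      unfolding has_lifting_def HomD(2,3) [OF pED] HomD(2,3) [OF i]
    proof (intro ballI impI)
      fix u v assume u: "u \<in> Hom (sPSh A) I E" and v: "v \<in> Hom (sPSh A) (repr c) D"
      let ?y = "level (component v c) 0 (e (Ide A c))"
      have Ic: "e (Ide A c) \<in> fobj (fobj (repr c) c) 0" using c Ide_in by simp
      have y: "?y \<in> fobj (fobj D c) 0" by (rule level_in [OF sPSh_HomD(5) [OF v c] Ic])
      then obtain x where x: "x \<in> fobj (fobj E c) 0" "level (component p c) 0 x = ?y"
        using trivial_fibration_surj_on_vertices [OF pc kan w y] by blast
      obtain h where h: "h \<in> Hom (sPSh A) (repr c) E" "level (component h c) 0 (e (Ide A c)) = x"
        using yoneda_ex [OF c p'(1) x(1)] .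
      have "Comp (sPSh A) h i = u"
        using I PA.Comp_in [OF i h(1)] u p'(1) unfolding is_initial_def by blast
      moreover have "Comp (sPSh A) p h = v"
        using level_Comp [OF sPSh_HomD(5) [OF h(1) c] pc Ic] h(2) x(2) c
        by (intro yoneda_eqI [OF c PA.Comp_in [OF h(1) pED] v]) simp
      ultimately show "\<exists>h\<in>Hom (sPSh A) (repr c) E. Comp (sPSh A) h i = u \<and> Comp (sPSh A) p h = v"
        using h(1) by blast
    qed
  qed
  then have "i \<in> Cof (bousfield_kan A)" using HomD(1) [OF i] unfolding bousfield_kan_simps(4) by blast
  then show ?thesis using I i unfolding cofibrant_def bousfield_kan_simps(1) by blast
qed

end

section \<open>Finite limits\<close>

lemma has_finite_limits_terminal:
  assumes "has_finite_limits C"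
  obtains l where "is_terminal C l"
proof -
  define J :: "(nat, nat) cat" where
    "J = \<lparr>Obj = {}, Arr = {}, Dom = id, Cod = id, Ide = id, Comp = \<lambda>g f. g\<rparr>"
  have Hom [simp]: "Hom J x y = {}" for x y by (simp add: Hom_def J_def)
  have Obj [simp]: "Obj J = {}" "Arr J = {}" by (simp_all add: J_def)
  have "finite_category J" by (simp add: finite_category_def category_def)
  moreover have "cat_functor J C \<lparr>fobj = \<lambda>_. undefined, farr = \<lambda>_. undefined\<rparr>"
    by (simp add: cat_functor_def)
  ultimately obtain l p where "is_limit J C \<lparr>fobj = \<lambda>_. undefined, farr = \<lambda>_. undefined\<rparr> l p"
    using assms unfolding has_finite_limits_def by blast
  then have "is_terminal C l" by (simp add: is_limit_def is_cone_def is_terminal_def)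
  then show thesis by (rule that)
qed

text \<open>The shape has objects $0$ and $1$; its arrows $0$ and $1$ are the identities, $2$ and $3$ the
parallel pair.  As both parallel arrows have the target $1$, a composite \<open>b \<circ> a\<close> equals $b$ when $a$ is an identity
and $a$ otherwise.\<close>

lemma has_finite_limits_equalizer:
  assumes C: "category C" and "has_finite_limits C" and f: "f \<in> Hom C x y" and g: "g \<in> Hom C x y"
  obtains l m where "m \<in> Hom C l x" "Comp C f m = Comp C g m"
    "\<And>l' m'. m' \<in> Hom C l' x \<Longrightarrow> Comp C f m' = Comp C g m' \<Longrightarrow> \<exists>!u. u \<in> Hom C l' l \<and> Comp C m u = m'"
proof -
  interpret category C by fact
  note xy = Hom_Obj [OF f]
  define J :: "(nat, nat) cat" where
    "J = \<lparr>Obj = {0, 1}, Arr = {0, 1, 2, 3}, Dom = \<lambda>a. if a = 1 then 1 else 0,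
      Cod = \<lambda>a. if a = 0 then 0 else 1, Ide = id, Comp = \<lambda>b a. if a < 2 then b else a\<rparr>"
  define D where "D = \<lparr>fobj = (\<lambda>j::nat. if j = 0 then x else y),
      farr = (\<lambda>a::nat. if a = 0 then Ide C x else if a = 1 then Ide C y else if a = 2 then f else g)\<rparr>"
  have J [simp]: "Obj J = {0, 1}" "Arr J = {0, 1, 2, 3}" "Dom J a = (if a = 1 then 1 else 0)"
    "Cod J a = (if a = 0 then 0 else 1)" "Ide J a = a" "Comp J b a = (if a < 2 then b else a)" for a b
    by (simp_all add: J_def)
  have HomJ: "a \<in> Hom J i j \<longleftrightarrow> a = 0 \<and> i = 0 \<and> j = 0 \<or> a = 1 \<and> i = 1 \<and> j = 1 \<or>
      (a = 2 \<or> a = 3) \<and> i = 0 \<and> j = 1" for a i j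
    by (auto simp: Hom_def)
  have "category J" by unfold_locales (auto simp: HomJ)
  then have "finite_category J" by (simp add: finite_category_def)
  moreover have "cat_functor J C D"
    by unfold_locales
      (auto simp: HomJ D_def xy f g Ide_in Comp_Ide [OF f] Comp_Ide [OF g] Ide_Comp [OF f] Ide_Comp [OF g]
        Comp_Ide [OF Ide_in])
  ultimately obtain l p where lim: "is_limit J C D l p"
    using assms(2) unfolding has_finite_limits_def by blast
  have cone: "is_cone J C D l' q \<longleftrightarrow> q 0 \<in> Hom C l' x \<and> Comp C f (q 0) = q 1 \<and> Comp C g (q 0) = q 1" for l' q
  proof
    assume "is_cone J C D l' q"
    then show "q 0 \<in> Hom C l' x \<and> Comp C f (q 0) = q 1 \<and> Comp C g (q 0) = q 1"
      by (simp add: is_cone_def D_def)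
  next
    assume q: "q 0 \<in> Hom C l' x \<and> Comp C f (q 0) = q 1 \<and> Comp C g (q 0) = q 1"
    then have q1: "q 1 \<in> Hom C l' y" using Comp_in [of "q 0" l' x f y] f by simp
    show "is_cone J C D l' q"
      using q q1 Hom_Obj [OF q1] Ide_Comp [OF q1] Ide_Comp [of "q 0" l' x] by (simp add: is_cone_def D_def)
  qed
  show thesis
  proof (rule that)
    show "p 0 \<in> Hom C l x" "Comp C f (p 0) = Comp C g (p 0)"
      using lim by (auto simp: is_limit_def cone)
    fix l' m' assume m': "m' \<in> Hom C l' x" "Comp C f m' = Comp C g m'"
    have "is_cone J C D l' (\<lambda>j. if j = 0 then m' else Comp C f m')"
      using m' by (simp add: cone)
    then have ex1: "\<exists>!u. u \<in> Hom C l' l \<and> (\<forall>j\<in>Obj J. Comp C (p j) u = (if j = 0 then m' else Comp C f m'))"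
      using lim unfolding is_limit_def by blast
    have "(\<forall>j\<in>Obj J. Comp C (p j) u = (if j = 0 then m' else Comp C f m')) \<longleftrightarrow> Comp C (p 0) u = m'"
      if u: "u \<in> Hom C l' l" for u
    proof -
      have p: "p 0 \<in> Hom C l x" "p 1 = Comp C f (p 0)" using lim by (auto simp: is_limit_def cone)
      have "Comp C (p 1) u = Comp C f (Comp C (p 0) u)"
        unfolding p(2) by (rule Comp_assoc [OF u p(1) f, symmetric])
      then show ?thesis by auto
    qed
    with ex1 show "\<exists>!u. u \<in> Hom C l' l \<and> Comp C (p 0) u = m'" by (metis (no_types, lifting))
  qed
qed

text \<open>The equalizer of an idempotent $e$ and the identity is the object of fixed points of $e$.\<close>

lemma idempotent_splits:
  assumes C: "category C" and lim: "has_finite_limits C" and e: "e \<in> Hom C c c" and ee: "Comp C e e = e"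
  obtains c' m q where "m \<in> Hom C c' c" "q \<in> Hom C c c'" "Comp C m q = e" "Comp C q m = Ide C c'"
proof -
  interpret category C by fact
  note c = Hom_Obj(1) [OF e]
  obtain l m where m: "m \<in> Hom C l c" "Comp C e m = Comp C (Ide C c) m"
    and univ: "\<And>l' m'. m' \<in> Hom C l' c \<Longrightarrow> Comp C e m' = Comp C (Ide C c) m' \<Longrightarrow>
      \<exists>!u. u \<in> Hom C l' l \<and> Comp C m u = m'"
    by (rule has_finite_limits_equalizer [OF C lim e Ide_in [OF c]]) (rule that)
  have em: "Comp C e m = m" using m(2) Ide_Comp [OF m(1)] by simp
  obtain q where q: "q \<in> Hom C c l" "Comp C m q = e"
    using ex1_implies_ex [OF univ [OF e]] ee Ide_Comp [OF e] by auto
  have l: "l \<in> Obj C" using Hom_Obj [OF m(1)] by simp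
  have "Comp C m (Comp C q m) = m" using Comp_assoc [OF m(1) q(1) m(1)] q(2) em by simp
  moreover have "Comp C m (Ide C l) = m" by (rule Comp_Ide [OF m(1)])
  ultimately have "Comp C q m = Ide C l"
    using Comp_in [OF m(1) q(1)] Ide_in [OF l] by (intro ex1_unique [OF univ [OF m]]) simp_all
  then show thesis using that m(1) q by blast
qed

text \<open>A retract of $Fc$ corresponds to an idempotent of $c$ because $F$ is fully faithful.  Both
$b$ and the image of the splitting object split the same idempotent of $Fc$, so they are
isomorphic.\<close>

lemma retracts_imp_essentially_surjective:
  assumes C: "category C" and B: "category B" and F: "cat_functor C B F" and ff: "fully_faithful C B F"
    and lim: "has_finite_limits C"
    and retract: "\<And>b. b \<in> Obj B \<Longrightarrow> \<exists>c\<in>Obj C. \<exists>s\<in>Hom B b (fobj F c). \<exists>r\<in>Hom B (fobj F c) b. Comp B r s = Ide B b"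
  shows "essentially_surjective C B F"
  unfolding essentially_surjective_def
proof
  interpret C: category C by fact
  interpret B: category B by fact
  interpret F: cat_functor C B F by fact
  fix b assume b: "b \<in> Obj B"
  obtain c s r where c: "c \<in> Obj C" and s: "s \<in> Hom B b (fobj F c)" and r: "r \<in> Hom B (fobj F c) b"
    and rs: "Comp B r s = Ide B b" using retract [OF b] by blast
  have sr: "Comp B s r \<in> Hom B (fobj F c) (fobj F c)" by (rule B.Comp_in [OF r s])
  obtain e where e: "e \<in> Hom C c c" "farr F e = Comp B s r" using fully_faithful_surj [OF ff c c sr] .
  have srs: "Comp B (Comp B s r) s = s"
    using B.Comp_assoc [OF s r s] rs B.Comp_Ide [OF s] by simp
  have "Comp B (Comp B s r) (Comp B s r) = Comp B s r"
    using B.Comp_assoc [OF r s sr] srs by simp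
  then have "Comp C e e = e"
    using F.farr_Comp [OF e(1) e(1)] e(2) by (intro fully_faithful_inj [OF C ff C.Comp_in [OF e(1) e(1)] e(1)]) simp
  then obtain c' m q where m: "m \<in> Hom C c' c" and q: "q \<in> Hom C c c'" and mq: "Comp C m q = e"
    and qm: "Comp C q m = Ide C c'"
    using idempotent_splits [OF C lim e(1)] by blast
  note Fm = F.farr_in [OF m] and Fq = F.farr_in [OF q]
  have c': "c' \<in> Obj C" using C.Hom_Obj [OF m] by simp
  have FmFq: "Comp B (farr F m) (farr F q) = Comp B s r"
    using F.farr_Comp [OF q m] mq e(2) by simp
  have FqFm: "Comp B (farr F q) (farr F m) = Ide B (fobj F c')"
    using F.farr_Comp [OF m q] qm F.farr_Ide [OF c'] by simp
  have h: "Comp B (farr F q) s \<in> Hom B b (fobj F c')" and k: "Comp B r (farr F m) \<in> Hom B (fobj F c') b"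
    using B.Comp_in [OF s Fq] B.Comp_in [OF Fm r] by simp_all
  have "is_iso B (Comp B (farr F q) s)"
  proof (rule is_isoI [OF h k])
    have "Comp B (Comp B r (farr F m)) (Comp B (farr F q) s) = Comp B r (Comp B (Comp B (farr F m) (farr F q)) s)"
      using B.Comp_assoc [OF h Fm r] B.Comp_assoc [OF s Fq Fm] by simp
    then show "Comp B (Comp B r (farr F m)) (Comp B (farr F q) s) = Ide B b"
      using FmFq srs rs by simp
    have "Comp B (Comp B (farr F q) s) (Comp B r (farr F m)) = Comp B (farr F q) (Comp B (Comp B s r) (farr F m))"
      using B.Comp_assoc [OF k s Fq] B.Comp_assoc [OF Fm r s] by simp
    also have "\<dots> = Comp B (farr F q) (Comp B (farr F m) (Comp B (farr F q) (farr F m)))"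
      using FmFq B.Comp_assoc [OF Fm Fq Fm] by simp
    also have "\<dots> = Ide B (fobj F c')"
      using FqFm B.Comp_Ide [OF Fm] by simp
    finally show "Comp B (Comp B (farr F q) s) (Comp B r (farr F m)) = Ide B (fobj F c')" .
  qed
  then show "\<exists>c\<in>Obj C. \<exists>h\<in>Hom B b (fobj F c). is_iso B h" using c' h by blast
qed

section \<open>Universal equivalences\<close>

text \<open>The hom-sets of both categories are encoded in the universe, so that representable presheaves
exist on either side.  The hypothesis supplies the adjunction, and with it the universal
property of $F_*$, from which everything here is derived.\<close>

locale encoded_universal_equivalence =
  C: encoded_category C eC + B: encoded_category B eB + F: cat_functor C B F
  for C :: "('c, 'k) cat" and eC :: "'k \<Rightarrow> 'u" and B :: "('b, 'l) cat" and eB :: "'l \<Rightarrow> 'u"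
    and F :: "('c, 'k, 'b, 'l) ftor" +
  assumes UE: "universal_equivalence TYPE('u) C B F"
begin

sublocale PC: category "sPSh C" by (rule category_sPSh [OF C.category_axioms])
sublocale PB: category "sPSh B" by (rule category_sPSh [OF B.category_axioms])

abbreviation L ::
  "(('c, 'k, 'u) spsh, ('c, 'k, 'u) spsh_map, ('b, 'l, 'u) spsh, ('b, 'l, 'u) spsh_map) ftor" where
  "L \<equiv> lan C B F"

abbreviation R ::
  "(('b, 'l, 'u) spsh, ('b, 'l, 'u) spsh_map, ('c, 'k, 'u) spsh, ('c, 'k, 'u) spsh_map) ftor" where
  "R \<equiv> restr C B F"

abbreviation \<eta> :: "('c, 'k, 'u) spsh \<Rightarrow> ('c, 'k, 'u) spsh_map" where
  "\<eta> \<equiv> lan_unit C B F"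

lemma adj: "adjunction (sPSh C) (sPSh B) L R \<eta>"
  using UE by (simp add: universal_equivalence_def quillen_equivalence_def quillen_adjunction_def)

lemmas adjD = adjunctionD [OF adj]

lemma weq_iff:
  assumes "cofibrant (bousfield_kan C) X" "fibrant (bousfield_kan B) Y" "f \<in> Hom (sPSh B) (fobj L X) Y"
  shows "f \<in> Weq (bousfield_kan B) \<longleftrightarrow> adjunct (sPSh C) R \<eta> X f \<in> Weq (bousfield_kan C)"
  using UE assms unfolding universal_equivalence_def quillen_equivalence_def bousfield_kan_simps(1) by blast

lemma ex_adjunct:
  assumes "X \<in> Obj (sPSh C)" "Y \<in> Obj (sPSh B)" "t \<in> Hom (sPSh C) X (fobj R Y)"
  obtains f where "f \<in> Hom (sPSh B) (fobj L X) Y" "adjunct (sPSh C) R \<eta> X f = t"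
proof -
  have "t \<in> adjunct (sPSh C) R \<eta> X ` Hom (sPSh B) (fobj L X) Y"
    using assms(3) unfolding bij_betw_imp_surj_on [OF adjD(5) [OF assms(1,2)]] .
  then show thesis using that by blast
qed

lemma R_fobj_in: "Y \<in> Obj (sPSh B) \<Longrightarrow> fobj R Y \<in> Obj (sPSh C)"
  by (rule restr_fobj_in_Obj [OF C.category_axioms F.cat_functor_axioms])

lemma fibrant_repr: "fibrant (bousfield_kan B) (B.repr b)"
  unfolding B.repr_def by (rule B.repr.fibrant_disc_presheaf)

text \<open>Both $F_*h_c$ and $h_{Fc}$ represent the functor $Y \mapsto Y(Fc)_0$, the former because of
$Y(Fc)_0 = (F^*Y)(c)_0$.  The last two equations record that the isomorphism matches the generic
elements.\<close>

lemma ex_lan_repr_iso: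
  assumes c: "c \<in> Obj C"
  obtains f g where "f \<in> Hom (sPSh B) (fobj L (C.repr c)) (B.repr (fobj F c))"
    "g \<in> Hom (sPSh B) (B.repr (fobj F c)) (fobj L (C.repr c))"
    "Comp (sPSh B) g f = Ide (sPSh B) (fobj L (C.repr c))"
    "Comp (sPSh B) f g = Ide (sPSh B) (B.repr (fobj F c))"
    "level (component (adjunct (sPSh C) R \<eta> (C.repr c) f) c) 0 (eC (Ide C c)) = eB (Ide B (fobj F c))"
    "level (component g (fobj F c)) 0 (eB (Ide B (fobj F c))) = level (component (\<eta> (C.repr c)) c) 0 (eC (Ide C c))"
proof -
  interpret L: cat_functor "sPSh C" "sPSh B" L by (rule adjD(1))
  interpret R: cat_functor "sPSh B" "sPSh C" R by (rule adjD(2))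
  let ?X = "C.repr c" and ?Y = "B.repr (fobj F c)"
  note X = C.repr_in_Obj [of c] and Y = B.repr_in_Obj [of "fobj F c"] and Fc = F.fobj_in [OF c]
  note LX = L.fobj_in [OF X]
  have 1: "eC (Ide C c) \<in> fobj (fobj ?X c) 0" using c C.Ide_in by simp
  have 2: "eB (Ide B (fobj F c)) \<in> fobj (fobj ?Y (fobj F c)) 0" using Fc B.Ide_in by simp
  have RY: "eB (Ide B (fobj F c)) \<in> fobj (fobj (fobj R ?Y) c) 0" using 2 c by simp
  obtain t where t: "t \<in> Hom (sPSh C) ?X (fobj R ?Y)"
    "level (component t c) 0 (eC (Ide C c)) = eB (Ide B (fobj F c))"
    using C.yoneda_ex [OF c R_fobj_in [OF Y] RY] .
  obtain f where f: "f \<in> Hom (sPSh B) (fobj L ?X) ?Y" "adjunct (sPSh C) R \<eta> ?X f = t"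
    using ex_adjunct [OF X Y t(1)] .
  let ?y = "level (component (\<eta> ?X) c) 0 (eC (Ide C c))"
  have \<eta>c: "component (\<eta> ?X) c \<in> Hom sSet (fobj ?X c) (fobj (fobj L ?X) (fobj F c))"
    using sPSh_HomD(5) [OF adjD(3) [OF X] c] c by simp
  have y: "?y \<in> fobj (fobj (fobj L ?X) (fobj F c)) 0"
    by (rule level_in [OF \<eta>c 1])
  obtain g where g: "g \<in> Hom (sPSh B) ?Y (fobj L ?X)"
    "level (component g (fobj F c)) 0 (eB (Ide B (fobj F c))) = ?y"
    using B.yoneda_ex [OF Fc LX y] .
  note fF = sPSh_HomD(5) [OF f(1) Fc] and gF = sPSh_HomD(5) [OF g(1) Fc]
  have fy: "level (component f (fobj F c)) 0 ?y = eB (Ide B (fobj F c))"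
    using t(2) level_Comp [OF \<eta>c fF 1] c unfolding f(2) [symmetric] by (simp add: adjunct_def)
  have fg: "Comp (sPSh B) f g = Ide (sPSh B) ?Y"
    using level_Comp [OF gF fF 2] g(2) fy level_Ide [OF 2] Fc
    by (intro B.yoneda_eqI [OF Fc PB.Comp_in [OF g(1) f(1)] PB.Ide_in [OF Y]]) simp
  have gf_in: "Comp (sPSh B) g f \<in> Hom (sPSh B) (fobj L ?X) (fobj L ?X)"
    and id_in: "Ide (sPSh B) (fobj L ?X) \<in> Hom (sPSh B) (fobj L ?X) (fobj L ?X)"
    by (rule PB.Comp_in [OF f(1) g(1)], rule PB.Ide_in [OF LX])
  have "adjunct (sPSh C) R \<eta> ?X (Comp (sPSh B) g f) = \<eta> ?X"
  proof (rule C.yoneda_eqI [OF c _ adjD(3) [OF X]])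
    have eq: "adjunct (sPSh C) R \<eta> ?X (Comp (sPSh B) g f) = Comp (sPSh C) (farr R g) t"
      using adjunct_Comp_right [OF PC.category_axioms adj X f(1) g(1)] f(2) by simp
    show "adjunct (sPSh C) R \<eta> ?X (Comp (sPSh B) g f) \<in> Hom (sPSh C) ?X (fobj R (fobj L ?X))"
      unfolding eq by (rule PC.Comp_in [OF t(1) R.farr_in [OF g(1)]])
    have tc: "component t c \<in> Hom sSet (fobj ?X c) (fobj ?Y (fobj F c))"
      using sPSh_HomD(5) [OF t(1) c] c by simp
    show "level (component (adjunct (sPSh C) R \<eta> ?X (Comp (sPSh B) g f)) c) 0 (eC (Ide C c)) = ?y"
      unfolding eq using level_Comp [OF tc gF 1] t(2) g(2) c by simp
  qed
  moreover have "adjunct (sPSh C) R \<eta> ?X (Ide (sPSh B) (fobj L ?X)) = \<eta> ?X"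
    using R.farr_Ide [OF LX] PC.Ide_Comp [OF adjD(3) [OF X]] by (simp only: adjunct_def)
  ultimately have gf: "Comp (sPSh B) g f = Ide (sPSh B) (fobj L ?X)"
    using inj_onD [OF bij_betw_imp_inj_on [OF adjD(5) [OF X LX]] _ gf_in id_in] by simp
  show thesis
    using that [OF f(1) g(1) gf fg _ g(2)] t(2) f(2) by simp
qed

text \<open>Every element of the representable presheaf $h_{Fc}$ is a restriction of the identity of $Fc$.\<close>

lemma lan_repr_generated:
  assumes c: "c \<in> Obj C" and b: "b \<in> Obj B" and z: "z \<in> fobj (fobj (fobj L (C.repr c)) b) 0"
  obtains h where "h \<in> Hom B b (fobj F c)"
    "z = level (farr (fobj L (C.repr c)) h) 0 (level (component (\<eta> (C.repr c)) c) 0 (eC (Ide C c)))"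
proof -
  obtain f g where f: "f \<in> Hom (sPSh B) (fobj L (C.repr c)) (B.repr (fobj F c))"
    and g: "g \<in> Hom (sPSh B) (B.repr (fobj F c)) (fobj L (C.repr c))"
    and gf: "Comp (sPSh B) g f = Ide (sPSh B) (fobj L (C.repr c))"
    and gI: "level (component g (fobj F c)) 0 (eB (Ide B (fobj F c))) = level (component (\<eta> (C.repr c)) c) 0 (eC (Ide C c))"
    using ex_lan_repr_iso [OF c] .
  note fb = sPSh_HomD(5) [OF f b] and gb = sPSh_HomD(5) [OF g b]
  have "level (component f b) 0 z \<in> eB ` Hom B b (fobj F c)"
    using level_in [OF fb z] b by simp
  then obtain h where h: "h \<in> Hom B b (fobj F c)" "level (component f b) 0 z = eB h" by blast
  have "z = level (component (Comp (sPSh B) g f) b) 0 z"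
    unfolding gf using b level_Ide [OF z] by simp
  also have "\<dots> = level (component g b) 0 (eB h)"
    using level_Comp [OF fb gb z] b h(2) by simp
  finally show thesis
    using that h(1) B.yoneda_value [OF g h(1)] gI by simp
qed

text \<open>The map $h_c \to F^*h_{Fc}$ adjunct to the isomorphism $F_*h_c \cong h_{Fc}$ is given by the
action of $F$ on arrows.  At each $c'$ it is a weak equivalence of discrete simplicial sets, and
these are bijections by the two lemmas on components.\<close>

lemma fully_faithful: "fully_faithful C B F"
  unfolding fully_faithful_def
proof (intro ballI)
  fix c' c assume c': "c' \<in> Obj C" and c: "c \<in> Obj C"
  let ?X = "C.repr c" and ?Y = "B.repr (fobj F c)"
  note X = C.repr_in_Obj [of c] and Y = B.repr_in_Obj [of "fobj F c"] and Fc = F.fobj_in [OF c]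
  note Fc' = F.fobj_in [OF c']
  obtain f g where f: "f \<in> Hom (sPSh B) (fobj L ?X) ?Y" and g: "g \<in> Hom (sPSh B) ?Y (fobj L ?X)"
    and gf: "Comp (sPSh B) g f = Ide (sPSh B) (fobj L ?X)" and fg: "Comp (sPSh B) f g = Ide (sPSh B) ?Y"
    and fI: "level (component (adjunct (sPSh C) R \<eta> ?X f) c) 0 (eC (Ide C c)) = eB (Ide B (fobj F c))"
    using ex_lan_repr_iso [OF c] .
  have iso: "is_iso (sPSh B) f" by (rule is_isoI [OF f g gf fg])
  have "f \<in> Weq (bousfield_kan B)"
    using is_iso_weak_equivalence [OF sPSh_HomD(5) [OF f]]
      is_iso_functor_cat_component [of f "op_cat B" sSet] iso f HomD(1) [OF f] by (simp add: sPSh_def)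
  then have w: "adjunct (sPSh C) R \<eta> ?X f \<in> Weq (bousfield_kan C)"
    using weq_iff [OF C.cofibrant_repr [OF c] fibrant_repr f] by simp
  let ?t = "adjunct (sPSh C) R \<eta> ?X f"
  have t: "?t \<in> Hom (sPSh C) ?X (fobj R ?Y)"
    using bij_betwE [OF adjD(5) [OF X Y]] f by blast
  have tc': "component ?t c' \<in> Hom sSet (disc (eC ` Hom C c' c)) (disc (eB ` Hom B (fobj F c') (fobj F c)))"
    using sPSh_HomD(5) [OF t c'] c' Fc' by simp
  have wc': "weak_equivalence (component ?t c')" using w c' by simp
  have val: "level (component ?t c') 0 (eC k) = eB (farr F k)" if k: "k \<in> Hom C c' c" for k
  proof -
    have "level (component ?t c') 0 (eC k) = level (farr (fobj R ?Y) k) 0 (eB (Ide B (fobj F c)))"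
      using C.yoneda_value [OF t k] fI by simp
    also have "\<dots> = eB (farr F k)"
      using B.repr_farr [OF F.farr_in [OF k] B.Ide_in [OF Fc]] B.Ide_Comp [OF F.farr_in [OF k]] HomD(1) [OF k]
      by simp
    finally show ?thesis .
  qed
  show "bij_betw (farr F) (Hom C c' c) (Hom B (fobj F c') (fobj F c))"
  proof (rule bij_betwI')
    fix k k' assume k: "k \<in> Hom C c' c" "k' \<in> Hom C c' c"
    show "farr F k = farr F k' \<longleftrightarrow> k = k'"
    proof
      assume "farr F k = farr F k'"
      then have "eC k = eC k'"
        using inj_onD [OF weak_equivalence_from_disc_inj [OF tc' wc'], of "eC k" "eC k'"] k val by simp
      then show "k = k'" using C.dec_e k by metis
    qed simp
  next
    fix h assume h: "h \<in> Hom B (fobj F c') (fobj F c)"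
    then obtain x where "x \<in> eC ` Hom C c' c" "level (component ?t c') 0 x = eB h"
      using weak_equivalence_to_disc_surj [OF tc' wc', of "eB h"] by auto
    then obtain k where k: "k \<in> Hom C c' c" "eB (farr F k) = eB h" using val by auto
    then have "farr F k = h" using B.dec_e F.farr_in h by metis
    then show "\<exists>k\<in>Hom C c' c. h = farr F k" using k(1) by blast
  qed (rule F.farr_in)
qed

definition factors_through_F :: "'l \<Rightarrow> bool" where
  "factors_through_F h \<longleftrightarrow> (\<exists>c\<in>Obj C. \<exists>s\<in>Hom B (Dom B h) (fobj F c). \<exists>r\<in>Hom B (fobj F c) (Cod B h). h = Comp B r s)"

lemma factors_through_F_Comp:
  assumes "factors_through_F h" "h \<in> Hom B d b" "k \<in> Hom B d' d"
  shows "factors_through_F (Comp B h k)"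
proof -
  obtain c s r where c: "c \<in> Obj C" and s: "s \<in> Hom B d (fobj F c)" and r: "r \<in> Hom B (fobj F c) b" "h = Comp B r s"
    using assms(1) HomD [OF assms(2)] unfolding factors_through_F_def by blast
  have "Comp B h k = Comp B r (Comp B s k)" using B.Comp_assoc [OF assms(3) s r(1)] r(2) by simp
  then show ?thesis
    using c B.Comp_in [OF assms(3) s] r(1) HomD(2,3) [OF B.Comp_in [OF assms(3,2)]] unfolding factors_through_F_def by blast
qed

lemma arrow_from_image_factors:
  assumes c: "c \<in> Obj C" and h: "h \<in> Hom B (fobj F c) b"
  shows "factors_through_F h"
  using c B.Comp_Ide [OF h] B.Ide_in [OF F.fobj_in [OF c]] h HomD(2,3) [OF h] unfolding factors_through_F_def by metis

text \<open>$P$ is $h_b$ with the arrows that factor through the image of $F$ collapsed to \<open>star\<close>.  Over an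
object $Fc$ every arrow factors, so only \<open>star\<close> remains there.\<close>

lemma retract:
  assumes star: "star \<notin> eB ` Arr B" and T: "is_terminal C T" and b: "b \<in> Obj B"
  shows "\<exists>c\<in>Obj C. \<exists>s\<in>Hom B b (fobj F c). \<exists>r\<in>Hom B (fobj F c) b. Comp B r s = Ide B b"
proof -
  define P where "P d = insert star (eB ` {h \<in> Hom B d b. \<not> factors_through_F h})" for d
  define \<rho> where "\<rho> k u = (if u = star \<or> factors_through_F (Comp B (B.dec u) k) then star else eB (Comp B (B.dec u) k))" for k u
  have eB_star: "eB h \<noteq> star" if "h \<in> Hom B d d'" for h d d' using star HomD(1) [OF that] by blast
  have \<rho>_star: "\<rho> k star = star" for k by (simp add: \<rho>_def)
  have \<rho>_e: "\<rho> k (eB h) = (if factors_through_F (Comp B h k) then star else eB (Comp B h k))" if "h \<in> Hom B d b" for k h d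
    using eB_star [OF that] B.dec_e [OF that] by (simp add: \<rho>_def)
  interpret Y: set_presheaf B P \<rho>
  proof
    fix k d d' x assume k: "k \<in> Hom B d d'" and x: "x \<in> P d'"
    show "\<rho> k x \<in> P d"
      using x B.Comp_in [OF k] by (auto simp: P_def \<rho>_star \<rho>_e)
  next
    fix k d d' k' d'' y assume k: "k \<in> Hom B d d'" and k': "k' \<in> Hom B d' d''" and y: "y \<in> P d''"
    show "\<rho> (Comp B k' k) y = \<rho> k (\<rho> k' y)"
    proof (cases "y = star")
      case False
      then obtain h where h: "y = eB h" "h \<in> Hom B d'' b" using y by (auto simp: P_def)
      note hk' = B.Comp_in [OF k' h(2)]
      show ?thesis
        using factors_through_F_Comp [OF _ hk' k] B.Comp_assoc [OF k k' h(2)] h(1)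
        by (simp add: \<rho>_e [OF h(2)] \<rho>_star \<rho>_e [OF hk'])
    qed (simp add: \<rho>_star)
  next
    fix d x assume d: "d \<in> Obj B" and x: "x \<in> P d"
    show "\<rho> (Ide B d) x = x"
      using x B.Comp_Ide by (auto simp: P_def \<rho>_star \<rho>_e)
  qed
  have P_F: "P (fobj F c) = {star}" if "c \<in> Obj C" for c
    using arrow_from_image_factors [OF that] by (auto simp: P_def)
  have T_Obj: "T \<in> Obj C" using T by (simp add: is_terminal_def)
  note Y = Y.disc_presheaf_in_Obj and X = C.repr_in_Obj [of T] and FT = F.fobj_in [OF T_Obj]
  have "star \<in> fobj (fobj (fobj R Y.D) T) 0" using T_Obj FT P_F by simp
  then obtain t where t: "t \<in> Hom (sPSh C) (C.repr T) (fobj R Y.D)"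
    using C.yoneda_ex [OF T_Obj R_fobj_in [OF Y]] by metis
  obtain f where f: "f \<in> Hom (sPSh B) (fobj L (C.repr T)) Y.D" "adjunct (sPSh C) R \<eta> (C.repr T) f = t"
    using ex_adjunct [OF X Y t] .
  have "weak_equivalence (component t c)" if c: "c \<in> Obj C" for c
  proof -
    obtain k where "k \<in> Hom C c T" "\<And>k'. k' \<in> Hom C c T \<Longrightarrow> k' = k"
      using T c unfolding is_terminal_def by blast
    then have "Hom C c T = {k}" by blast
    then have tc: "component t c \<in> Hom sSet (disc {eC k}) (disc {star})"
      using sPSh_HomD(5) [OF t c] c F.fobj_in [OF c] P_F [OF c] by simp
    have "bij_betw (level (component t c) n) {eC k} {star}" for n
      using level_in [OF tc, of "eC k" n] by (simp add: bij_betw_def)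
    then show ?thesis
      by (intro is_iso_weak_equivalence [OF tc is_iso_sSet_map [OF tc]]) simp
  qed
  then have "t \<in> Weq (bousfield_kan C)" using HomD(1) [OF t] by simp
  then have "f \<in> Weq (bousfield_kan B)"
    using weq_iff [OF C.cofibrant_repr [OF T_Obj] Y.fibrant_disc_presheaf f(1)] f(2) by simp
  then have w: "weak_equivalence (component f b)" using b by simp
  have fb: "component f b \<in> Hom sSet (fobj (fobj L (C.repr T)) b) (disc (P b))"
    using sPSh_HomD(5) [OF f(1) b] b by simp
  \<comment> \<open>Otherwise the identity of $b$ is an element of $P(b)$ other than \<open>star\<close>, but the image of
    $F_*h_T$ consists of restrictions of \<open>star\<close>.\<close>
  have "factors_through_F (Ide B b)"
  proof (rule ccontr)
    assume "\<not> factors_through_F (Ide B b)"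
    then have "eB (Ide B b) \<in> P b" using B.Ide_in [OF b] by (simp add: P_def)
    then obtain z where z: "z \<in> fobj (fobj (fobj L (C.repr T)) b) 0" "level (component f b) 0 z = eB (Ide B b)"
      using weak_equivalence_to_disc_surj [OF fb w] by blast
    let ?y = "level (component (\<eta> (C.repr T)) T) 0 (eC (Ide C T))"
    obtain h where h: "h \<in> Hom B b (fobj F T)" "z = level (farr (fobj L (C.repr T)) h) 0 ?y"
      using lan_repr_generated [OF T_Obj b z(1)] .
    have "component (\<eta> (C.repr T)) T \<in> Hom sSet (fobj (C.repr T) T) (fobj (fobj L (C.repr T)) (fobj F T))"
      using sPSh_HomD(5) [OF adjD(3) [OF X] T_Obj] T_Obj by simp
    then have y: "?y \<in> fobj (fobj (fobj L (C.repr T)) (fobj F T)) 0"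
      by (rule level_in) (simp add: T_Obj C.Ide_in)
    note fF = sPSh_HomD(5) [OF f(1) FT] and Lh = sPSh_arr_in [OF sPSh_HomD(1) [OF f(1)] h(1)]
    have "level (component f (fobj F T)) 0 ?y = star"
      using level_in [OF fF y] FT P_F [OF T_Obj] by simp
    moreover have "level (component f b) 0 z = level (farr Y.D h) 0 (level (component f (fobj F T)) 0 ?y)"
      using sPSh_HomD(6) [OF f(1) h(1)] level_Comp [OF Lh sPSh_HomD(5) [OF f(1) b] y]
        level_Comp [OF fF sPSh_arr_in [OF Y h(1)] y] h(2) by simp
    ultimately have "eB (Ide B b) = star"
      using z(2) level_disc_presheaf [OF h(1), of star P \<rho> 0] P_F [OF T_Obj] \<rho>_star by simp
    then show False using eB_star [OF B.Ide_in [OF b]] by simp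
  qed
  then show ?thesis
    unfolding factors_through_F_def HomD(2,3) [OF B.Ide_in [OF b]] by metis
qed

end

theorem corollary1p9:
  fixes C :: "('c, 'k) cat" and B :: "('b, 'l) cat" and F :: "('c, 'k, 'b, 'l) ftor"
  assumes "infinite (UNIV :: 'u set)"
    and "category C" and "small TYPE('u) C"
    and "category B" and "small TYPE('u) B"
    and "cat_functor C B F"
    and "has_finite_limits C"
    and "preserves_finite_limits C B F"
  shows "equivalence_of_categories C B F \<longleftrightarrow> universal_equivalence TYPE('u) C B F"
proof
  assume UE: "universal_equivalence TYPE('u) C B F"
  obtain eC :: "'k \<Rightarrow> 'u" where eC: "inj_on eC (Arr C)"
    using assms(3) by (auto simp: small_def lepoll_def)
  obtain i :: "'l \<Rightarrow> 'u" where i: "inj_on i (Arr B)"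
    using assms(5) by (auto simp: small_def lepoll_def)
  \<comment> \<open>An infinite universe has room for an element \<open>star\<close> that encodes no arrow of $B$.\<close>
  obtain star and \<sigma> where \<sigma>: "bij_betw \<sigma> (UNIV :: 'u set) (UNIV - {star :: 'u})"
    using infinite_imp_bij_betw [OF assms(1)] by blast
  then have "inj \<sigma>" "star \<notin> range \<sigma>" by (auto simp: bij_betw_def)
  then have eB: "inj_on (\<sigma> \<circ> i) (Arr B)" and star: "star \<notin> (\<sigma> \<circ> i) ` Arr B"
    using i by (auto intro: comp_inj_on inj_on_subset)
  interpret encoded_universal_equivalence C eC B "\<sigma> \<circ> i" F
    using assms(2,4,6) UE eC eB
    by (intro encoded_universal_equivalence.intro encoded_category.intro encoded_category_axioms.intro
        encoded_universal_equivalence_axioms.intro)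
  obtain T where T: "is_terminal C T" using has_finite_limits_terminal [OF assms(7)] .
  have "essentially_surjective C B F"
    by (rule retracts_imp_essentially_surjective [OF assms(2,4,6) fully_faithful assms(7) retract [OF star T]])
  then show "equivalence_of_categories C B F"
    by (rule equivalence_of_categoriesI [OF assms(2,4,6) fully_faithful])
qed (rule equivalence_imp_universal_equivalence [OF assms(2,4)])

end
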